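(* Let $\alpha(t)=(y_1(t),y_2(t))$ be a solution of $$\ddot y_1=\frac{\partial\omega}{\partial y_1}+2\dot y_2,\qquad \ddot y_2=\frac{\partial\omega}{\partial y_2}-2\dot y_1$$ with Jacobian integral equal to $C$. Assume that $\alpha$ is $T$-periodic and $n$-simple around $(-\mu,0)$ with lifting $\beta(t)$. Let $f=\sqrt{2\omega-C}$, let $\tilde\Omega$ be the region enclosed by $\beta$, and let $\tilde h=\ln\tilde f$ with $\tilde f=f\circ\phi$, where $$\phi(z_1,z_2)=(\mathrm{Re}\,\xi(z_1,z_2),\mathrm{Im}\,\xi(z_1,z_2)),\qquad \xi(z_1,z_2)=-\mu+(z_1+\mu+i z_2)^n .$$ Then: - if $\beta$ goes clockwise around $\tilde\Omega$ and $\phi(\tilde\Omega)$ is contained in $U_C\cup\{(-\mu,0)\}$, then $\displaystyle 2T=n\pi+\iint_{\tilde\Omega}\Delta\tilde h\,dz_1dz_2$; - if $\beta$ goes counterclockwise around $\tilde\Omega$ and $\phi(\tilde\Omega)$ is contained in $U_C\cup\{(-\mu,0)\}$, then $\displaystyle 2T=-n\pi-\iint_{\tilde\Omega}\Delta\tilde h\,dz_1dz_2$.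
   Context: Fix a real number $\mu$ with $0<\mu\le \frac12$ (mass parameter of the planar circular restricted three body problem, in rotating coordinates). On $\mathbb{R}^2\setminus\{(-\mu,0),(1-\mu,0)\}$ define $$\omega(y_1,y_2)=\frac12(y_1^2+y_2^2)+\frac{1-\mu}{\sqrt{(y_1+\mu)^2+y_2^2}}+\frac{\mu}{\sqrt{(y_1+\mu-1)^2+y_2^2}}.$$ For every solution of the differential equation the quantity $-\dot y_1^2-\dot y_2^2+2\omega(y_1,y_2)$ is a constant $C$, called its Jacobian integral. For a constant $C$, $U_C=\{(y_1,y_2): 2\omega(y_1,y_2)-C\ge 0\}$, where the two points $(-\mu,0)$ and $(1-\mu,0)$ (at which $\omega$ is undefined) are not considered part of $U_C$. Definition ($n$ a positive integer). A closed curve $\alpha:[0,T]\to\mathbb{R}^2$, $\alpha(t)=(z_1(t),z_2(t))$, is $n$-simple around the point $p=(u,v)$ if there is a simple regular closed curve $\beta:[0,T]\to\mathbb{R}^2$, $\beta(t)=(w_1(t),w_2(t))$, going around $p$ (that is, the region enclosed by $\beta$ contains $p$), such that, identifying $(x,y)$ with $x+iy$, $$(u+iv)+\big((w_1(t)-u)+i(w_2(t)-v)\big)^n=z_1(t)+i z_2(t)\quad\text{for all } t.$$ The curve $\beta$ is called the lifting of $\alpha$. Regular means the derivative never vanishes. The region enclosed by a simple closed curve is the bounded component of its complement. $\Delta=\partial_{z_1}^2+\partial_{z_2}^2$; $\tilde h$ is not defined at $(-\mu,0)$, and the integral over $\tilde\Omega$ is over $\tilde\Omega$ minus this point. *)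

theory Defs
  imports "HOL-Complex_Analysis.Complex_Analysis"
begin

text \<open>
  The plane \<open>\<real>\<^sup>2\<close> is represented by the type \<^typ>\<open>complex\<close>; the point \<open>(x, y)\<close> is \<open>x + iy\<close>.
  In particular the primaries are the complex numbers \<open>- \<mu>\<close> and \<open>1 - \<mu>\<close>, and area integrals are
  integrals over subsets of \<^typ>\<open>complex\<close> with respect to Lebesgue measure.
\<close>

definition partial_deriv :: "complex \<Rightarrow> (complex \<Rightarrow> real) \<Rightarrow> complex \<Rightarrow> real" where
  "partial_deriv v h z = deriv (\<lambda>s::real. h (z + of_real s * v)) 0"

definition laplacian :: "(complex \<Rightarrow> real) \<Rightarrow> complex \<Rightarrow> real" where
  "laplacian h z =
     partial_deriv 1 (partial_deriv 1 h) z + partial_deriv \<i> (partial_deriv \<i> h) z"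

definition primaries :: "real \<Rightarrow> complex set" where
  "primaries \<mu> = {complex_of_real (- \<mu>), complex_of_real (1 - \<mu>)}"

text \<open>At the primaries the value of \<open>omega\<close> is an artefact of \<open>x / 0 = 0\<close>; it is never used there.\<close>

definition omega :: "real \<Rightarrow> complex \<Rightarrow> real" where
  "omega \<mu> y = 1 / 2 * ((Re y)\<^sup>2 + (Im y)\<^sup>2)
     + (1 - \<mu>) / sqrt ((Re y + \<mu>)\<^sup>2 + (Im y)\<^sup>2)
     + \<mu> / sqrt ((Re y + \<mu> - 1)\<^sup>2 + (Im y)\<^sup>2)"

definition velocity :: "(real \<Rightarrow> complex) \<Rightarrow> real \<Rightarrow> complex" where
  "velocity \<alpha> t = vector_derivative \<alpha> (at t)"

definition is_solution :: "real \<Rightarrow> (real \<Rightarrow> complex) \<Rightarrow> bool" where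
  "is_solution \<mu> \<alpha> \<longleftrightarrow>
     (\<forall>t. \<alpha> t \<notin> primaries \<mu> \<and> \<alpha> differentiable (at t) \<and> velocity \<alpha> differentiable (at t) \<and>
          Re (velocity (velocity \<alpha>) t) = partial_deriv 1 (omega \<mu>) (\<alpha> t) + 2 * Im (velocity \<alpha> t) \<and>
          Im (velocity (velocity \<alpha>) t) = partial_deriv \<i> (omega \<mu>) (\<alpha> t) - 2 * Re (velocity \<alpha> t))"

definition has_jacobian_integral :: "real \<Rightarrow> (real \<Rightarrow> complex) \<Rightarrow> real \<Rightarrow> bool" where
  "has_jacobian_integral \<mu> \<alpha> C \<longleftrightarrow>
     (\<forall>t. - (Re (velocity \<alpha> t))\<^sup>2 - (Im (velocity \<alpha> t))\<^sup>2 + 2 * omega \<mu> (\<alpha> t) = C)"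

definition periodic_with :: "real \<Rightarrow> (real \<Rightarrow> complex) \<Rightarrow> bool" where
  "periodic_with T \<alpha> \<longleftrightarrow> T > 0 \<and> (\<forall>t. \<alpha> (t + T) = \<alpha> t)"

definition U_region :: "real \<Rightarrow> real \<Rightarrow> complex set" where
  "U_region \<mu> C = {y. y \<notin> primaries \<mu> \<and> 2 * omega \<mu> y - C \<ge> 0}"

text \<open>
  Only the values on \<open>[0, T]\<close> matter. The derivative is one-sided at the two end points, and
  these one-sided derivatives are not required to coincide.
\<close>

definition simple_regular_closed_curve :: "real \<Rightarrow> (real \<Rightarrow> complex) \<Rightarrow> bool" where
  "simple_regular_closed_curve T \<beta> \<longleftrightarrow>
     \<beta> 0 = \<beta> T \<and> inj_on \<beta> {0..<T} \<and>
     (\<exists>\<beta>'. continuous_on {0..T} \<beta>' \<and>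
        (\<forall>t\<in>{0..T}. (\<beta> has_vector_derivative \<beta>' t) (at t within {0..T}) \<and> \<beta>' t \<noteq> 0))"

definition enclosed_region :: "real \<Rightarrow> (real \<Rightarrow> complex) \<Rightarrow> complex set" where
  "enclosed_region T \<beta> = inside (\<beta> ` {0..T})"

text \<open>The curve \<open>\<alpha>\<close>, restricted to \<open>[0, T]\<close>, is \<open>n\<close>-simple around \<open>p\<close> with lifting \<open>\<beta>\<close>.\<close>

definition n_simple_with_lifting ::
  "nat \<Rightarrow> complex \<Rightarrow> real \<Rightarrow> (real \<Rightarrow> complex) \<Rightarrow> (real \<Rightarrow> complex) \<Rightarrow> bool" where
  "n_simple_with_lifting n p T \<alpha> \<beta> \<longleftrightarrow>
     simple_regular_closed_curve T \<beta> \<and> p \<in> enclosed_region T \<beta> \<and>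
     (\<forall>t\<in>{0..T}. p + (\<beta> t - p) ^ n = \<alpha> t)"

text \<open>Winding numbers in the library are for paths on \<open>[0, 1]\<close>, hence the reparametrization.\<close>

definition goes_clockwise :: "real \<Rightarrow> (real \<Rightarrow> complex) \<Rightarrow> bool" where
  "goes_clockwise T \<beta> \<longleftrightarrow>
     (\<forall>z\<in>enclosed_region T \<beta>. winding_number (\<lambda>s. \<beta> (T * s)) z = - 1)"

definition goes_counterclockwise :: "real \<Rightarrow> (real \<Rightarrow> complex) \<Rightarrow> bool" where
  "goes_counterclockwise T \<beta> \<longleftrightarrow>
     (\<forall>z\<in>enclosed_region T \<beta>. winding_number (\<lambda>s. \<beta> (T * s)) z = 1)"

definition phi :: "real \<Rightarrow> nat \<Rightarrow> complex \<Rightarrow> complex" where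
  "phi \<mu> n z = - of_real \<mu> + (z + of_real \<mu>) ^ n"

definition f_tilde :: "real \<Rightarrow> real \<Rightarrow> nat \<Rightarrow> complex \<Rightarrow> real" where
  "f_tilde \<mu> C n z = sqrt (2 * omega \<mu> (phi \<mu> n z) - C)"

text \<open>Since \<open>ln 0 = 0\<close> in HOL, \<open>h_tilde\<close> is meaningful only where \<open>f_tilde\<close> is positive.\<close>

definition h_tilde :: "real \<Rightarrow> real \<Rightarrow> nat \<Rightarrow> complex \<Rightarrow> real" where
  "h_tilde \<mu> C n z = ln (f_tilde \<mu> C n z)"

end

theory Submission
  imports Defs
begin

text \<open>
  Write \<open>p = - \<mu>\<close>, and let \<open>\<sigma> = \<plusminus>1\<close> be the winding number of \<open>\<beta>\<close> around its interior.
  In complex notation the equation of motion says \<open>\<alpha>'' / \<alpha>' = \<nabla>\<omega> / \<alpha>' - 2i\<close>. Since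
  \<open>\<alpha>' = n (\<beta> - p)^(n - 1) \<beta>'\<close>, Hopf's theorem on the rotation of the tangent of \<open>\<beta>\<close> shows that the
  integral of the left-hand side over a period is \<open>2\<pi>i n\<sigma>\<close>. As \<open>|\<alpha>'| = f\<close>, the complex conjugate
  of the right-hand side pulls back to the contour integral of \<open>2 \<partial>h / \<partial>z\<close> over \<open>\<beta>\<close>, up to the
  constant \<open>2iT\<close>. Green's theorem turns this contour integral into the area integral of the
  Laplacian of \<open>h\<close>; the logarithmic pole \<open>h \<sim> - (n / 2) ln |z - p|\<close> contributes \<open>- \<pi>i n\<sigma>\<close>.

  Green's theorem is obtained without any analysis of the boundary: the Cauchy--Pompeiu formula
  represents a compactly supported function as the convolution of its \<open>\<partial> / \<partial>z-bar\<close> derivative with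
  \<open>1 / z\<close>, and integrating this representation over a closed curve produces winding numbers.

  If \<open>f\<close> vanishes at an interior point, then this point is a nondegenerate, anisotropic minimum
  (a triangular libration point), near which the Laplacian of \<open>ln f\<close> is not integrable; so
  integrability forces \<open>f\<close> to be positive.
\<close>

section \<open>Cauchy--Pompeiu formula and Green's theorem\<close>

text \<open>The orientation hypothesis speaks only of winding numbers, whereas the rotation theorem
  produces a sign attached to the lowest point of the curve. Both are therefore computed at that
  point: the turning of the tangent and the winding number about a point slightly above it equal the
  same \<open>sgn (Re (\<Gamma>' t0))\<close>, which is thereby identified with
  \<open>\<sigma>\<close>.

  The Cauchy--Pompeiu representation wants a globally defined function, but \<open>h\<close> is
  smooth only where \<open>f\<close> is positive and has a pole at \<open>p\<close>. On the curve
  \<open>f\<close> is the speed, which never vanishes; so positivity inside gives a whole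
  neighbourhood of the closed region, away from \<open>p\<close>, and a cutoff equal to 1 on that
  region extends the gradient to the plane. The pole is removed by adding
  \<open>(n / 2) / (z - p)\<close> to \<open>h_grad\<close>: this has a known contour integral,
  leaves the conjugate derivative unchanged, and what remains is \<open>o(1 / |z - p|)\<close>. A
  cutoff around \<open>p\<close> at radius \<open>r\<close> has gradient \<open>O(1 / r)\<close>
  over an area \<open>O(r^2)\<close>, so such a remainder contributes nothing in the limit.\<close>

lemma integral_translation_lborel:
  fixes u :: "'a::euclidean_space \<Rightarrow> 'b::{banach, second_countable_topology}"
  assumes "u \<in> borel_measurable borel"
  shows "(\<integral>z. u (z + c) \<partial>lborel) = (\<integral>z. u z \<partial>lborel)"
proof -
  have "(\<integral>z. u z \<partial>lborel) = (\<integral>z. u z \<partial>(distr lborel borel ((+) c)))"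
    by (simp add: lborel_distr_plus)
  also have "\<dots> = (\<integral>z. u (c + z) \<partial>lborel)"
    using assms by (subst integral_distr) auto
  finally show ?thesis by (simp add: add.commute)
qed

lemma integrable_bounded_support:
  fixes u :: "'a::euclidean_space \<Rightarrow> 'b::{banach, second_countable_topology}"
  assumes "u \<in> borel_measurable borel" "\<And>z. norm (u z) \<le> B * indicator (cball 0 M) z"
  shows "integrable lborel u"
proof (rule Bochner_Integration.integrable_bound)
  show "integrable lborel (\<lambda>z::'a. B * indicator (cball 0 M) z :: real)"
    by (intro integrable_mult_right integrable_real_indicator) (auto simp: emeasure_lborel_cball_finite[unfolded infinity_ennreal_def])
  have "0 \<le> B * indicator (cball 0 M) x" for x :: 'a
    by (rule order_trans[OF norm_ge_zero assms(2)])
  then show "AE z in lborel. norm (u z) \<le> norm (B * indicator (cball 0 M) z :: real)"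
    using assms(2) by simp
qed (use assms in auto)

text \<open>Translation invariance makes every difference quotient of a compactly supported function
  integrate to zero, and the Lipschitz bound dominates the quotients on a ball enlarged by
  \<open>norm v\<close>. The limit is needed only almost everywhere; this matters because the
  truncated kernel below has a kink along a circle.\<close>

lemma integral_directional_derivative_eq_0:
  fixes u :: "'a::euclidean_space \<Rightarrow> 'b::{banach, second_countable_topology}"
  assumes lip: "\<And>x y. norm (u x - u y) \<le> L * norm (x - y)"
    and supp: "\<And>z. norm z > M \<Longrightarrow> u z = 0"
    and der: "AE z in lborel. (u has_derivative D z) (at z)"
    and meas: "(\<lambda>z. D z v) \<in> borel_measurable borel"
  shows "integrable lborel (\<lambda>z. D z v) \<and> (\<integral>z. D z v \<partial>lborel) = 0"
proof -
  have contu: "continuous_on UNIV u"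
  proof (intro continuous_at_imp_continuous_on ballI)
    fix x
    have "(u \<longlongrightarrow> u x) (at x)"
    proof (rule Lim_null_comparison[THEN Lim_null[THEN iffD2]])
      show "\<forall>\<^sub>F y in at x. norm (u y - u x) \<le> L * norm (y - x)" using lip by simp
      have "((\<lambda>y. L * norm (y - x)) \<longlongrightarrow> L * norm (x - x)) (at x)"
        by (intro tendsto_intros)
      then show "((\<lambda>y. L * norm (y - x)) \<longlongrightarrow> 0) (at x)" by simp
    qed
    then show "isCont u x" by (simp add: isCont_def)
  qed
  then have mu: "u \<in> borel_measurable borel"
    by (rule borel_measurable_continuous_onI)
  define q where "q k z = real (Suc k) *\<^sub>R (u (z + (1 / real (Suc k)) *\<^sub>R v) - u z)" for k z
  have mq: "q k \<in> borel_measurable lborel" for k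
    unfolding q_def using contu
    by (simp, intro borel_measurable_continuous_onI continuous_intros continuous_on_compose2[OF contu]) auto
  have bd: "norm (q k z) \<le> (L * norm v) * indicator (cball 0 (M + norm v)) z" for k z
  proof (cases "norm z \<le> M + norm v")
    case True
    have "norm (q k z) \<le> real (Suc k) * (L * norm ((1 / real (Suc k)) *\<^sub>R v))"
      unfolding q_def norm_scaleR using lip[of "z + (1 / real (Suc k)) *\<^sub>R v" z]
      by (intro mult_mono) auto
    also have "\<dots> = L * norm v" by simp
    finally show ?thesis using True by simp
  next
    case False
    have "norm z - norm ((1 / real (Suc k)) *\<^sub>R v) \<le> norm (z + (1 / real (Suc k)) *\<^sub>R v)"
      by (rule norm_diff_ineq)
    moreover have "norm ((1 / real (Suc k)) *\<^sub>R v) \<le> norm v"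
      by (simp add: divide_le_eq mult_le_cancel_left1)
    ultimately have "norm (z + (1 / real (Suc k)) *\<^sub>R v) > M" "norm z > M" 
      using False norm_ge_zero[of v] by linarith+
    then have "q k z = 0" using supp by (simp add: q_def)
    then show ?thesis using False by simp
  qed
  have int_w: "integrable lborel (\<lambda>z::'a. (L * norm v) * indicator (cball 0 (M + norm v)) z)"
    by (intro integrable_mult_right integrable_real_indicator) (auto simp: emeasure_lborel_cball_finite[unfolded infinity_ennreal_def])
  have Mu: "norm (u z) \<le> (L * (2 * \<bar>M\<bar> + 1)) * indicator (cball 0 M) z" for z
  proof (cases "norm z \<le> M")
    case True
    \<comment> \<open>Comparison with a point \<open>y\<close> of norm
      \<open>\<bar>M\<bar> + 1\<close>, outside the support, turns the Lipschitz constant into a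
      bound for \<open>u\<close> itself. The absolute value covers negative
      \<open>M\<close>.\<close>
    obtain b :: 'a where b: "b \<in> Basis" using nonempty_Basis by blast
    define y where "y = (\<bar>M\<bar> + 1) *\<^sub>R b"
    have ny: "norm y = \<bar>M\<bar> + 1" using b by (simp add: y_def)
    then have "u y = 0" by (intro supp) simp
    then have "norm (u z) \<le> L * norm (z - y)" using lip[of z y] by simp
    moreover have "norm (z - y) \<le> 2 * \<bar>M\<bar> + 1"
      using norm_triangle_ineq4[of z y] True ny by simp
    moreover have "L \<ge> 0"
      using order_trans[OF norm_ge_zero lip[of b 0]] b by simp
    ultimately have "norm (u z) \<le> L * (2 * \<bar>M\<bar> + 1)"
      by (meson mult_left_mono order_trans)
    then show ?thesis using True by simp
  qed (use supp in auto)
  have iu: "integrable lborel u"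
    by (rule integrable_bounded_support[OF mu Mu])
  have iq: "(\<integral>z. q k z \<partial>lborel) = 0" for k
  proof -
    define c where "c = (1 / real (Suc k)) *\<^sub>R v"
    have "integrable lborel (\<lambda>z. u (z + c))"
    proof -
      have "integrable (distr lborel borel ((+) c)) u" using iu by (simp add: lborel_distr_plus)
      then have "integrable lborel (\<lambda>z. u (c + z))" using mu by (subst (asm) integrable_distr_eq) auto
      then show ?thesis by (simp add: add.commute)
    qed
    then show ?thesis unfolding q_def c_def[symmetric]
      using iu integral_translation_lborel[OF mu, of c] by simp
  qed
  have lim: "AE z in lborel. (\<lambda>k. q k z) \<longlonglongrightarrow> D z v"
    using der
  proof eventually_elim
    case (elim z)
    have "((\<lambda>h. (u (z + h *\<^sub>R v) - u z) /\<^sub>R h) \<longlongrightarrow> D z v) (at 0)"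
    proof -
      have "((\<lambda>h. u (z + h *\<^sub>R v)) has_derivative (\<lambda>h. D z (h *\<^sub>R v))) (at 0)"
        by (rule has_derivative_compose[where f="\<lambda>h. z + h *\<^sub>R v" and g=u])
           (auto intro!: derivative_eq_intros elim)
      then have "((\<lambda>h. u (z + h *\<^sub>R v)) has_vector_derivative D z v) (at 0)"
        unfolding has_vector_derivative_def
        using linear_scale[OF has_derivative_linear[OF elim]] by simp
      then show ?thesis
        unfolding has_vector_derivative_def has_derivative_iff_norm
          Lim_null[where f="\<lambda>h. (u (z + h *\<^sub>R v) - u z) /\<^sub>R h"]
      proof (elim conjE, intro tendsto_norm_zero_cancel[of "\<lambda>h. (u (z + h *\<^sub>R v) - u z) /\<^sub>R h - D z v"])
        assume "((\<lambda>h. norm (u (z + h *\<^sub>R v) - u (z + 0 *\<^sub>R v) - (h - 0) *\<^sub>R D z v) / norm (h - 0)) \<longlongrightarrow> 0) (at 0)"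
        moreover have "norm (u (z + h *\<^sub>R v) - u (z + 0 *\<^sub>R v) - (h - 0) *\<^sub>R D z v) / norm (h - 0)
            = norm ((u (z + h *\<^sub>R v) - u z) /\<^sub>R h - D z v)" if "h \<noteq> 0" for h
        proof -
          have "(u (z + h *\<^sub>R v) - u z) /\<^sub>R h - D z v = (u (z + h *\<^sub>R v) - u z - h *\<^sub>R D z v) /\<^sub>R h"
            using that by (simp add: scaleR_diff_right)
          then show ?thesis by (simp add: divide_inverse)
        qed
        then have "\<forall>\<^sub>F h in at 0. norm (u (z + h *\<^sub>R v) - u (z + 0 *\<^sub>R v) - (h - 0) *\<^sub>R D z v) / norm (h - 0)
            = norm ((u (z + h *\<^sub>R v) - u z) /\<^sub>R h - D z v)"
          by (simp only: eventually_at_filter) simp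
        ultimately show "((\<lambda>h. norm ((u (z + h *\<^sub>R v) - u z) /\<^sub>R h - D z v)) \<longlongrightarrow> 0) (at 0)"
          by (rule Lim_transform_eventually)
      qed
    qed
    moreover have "filterlim (\<lambda>k. 1 / real (Suc k)) (at 0) sequentially"
      unfolding filterlim_at using LIMSEQ_inverse_real_of_nat by (auto simp: inverse_eq_divide)
    ultimately have "(\<lambda>k. (u (z + (1 / real (Suc k)) *\<^sub>R v) - u z) /\<^sub>R (1 / real (Suc k))) \<longlonglongrightarrow> D z v"
      by (rule filterlim_compose)
    then show ?case by (simp add: q_def)
  qed
  have "integrable lborel (\<lambda>z. D z v)" "(\<lambda>k. \<integral>z. q k z \<partial>lborel) \<longlonglongrightarrow> (\<integral>z. D z v \<partial>lborel)"
    using integrable_dominated_convergence[OF _ mq int_w lim] bd 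
      integral_dominated_convergence[OF _ mq int_w lim] meas by auto
  then show ?thesis using iq by (simp add: LIMSEQ_const_iff)
qed

section \<open>Local integrability of 1 / |z| in the plane\<close>

lemma cball_borel [measurable]: "cball c r \<in> sets borel"
  for c :: "'a::metric_space"
  by (rule borel_closed) simp

text \<open>A dyadic majorant takes the place of polar coordinates: the height
  \<open>2 ^ Suc k / r\<close> dominates \<open>1 / norm z\<close> on the shell between the radii
  \<open>r / 2 ^ Suc k\<close> and \<open>r / 2 ^ k\<close>. The heights double while the areas
  shrink by four, so the integrals form a geometric series.\<close>

lemma nn_integral_inverse_norm_cball_finite:
  fixes r :: real
  assumes "r > 0"
  shows "(\<integral>\<^sup>+z. ennreal (indicator (cball 0 r) z / norm (z::complex)) \<partial>lborel) < \<infinity>"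
proof -
  define f where "f k z = ennreal (2 ^ Suc k / r) * indicator (cball 0 (r / 2 ^ k)) z" for k and z :: complex
  have dom: "ennreal (indicator (cball 0 r) z / norm z) \<le> (\<Sum>k. f k z)" for z :: complex
  proof (cases "z \<in> cball 0 r \<and> z \<noteq> 0")
    case True
    then have zp: "norm z > 0" "norm z \<le> r" by auto
    obtain N where N: "r / norm z < 2 ^ N" using real_arch_pow[of 2 "r / norm z"] by auto
    define P where "P = (\<lambda>k::nat. r / 2 ^ k < norm z)"
    have "P N" using N zp by (simp add: P_def field_simps)
    moreover have "\<not> P 0" using zp by (simp add: P_def)
    ultimately obtain k where k: "\<forall>i<k. \<not> P i" "P k" using ex_least_nat_le[of P] by blast
    with \<open>\<not> P 0\<close> obtain j where j: "k = Suc j" by (cases k) auto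
    have j1: "norm z \<le> r / 2 ^ j" and j2: "r / 2 ^ Suc j < norm z"
      using k by (auto simp: j P_def not_less)
    have "1 / norm z \<le> 2 ^ Suc j / r" using j2 zp assms by (simp add: field_simps)
    then have "ennreal (indicator (cball 0 r) z / norm z) \<le> ennreal (2 ^ Suc j / r)"
      using True by (intro ennreal_leI) auto
    also have "\<dots> = f j z" using j1 by (simp add: f_def)
    also have "\<dots> \<le> (\<Sum>k. f k z)"
      using sum_le_suminf[of "\<lambda>k. f k z" "{j}"] by (simp add: summableI)
    finally show ?thesis .
  qed (auto simp: indicator_def)
  have "(\<integral>\<^sup>+z. ennreal (indicator (cball 0 r) z / norm (z::complex)) \<partial>lborel)
        \<le> (\<integral>\<^sup>+z. (\<Sum>k. f k z) \<partial>lborel)"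
    by (intro nn_integral_mono dom)
  also have "\<dots> = (\<Sum>k. \<integral>\<^sup>+z. f k z \<partial>lborel)"
    by (intro nn_integral_suminf) (auto simp: f_def)
  also have "(\<lambda>k. \<integral>\<^sup>+z. f k z \<partial>lborel) = (\<lambda>k. ennreal (2 * pi * r * (1 / 2) ^ k))"
  proof
    fix k
    have "(\<integral>\<^sup>+z. f k z \<partial>lborel) = ennreal (2 ^ Suc k / r) * emeasure lborel (cball (0::complex) (r / 2 ^ k))"
      unfolding f_def by (subst nn_integral_cmult_indicator) auto
    also have "emeasure lborel (cball (0::complex) (r / 2 ^ k)) = ennreal (pi * (r / 2 ^ k)\<^sup>2)"
      using assms by (simp add: emeasure_cball unit_ball_vol_2)
    also have "ennreal (2 ^ Suc k / r) * ennreal (pi * (r / 2 ^ k)\<^sup>2) = ennreal (2 * pi * r * (1 / 2) ^ k)"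
      using assms by (subst ennreal_mult[symmetric])
        (auto simp: field_simps power2_eq_square power_divide)
    finally show "(\<integral>\<^sup>+z. f k z \<partial>lborel) = ennreal (2 * pi * r * (1 / 2) ^ k)" .
  qed
  also have "(\<Sum>k. ennreal (2 * pi * r * (1 / 2) ^ k)) = ennreal (\<Sum>k. 2 * pi * r * (1 / 2) ^ k)"
    using assms by (intro suminf_ennreal2) (auto intro!: summable_mult summable_geometric)
  also have "\<dots> < \<infinity>" by simp
  finally show ?thesis .
qed

lemma nn_integral_translation_lborel:
  fixes f :: "'a::euclidean_space \<Rightarrow> ennreal"
  assumes "f \<in> borel_measurable borel"
  shows "(\<integral>\<^sup>+z. f (z - c) \<partial>lborel) = (\<integral>\<^sup>+z. f z \<partial>lborel)"
proof -
  have "(\<integral>\<^sup>+z. f z \<partial>lborel) = (\<integral>\<^sup>+z. f z \<partial>(distr lborel borel ((+) (- c))))"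
    by (simp add: lborel_distr_plus)
  also have "\<dots> = (\<integral>\<^sup>+z. f (- c + z) \<partial>lborel)"
    using assms by (subst nn_integral_distr) auto
  finally show ?thesis by simp
qed

text \<open>The ball of radius \<open>M\<close> about 0 lies in the ball of radius
  \<open>2 * M\<close> about \<open>w\<close>, which gives a bound independent of \<open>w\<close>.
  Fubini along a curve relies on this uniformity.\<close>

lemma nn_integral_inverse_norm_uniform:
  fixes w :: complex
  assumes "M > 0" "norm w \<le> M"
  shows "(\<integral>\<^sup>+z. ennreal (indicator (cball 0 M) z / norm (z - w)) \<partial>lborel)
     \<le> (\<integral>\<^sup>+z. ennreal (indicator (cball 0 (2 * M)) z / norm (z::complex)) \<partial>lborel)"
proof -
  have "(\<integral>\<^sup>+z. ennreal (indicator (cball 0 M) z / norm (z - w)) \<partial>lborel)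
     \<le> (\<integral>\<^sup>+z. ennreal (indicator (cball 0 (2 * M)) (z - w) / norm (z - w)) \<partial>lborel)"
  proof (intro nn_integral_mono ennreal_leI divide_right_mono)
    fix z
    have "norm (z - w) \<le> 2 * M" if "norm z \<le> M" using norm_triangle_ineq4[of z w] that assms by simp
    then show "indicat_real (cball 0 M) z \<le> indicat_real (cball 0 (2 * M)) (z - w)"
      by (auto simp: indicator_def)
  qed auto
  also have "\<dots> = (\<integral>\<^sup>+z. ennreal (indicator (cball 0 (2 * M)) z / norm (z::complex)) \<partial>lborel)"
    by (rule nn_integral_translation_lborel) auto
  finally show ?thesis .
qed

lemma integrable_inverse_norm_cball:
  fixes w :: complex
  shows "integrable lborel (\<lambda>z. indicator (cball 0 M) z / norm (z - w))"
proof -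
  define M' where "M' = \<bar>M\<bar> + norm w + 1"
  have M': "M' > 0" "norm w \<le> M'" "M \<le> M'" unfolding M'_def using norm_ge_zero[of w] by linarith+
  have "integrable lborel (\<lambda>z. indicator (cball 0 M') z / norm (z - w))"
  proof (rule integrableI_bounded)
    have "(\<integral>\<^sup>+z. ennreal (indicator (cball 0 M') z / norm (z - w)) \<partial>lborel) < \<infinity>"
      using nn_integral_inverse_norm_uniform[OF M'(1,2)] nn_integral_inverse_norm_cball_finite[of "2*M'"] M'
      by (meson le_less_trans zero_less_numeral zero_less_mult_iff)
    then show "(\<integral>\<^sup>+z. ennreal (norm (indicator (cball 0 M') z / norm (z - w))) \<partial>lborel) < \<infinity>"
      by simp
  qed auto
  then show ?thesis
    by (rule Bochner_Integration.integrable_bound) (use M' in \<open>auto simp: indicator_def\<close>)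
qed

section \<open>The Cauchy--Pompeiu representation\<close>

text \<open>\<open>P\<close> and \<open>R\<close> are the Wirtinger derivatives of \<open>g\<close> with respect to \<open>z\<close> and to its conjugate.\<close>

abbreviation wirtinger :: "(complex \<Rightarrow> complex) \<Rightarrow> complex \<Rightarrow> complex \<Rightarrow> complex \<Rightarrow> bool" where
  "wirtinger g P R z \<equiv> (g has_derivative (\<lambda>v. P * v + R * cnj v)) (at z)"

text \<open>
  A Lipschitz truncation of \<open>1 / z\<close>. Its derivative with respect to the conjugate variable is
  \<open>1 / e\<^sup>2\<close> on the disc of radius \<open>e\<close> and vanishes outside.
\<close>

definition cauchy_kernel :: "real \<Rightarrow> complex \<Rightarrow> complex" where
  "cauchy_kernel e z = cnj z / of_real (max ((norm z)\<^sup>2) (e\<^sup>2))"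

lemma cauchy_kernel_inside: "norm z \<le> e \<Longrightarrow> cauchy_kernel e z = cnj z / of_real (e\<^sup>2)"
proof -
  assume "norm z \<le> e"
  then have "(norm z)\<^sup>2 \<le> e\<^sup>2" by (intro power_mono) auto
  then show ?thesis by (simp add: cauchy_kernel_def max_absorb2)
qed

lemma cauchy_kernel_outside: "norm z \<ge> e \<Longrightarrow> e > 0 \<Longrightarrow> cauchy_kernel e z = 1 / z"
proof -
  assume a: "norm z \<ge> e" "e > 0"
  then have "z \<noteq> 0" by auto
  have "e\<^sup>2 \<le> (norm z)\<^sup>2" using a by (intro power_mono) auto
  then show ?thesis using \<open>z \<noteq> 0\<close>
    unfolding cauchy_kernel_def max_absorb1[OF \<open>e\<^sup>2 \<le> (norm z)\<^sup>2\<close>] complex_norm_square by simp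
qed

lemma norm_cauchy_kernel_le: "e > 0 \<Longrightarrow> norm (cauchy_kernel e z) \<le> 1 / e"
proof (cases "norm z \<le> e")
  case True assume "e > 0" then show ?thesis
    using True by (simp add: cauchy_kernel_inside norm_divide norm_mult power2_eq_square divide_simps)
next
  case False assume "e > 0" then show ?thesis
    using False by (simp add: cauchy_kernel_outside norm_divide divide_simps)
qed

lemma norm_cauchy_kernel_le_inverse: "e > 0 \<Longrightarrow> norm (cauchy_kernel e z) \<le> 1 / norm z"
proof (cases "norm z \<le> e")
  case True assume "e > 0" 
  have "norm z * norm z \<le> e * e" using True by (intro mult_mono) (use \<open>e > 0\<close> in auto)
  then show ?thesis
    using True \<open>e > 0\<close> by (cases "z = 0") (simp_all add: cauchy_kernel_inside norm_divide norm_mult power2_eq_square field_simps)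
next
  case False assume "e > 0" then show ?thesis
    using False by (simp add: cauchy_kernel_outside norm_divide divide_simps)
qed

text \<open>Inside the disc the kernel is real-linear with constant \<open>1 / e\<^sup>2\<close>,
  and outside \<open>1 / x - 1 / y = (y - x) / (x * y)\<close> gives the same constant. A mixed pair
  is split where the segment crosses the circle; distances add up along a segment, so the constant
  is not doubled.\<close>

lemma cauchy_kernel_lipschitz:
  assumes "e > 0"
  shows "norm (cauchy_kernel e x - cauchy_kernel e y) \<le> norm (x - y) / e\<^sup>2"
proof -
  have ii: "norm (cauchy_kernel e x - cauchy_kernel e y) = norm (x - y) / e\<^sup>2" if "norm x \<le> e" "norm y \<le> e" for x y
  proof -
    have "cauchy_kernel e x - cauchy_kernel e y = cnj (x - y) / of_real (e\<^sup>2)"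
      using that by (simp add: cauchy_kernel_inside diff_divide_distrib)
    then show ?thesis by (simp only: norm_divide complex_mod_cnj norm_of_real) simp
  qed
  have oo: "norm (cauchy_kernel e x - cauchy_kernel e y) \<le> norm (x - y) / e\<^sup>2" if "norm x \<ge> e" "norm y \<ge> e" for x y
  proof -
    have nz: "x \<noteq> 0" "y \<noteq> 0" using that assms by auto
    have "cauchy_kernel e x - cauchy_kernel e y = (y - x) / (x * y)"
      using that nz assms by (simp add: cauchy_kernel_outside field_simps)
    then have "norm (cauchy_kernel e x - cauchy_kernel e y) = norm (x - y) / (norm x * norm y)"
      by (simp add: norm_divide norm_mult norm_minus_commute)
    also have "\<dots> \<le> norm (x - y) / e\<^sup>2"
      unfolding power2_eq_square using that assms 
      by (intro divide_left_mono mult_mono mult_pos_pos) (use nz in auto)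
    finally show ?thesis .
  qed
  have io: "norm (cauchy_kernel e x - cauchy_kernel e y) \<le> norm (x - y) / e\<^sup>2" if "norm x \<le> e" "norm y \<ge> e" for x y
  proof -
    have "\<exists>c\<in>closed_segment x y. norm c = e"
    proof -
      have "connected (norm ` closed_segment x y)"
        by (intro connected_continuous_image continuous_intros) simp
      then have "e \<in> norm ` closed_segment x y"
        by (rule connectedD_interval[of _ "norm x" "norm y"]) (use that in auto)
      then show ?thesis by blast
    qed
    then obtain c where c: "c \<in> closed_segment x y" "norm c = e" by blast
    have "norm (cauchy_kernel e x - cauchy_kernel e y) \<le> norm (cauchy_kernel e x - cauchy_kernel e c) + norm (cauchy_kernel e c - cauchy_kernel e y)"
      using norm_triangle_ineq[of "cauchy_kernel e x - cauchy_kernel e c" "cauchy_kernel e c - cauchy_kernel e y"] by simp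
    also have "\<dots> \<le> norm (x - c) / e\<^sup>2 + norm (c - y) / e\<^sup>2"
      using ii[of x c] oo[of c y] that c by simp
    also have "\<dots> = norm (x - y) / e\<^sup>2"
      using between[of x y c] c(1) by (simp add: between_mem_segment[symmetric] dist_norm add_divide_distrib)
    finally show ?thesis .
  qed
  show ?thesis
    using ii[of x y] oo[of x y] io[of x y] io[of y x] 
    by (metis linear norm_minus_commute order_refl)
qed

lemma cauchy_kernel_borel [measurable]: "cauchy_kernel e \<in> borel_measurable borel"
  unfolding cauchy_kernel_def 
  by (intro borel_measurable_divide; intro borel_measurable_continuous_onI continuous_intros)

lemma wirtinger_zero_imp:
  assumes "wirtinger g P R z" "open S" "z \<in> S" "\<And>x. x \<in> S \<Longrightarrow> g x = 0"
  shows "P = 0" "R = 0"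
proof -
  have "((\<lambda>_. 0) has_derivative (\<lambda>v. P * v + R * cnj v)) (at z)"
    using assms by (intro has_derivative_transform_within_open[OF assms(1)]) auto
  then have "(\<lambda>v. P * v + R * cnj v) = (\<lambda>_. 0)"
    by (rule has_derivative_unique[OF _ has_derivative_const])
  from fun_cong[OF this, of 1] fun_cong[OF this, of \<i>] show "P = 0" "R = 0"
    by (auto simp: algebra_simps add_eq_0_iff2)
qed

lemma norm_wirtinger_le: "norm (P * v + R * cnj v) \<le> (norm P + norm R) * norm v"
  by (rule order_trans[OF norm_triangle_ineq]) (simp add: norm_mult algebra_simps)

text \<open>The derivatives vanish outside the support as well, so by compactness they are bounded,
  and the mean value inequality gives the Lipschitz estimate. One constant serves for all three
  bounds.\<close>

lemma wirtinger_compact_support_bounds: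
  assumes g: "\<And>z. wirtinger g (P z) (R z) z"
    and cont: "continuous_on UNIV P" "continuous_on UNIV R"
    and supp: "\<And>z. norm z > M \<Longrightarrow> g z = 0"
  obtains B where "B > 0" "\<And>z. norm (g z) \<le> B * indicator (cball 0 M) z" 
    "\<And>z. norm (R z) \<le> B * indicator (cball 0 M) z" 
    "\<And>x y. norm (g x - g y) \<le> B * norm (x - y)"
proof -
  have "open {z::complex. norm z > M}" by (intro open_Collect_less continuous_intros)
  then have supp': "P z = 0" "R z = 0" if "norm z > M" for z
    using wirtinger_zero_imp[OF g, of "{z. norm z > M}" z] supp that by auto
  have contg: "continuous_on UNIV g"
    using g has_derivative_continuous by (intro continuous_at_imp_continuous_on) blast
  have bd: "\<exists>B>0. \<forall>z. norm (f z) \<le> B" 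
    if f: "continuous_on UNIV f" "\<And>z. norm z > M \<Longrightarrow> f z = 0" for f :: "complex \<Rightarrow> complex"
  proof -
    have "compact (f ` cball 0 M)"
      by (intro compact_continuous_image continuous_on_subset[OF f(1)]) auto
    then obtain B where B: "B > 0" "\<forall>y\<in>f ` cball 0 M. norm y \<le> B" 
      using compact_imp_bounded bounded_pos by metis
    have "norm (f z) \<le> B" for z
      using B f(2)[of z] by (cases "norm z \<le> M") auto
    then show ?thesis using B by blast
  qed
  obtain B1 where B1: "B1 > 0" "\<And>z. norm (g z) \<le> B1" using bd[OF contg supp] by blast
  obtain B2 where B2: "B2 > 0" "\<And>z. norm (P z) \<le> B2" using bd[OF cont(1) supp'(1)] by blast
  obtain B3 where B3: "B3 > 0" "\<And>z. norm (R z) \<le> B3" using bd[OF cont(2) supp'(2)] by blast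
  have lip: "norm (g x - g y) \<le> (B2 + B3) * norm (x - y)" for x y
  proof (rule differentiable_bound[of UNIV])
    show "onorm (\<lambda>v. P z * v + R z * cnj v) \<le> B2 + B3" for z
    proof (rule onorm_le)
      fix v
      have "norm (P z * v + R z * cnj v) \<le> (norm (P z) + norm (R z)) * norm v" by (rule norm_wirtinger_le)
      also have "\<dots> \<le> (B2 + B3) * norm v" by (intro mult_right_mono add_mono B2 B3) auto
      finally show "norm (P z * v + R z * cnj v) \<le> (B2 + B3) * norm v" .
    qed
  qed (use g in auto)
  show ?thesis
  proof (rule that[of "B1 + B2 + B3"])
    show "B1 + B2 + B3 > 0" using B1 B2 B3 by simp
    show "norm (g z) \<le> (B1 + B2 + B3) * indicator (cball 0 M) z" for z
      using B1(1) B1(2)[of z] B2(1) B3(1) supp[of z] by (cases "norm z \<le> M") auto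
    show "norm (R z) \<le> (B1 + B2 + B3) * indicator (cball 0 M) z" for z
      using B1(1) B3(2)[of z] B2(1) B3(1) supp'[of z] by (cases "norm z \<le> M") auto
    show "norm (g x - g y) \<le> (B1 + B2 + B3) * norm (x - y)" for x y
      using lip[of x y] mult_nonneg_nonneg[of B1 "norm (x - y)"] B1(1) 
      by (simp add: algebra_simps del: mult_nonneg_nonneg)
  qed
qed

lemma sphere_null_set_lborel: "sphere (w::complex) e \<in> null_sets lborel"
  using negligible_sphere[of w e] 
  by (simp add: negligible_iff_null_sets null_sets_completion_iff borel_closed)

lemma measure_ball_complex: "e \<ge> 0 \<Longrightarrow> measure lborel (ball (w::complex) e) = pi * e\<^sup>2"
  using content_ball[of e w] by (simp add: unit_ball_vol_2)

text \<open>The left-hand side is the integral of the conjugate derivative of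
  \<open>g z * cauchy_kernel e (z - w)\<close>, a compactly supported Lipschitz function, and hence
  vanishes. The second term stems from the derivative \<open>1 / e\<^sup>2\<close> of the kernel on
  the disc.\<close>

lemma cauchy_pompeiu_regularized:
  assumes g: "\<And>z. wirtinger g (P z) (R z) z"
    and cont: "continuous_on UNIV P" "continuous_on UNIV R"
    and supp: "\<And>z. norm z > M \<Longrightarrow> g z = 0" and e: "e > 0"
  shows "(\<integral>z. R z * cauchy_kernel e (z - w) \<partial>lborel) + (\<integral>z. indicator (ball w e) z *\<^sub>R g z \<partial>lborel) / of_real (e\<^sup>2) = 0"
proof -
  obtain B where B: "B > 0" "\<And>z. norm (g z) \<le> B * indicator (cball 0 M) z" 
    "\<And>z. norm (R z) \<le> B * indicator (cball 0 M) z" 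
    "\<And>x y. norm (g x - g y) \<le> B * norm (x - y)"
    using wirtinger_compact_support_bounds[OF g cont supp] by blast
  have contg: "continuous_on UNIV g"
    using g has_derivative_continuous by (intro continuous_at_imp_continuous_on) blast
  have [measurable]: "g \<in> borel_measurable borel" "P \<in> borel_measurable borel" "R \<in> borel_measurable borel"
    using contg cont by (auto intro: borel_measurable_continuous_onI)
  define u where "u z = g z * cauchy_kernel e (z - w)" for z
  \<comment> \<open>The differential of the kernel. On the circle of radius \<open>e\<close>, where
    the kernel has its kink, the value is an arbitrary choice: the circle is a null set.\<close>
  define c where "c z v = (if norm (z - w) < e then cnj v / of_real (e\<^sup>2) else - v / (z - w)\<^sup>2)" for z v
  define D where "D z v = (P z * v + R z * cnj v) * cauchy_kernel e (z - w) + g z * c z v" for z v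
  have gB: "norm (g z) \<le> B" for z using B(2)[of z] B(1) by (cases "norm z \<le> M") auto
  have lip: "norm (u x - u y) \<le> (B / e + B / e\<^sup>2) * norm (x - y)" for x y
  proof -
    have "u x - u y = (g x - g y) * cauchy_kernel e (x - w) + g y * (cauchy_kernel e (x - w) - cauchy_kernel e (y - w))"
      by (simp add: u_def algebra_simps)
    then have "norm (u x - u y) \<le> norm (g x - g y) * norm (cauchy_kernel e (x - w)) 
        + norm (g y) * norm (cauchy_kernel e (x - w) - cauchy_kernel e (y - w))"
      by (metis norm_mult norm_triangle_ineq)
    also have "\<dots> \<le> (B * norm (x - y)) * (1 / e) + B * (norm ((x - w) - (y - w)) / e\<^sup>2)"
      using B(1) e by (intro add_mono mult_mono B gB norm_cauchy_kernel_le cauchy_kernel_lipschitz) auto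
    also have "\<dots> = (B / e + B / e\<^sup>2) * norm (x - y)" by (simp add: algebra_simps)
    finally show ?thesis .
  qed
  have der: "(u has_derivative D z) (at z)" if z: "z \<notin> sphere w e" for z
  proof -
    have "((\<lambda>z. cauchy_kernel e (z - w)) has_derivative c z) (at z)"
    proof (cases "norm (z - w) < e")
      case True
      have "((\<lambda>z. cnj (z - w) / of_real (e\<^sup>2)) has_derivative c z) (at z)"
        unfolding divide_inverse using True
        by (auto intro!: derivative_eq_intros simp: c_def fun_eq_iff divide_inverse)
      moreover have "open (ball w e)" "z \<in> ball w e" using True by (auto simp: dist_norm norm_minus_commute)
      ultimately show ?thesis
        by (rule has_derivative_transform_within_open) 
           (auto simp: dist_norm norm_minus_commute cauchy_kernel_inside)
    next
      case False
      then have "z \<in> - cball w e" using z by (auto simp: dist_norm norm_minus_commute)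
      moreover have "((\<lambda>z. 1 / (z - w)) has_derivative c z) (at z)"
      proof -
        have "z - w \<noteq> 0" using False e by auto
        then have "((\<lambda>z. 1 / (z - w)) has_field_derivative - 1 / (z - w)\<^sup>2) (at z)"
          by (auto intro!: derivative_eq_intros simp: power2_eq_square)
        moreover have "c z = (*) (- 1 / (z - w)\<^sup>2)" using False by (auto simp: c_def fun_eq_iff)
        ultimately show ?thesis by (simp add: has_field_derivative_def)
      qed
      ultimately show ?thesis
        using has_derivative_transform_within_open[of "\<lambda>z. 1 / (z - w)" "c z" z UNIV "- cball w e" "\<lambda>z. cauchy_kernel e (z - w)"]
        by (simp add: open_Compl dist_norm norm_minus_commute cauchy_kernel_outside e)
    qed
    from has_derivative_mult[OF g this] show ?thesis
      unfolding u_def D_def by (rule has_derivative_eq_rhs) (simp add: fun_eq_iff algebra_simps)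
  qed
  have AE: "AE z in lborel. (u has_derivative D z) (at z)"
    using AE_not_in[OF sphere_null_set_lborel[of w e]] by eventually_elim (rule der)
  have D0: "integrable lborel (\<lambda>z. D z v)" "(\<integral>z. D z v \<partial>lborel) = 0" for v
  proof -
    have "(\<lambda>z. D z v) \<in> borel_measurable borel" unfolding D_def c_def by measurable
    from integral_directional_derivative_eq_0[OF lip _ AE this, of M] supp
    show "integrable lborel (\<lambda>z. D z v)" "(\<integral>z. D z v \<partial>lborel) = 0" by (auto simp: u_def)
  qed
  \<comment> \<open>Half of \<open>D z 1 + \<i> * D z \<i>\<close> extracts the conjugate derivative
    from a real-linear differential.\<close>
  have eq: "R z * cauchy_kernel e (z - w) + indicator (ball w e) z *\<^sub>R g z / of_real (e\<^sup>2) = (D z 1 + \<i> * D z \<i>) / 2" for z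
    using e by (auto simp: D_def c_def dist_norm norm_minus_commute indicator_def field_simps)
  have i1: "integrable lborel (\<lambda>z. indicator (ball w e) z *\<^sub>R g z / of_real (e\<^sup>2))"
  proof (rule integrable_bounded_support[of _ "B / e\<^sup>2" M])
    show "norm (indicator (ball w e) z *\<^sub>R g z / of_real (e\<^sup>2)) \<le> B / e\<^sup>2 * indicator (cball 0 M) z" for z
    proof -
      have "norm (indicator (ball w e) z *\<^sub>R g z) \<le> norm (g z)" by (auto simp: indicator_def)
      also have "\<dots> \<le> B * indicator (cball 0 M) z" by (rule B(2))
      finally show ?thesis using divide_right_mono[of _ _ "e\<^sup>2"] by (simp add: norm_divide norm_power)
    qed
  qed (intro borel_measurable_divide borel_measurable_scaleR borel_measurable_indicator
      borel_measurable_const borel_open open_ball borel_measurable_continuous_onI contg)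
  have i2: "integrable lborel (\<lambda>z. R z * cauchy_kernel e (z - w))"
  proof -
    have "integrable lborel (\<lambda>z. (D z 1 + \<i> * D z \<i>) / 2 - indicator (ball w e) z *\<^sub>R g z / of_real (e\<^sup>2))"
      by (intro Bochner_Integration.integrable_diff i1 integrable_divide_zero Bochner_Integration.integrable_add integrable_mult_right D0)
    then show ?thesis by (simp add: eq[symmetric])
  qed
  have "(\<integral>z. R z * cauchy_kernel e (z - w) \<partial>lborel) + (\<integral>z. indicator (ball w e) z *\<^sub>R g z / of_real (e\<^sup>2) \<partial>lborel)
    = (\<integral>z. (D z 1 + \<i> * D z \<i>) / 2 \<partial>lborel)"
    by (subst Bochner_Integration.integral_add[OF i2 i1, symmetric]) (simp only: eq)
  also have "\<dots> = 0" using D0[of 1] D0[of \<i>] by simp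
  finally show ?thesis by simp
qed

text \<open>As \<open>e\<close> tends to 0 in the regularized identity, the first integral converges
  by domination with \<open>1 / norm (z - w)\<close>, and the second term is \<open>pi\<close> times
  the mean of \<open>g\<close> over a shrinking disc. Writing \<open>w - z\<close> for
  \<open>z - w\<close> absorbs the minus sign.\<close>

lemma cauchy_pompeiu:
  assumes g: "\<And>z. wirtinger g (P z) (R z) z"
    and cont: "continuous_on UNIV P" "continuous_on UNIV R"
    and supp: "\<And>z. norm z > M \<Longrightarrow> g z = 0"
  shows "integrable lborel (\<lambda>z. R z / (w - z))" "(\<integral>z. R z / (w - z) \<partial>lborel) = of_real pi * g w"
proof -
  obtain B where B: "B > 0" "\<And>z. norm (g z) \<le> B * indicator (cball 0 M) z" 
    "\<And>z. norm (R z) \<le> B * indicator (cball 0 M) z" 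
    "\<And>x y. norm (g x - g y) \<le> B * norm (x - y)"
    using wirtinger_compact_support_bounds[OF g cont supp] by blast
  have contg: "continuous_on UNIV g"
    using g has_derivative_continuous by (intro continuous_at_imp_continuous_on) blast
  have [measurable]: "g \<in> borel_measurable borel" "R \<in> borel_measurable borel"
    using contg cont by (auto intro: borel_measurable_continuous_onI)
  define e where "e k = 1 / real (Suc k)" for k
  have e: "e k > 0" for k by (simp add: e_def)
  have elim: "e \<longlonglongrightarrow> 0" unfolding e_def using LIMSEQ_inverse_real_of_nat by (simp add: inverse_eq_divide)
  have w: "integrable lborel (\<lambda>z. B * (indicator (cball 0 M) z / norm (z - w)))"
    by (intro integrable_mult_right integrable_inverse_norm_cball)
  have bd: "norm (R z * cauchy_kernel (e k) (z - w)) \<le> B * (indicator (cball 0 M) z / norm (z - w))" for k z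
    unfolding norm_mult using mult_mono[OF B(3)[of z] norm_cauchy_kernel_le_inverse[OF e[of k], of "z - w"]] B(1) by simp
  have lim: "(\<lambda>k. R z * cauchy_kernel (e k) (z - w)) \<longlonglongrightarrow> R z / (z - w)" for z
  proof (cases "z = w")
    \<comment> \<open>The sequence and its limit are both 0 at \<open>z = w\<close> because division
      by 0 gives 0, so the convergence holds at every point.\<close>
    case True then show ?thesis by (simp add: cauchy_kernel_def)
  next
    case False
    then have "\<forall>\<^sub>F k in sequentially. e k < norm (z - w)" using elim by (intro order_tendstoD) auto
    then have "\<forall>\<^sub>F k in sequentially. R z / (z - w) = R z * cauchy_kernel (e k) (z - w)"
      by eventually_elim (use e in \<open>simp add: cauchy_kernel_outside\<close>)
    then show ?thesis by (rule Lim_transform_eventually[OF tendsto_const])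
  qed
  have I: "integrable lborel (\<lambda>z. R z / (z - w))"
    "(\<lambda>k. \<integral>z. R z * cauchy_kernel (e k) (z - w) \<partial>lborel) \<longlonglongrightarrow> (\<integral>z. R z / (z - w) \<partial>lborel)"
    by (rule integrable_dominated_convergence[where s="\<lambda>k z. R z * cauchy_kernel (e k) (z - w)", OF _ _ w] 
          integral_dominated_convergence[where s="\<lambda>k z. R z * cauchy_kernel (e k) (z - w)", OF _ _ w];
        use lim bd in auto)+
  have "(\<lambda>k. (\<integral>z. indicator (ball w (e k)) z *\<^sub>R g z \<partial>lborel) / of_real ((e k)\<^sup>2)) \<longlonglongrightarrow> of_real pi * g w"
  proof (rule metric_LIMSEQ_I)
    fix r :: real assume r: "r > 0"
    \<comment> \<open>The disc contributes a factor \<open>pi < 4\<close>, hence the tolerance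
      \<open>r / 4\<close>.\<close>
    obtain d where d: "d > 0" "\<And>z. dist z w < d \<Longrightarrow> dist (g z) (g w) < r / 4"
      using contg r unfolding continuous_on_iff by (metis UNIV_I zero_less_divide_iff zero_less_numeral)
    obtain N where N: "\<And>k. k \<ge> N \<Longrightarrow> e k < d"
      using order_tendstoD(2)[OF elim d(1)] by (auto simp: eventually_sequentially)
    have "dist ((\<integral>z. indicator (ball w (e k)) z *\<^sub>R g z \<partial>lborel) / of_real ((e k)\<^sup>2)) (of_real pi * g w) < r" if "k \<ge> N" for k
    proof -
      let ?b = "ball w (e k)"
      have ib: "integrable lborel (indicator ?b :: complex \<Rightarrow> real)"
        by (intro integrable_real_indicator) (auto simp: emeasure_lborel_ball_finite[unfolded infinity_ennreal_def])
      have mb: "measure lborel ?b = pi * (e k)\<^sup>2" using e[of k] by (intro measure_ball_complex) simp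
      have i1: "integrable lborel (\<lambda>z. indicator ?b z *\<^sub>R g z)"
      proof (rule integrable_bounded_support[of _ "B" M])
        show "norm (indicator ?b z *\<^sub>R g z) \<le> B * indicator (cball 0 M) z" for z
          using B(2)[of z] B(1) by (cases "z \<in> ?b") auto
      qed (intro borel_measurable_scaleR borel_measurable_indicator
         borel_open open_ball borel_measurable_continuous_onI contg)
      have i2: "integrable lborel (\<lambda>z. indicator ?b z *\<^sub>R g w)" by (intro integrable_scaleR_left) (rule ib)
      have "(\<integral>z. indicator ?b z *\<^sub>R g w \<partial>lborel) = of_real (pi * (e k)\<^sup>2) * g w"
        by (subst integral_scaleR_left) (use ib mb in \<open>auto simp: scaleR_conv_of_real\<close>)
      then have "(\<integral>z. indicator ?b z *\<^sub>R g z \<partial>lborel) - of_real (pi * (e k)\<^sup>2) * g w = (\<integral>z. indicator ?b z *\<^sub>R (g z - g w) \<partial>lborel)"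
        by (simp add: scaleR_diff_right Bochner_Integration.integral_diff[OF i1 i2])
      moreover have "norm (\<integral>z. indicator ?b z *\<^sub>R (g z - g w) \<partial>lborel) \<le> (\<integral>z. indicator ?b z * (r / 4) \<partial>lborel)"
      proof (rule Bochner_Integration.integral_norm_bound_integral)
        show "norm (indicat_real ?b z *\<^sub>R (g z - g w)) \<le> indicat_real ?b z * (r / 4)" for z
          using d(2)[of z] N[OF that] by (auto simp: indicator_def dist_norm norm_minus_commute less_imp_le)
      qed (use i1 i2 ib in \<open>auto simp: scaleR_diff_right\<close>)
      moreover have "(\<integral>z. indicator ?b z * (r / 4) \<partial>lborel) = pi * (e k)\<^sup>2 * (r / 4)"
        using mb by simp
      ultimately have *: "norm ((\<integral>z. indicator ?b z *\<^sub>R g z \<partial>lborel) - of_real (pi * (e k)\<^sup>2) * g w) \<le> pi * (e k)\<^sup>2 * (r / 4)"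
        by (simp only:)
      have "(\<integral>z. indicator ?b z *\<^sub>R g z \<partial>lborel) / of_real ((e k)\<^sup>2) - of_real pi * g w
        = ((\<integral>z. indicator ?b z *\<^sub>R g z \<partial>lborel) - of_real (pi * (e k)\<^sup>2) * g w) / of_real ((e k)\<^sup>2)"
        using e[of k] by (simp add: field_simps)
      then have "norm ((\<integral>z. indicator ?b z *\<^sub>R g z \<partial>lborel) / of_real ((e k)\<^sup>2) - of_real pi * g w) \<le> pi * (e k)\<^sup>2 * (r / 4) / (e k)\<^sup>2"
        using divide_right_mono[OF *, of "(e k)\<^sup>2"] by (simp add: norm_divide norm_power)
      also have "\<dots> = pi * (r / 4)" using e[of k] by simp
      also have "\<dots> < r" using pi_less_4 r by simp
      finally show ?thesis by (simp add: dist_norm)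
    qed
    then show "\<exists>N. \<forall>k\<ge>N. dist ((\<integral>z. indicator (ball w (e k)) z *\<^sub>R g z \<partial>lborel) / of_real ((e k)\<^sup>2)) (of_real pi * g w) < r"
      by blast
  qed
  from tendsto_add[OF I(2) this] have "(\<lambda>k. 0) \<longlonglongrightarrow> (\<integral>z. R z / (z - w) \<partial>lborel) + of_real pi * g w"
    using cauchy_pompeiu_regularized[OF g cont supp e] by simp
  then have E: "(\<integral>z. R z / (z - w) \<partial>lborel) = - (of_real pi * g w)"
    by (simp add: LIMSEQ_const_iff add_eq_0_iff2)
  have eq: "R z / (w - z) = - (R z / (z - w))" for z by (simp add: minus_divide_right)
  show "integrable lborel (\<lambda>z. R z / (w - z))" unfolding eq using I(1) by simp
  show "(\<integral>z. R z / (w - z) \<partial>lborel) = of_real pi * g w"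
    unfolding eq using E by (simp del: minus_divide_right minus_divide_left)
qed

section \<open>Cutoff functions with one continuous derivative\<close>

definition sqpos :: "real \<Rightarrow> real" where "sqpos x = (max 0 x)\<^sup>2"

text \<open>Squaring the positive part makes the derivative continuous through 0, which is the
  regularity demanded of the cutoffs below.\<close>

lemma sqpos_has_derivative: "(sqpos has_real_derivative 2 * max 0 x) (at x)"
proof -
  consider "x > 0" | "x < 0" | "x = 0" by linarith
  then show ?thesis
  proof cases
    case 1
    have "((\<lambda>x. x\<^sup>2) has_real_derivative 2 * max 0 x) (at x)"
      using 1 by (auto intro!: derivative_eq_intros)
    then show ?thesis
      by (rule has_field_derivative_transform_within_open[of _ _ _ "{0<..}"]) (use 1 in \<open>auto simp: sqpos_def\<close>)
  next
    case 2
    have "((\<lambda>x. 0) has_real_derivative 2 * max 0 x) (at x)"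
      using 2 by (auto intro!: derivative_eq_intros)
    then show ?thesis
      by (rule has_field_derivative_transform_within_open[of _ _ _ "{..<0}"]) (use 2 in \<open>auto simp: sqpos_def\<close>)
  next
    case 3
    have "(\<lambda>h. sqpos h / h) \<midarrow>0\<rightarrow> 0"
    proof (rule Lim_null_comparison)
      have "norm (sqpos h / h) \<le> \<bar>h\<bar>" for h
        by (cases "h > 0") (auto simp: sqpos_def power2_eq_square)
      then show "\<forall>\<^sub>F h in at 0. norm (sqpos h / h) \<le> \<bar>h\<bar>" by simp
      show "((\<lambda>h::real. \<bar>h\<bar>) \<longlongrightarrow> 0) (at 0)" by (rule tendsto_rabs_zero) (rule tendsto_ident_at)
    qed
    then show ?thesis using 3 by (simp add: DERIV_def sqpos_def)
  qed
qed

text \<open>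
  The derivative of a real function as a complex number: \<open>G = h\<^sub>x - i h\<^sub>y\<close>, twice the Wirtinger
  derivative of \<open>h\<close>. The Laplacian of \<open>h\<close> is then \<open>2 R\<close>, where \<open>R\<close> is the derivative of \<open>G\<close>
  with respect to the conjugate variable.
\<close>

abbreviation rgrad :: "(complex \<Rightarrow> real) \<Rightarrow> complex \<Rightarrow> complex \<Rightarrow> bool" where
  "rgrad h G z \<equiv> (h has_derivative (\<lambda>v. Re (G * v))) (at z)"

lemma rgrad_wirtinger:
  assumes "rgrad h G z" shows "wirtinger (\<lambda>z. of_real (h z)) (G / 2) (cnj G / 2) z"
proof -
  have "((\<lambda>z. complex_of_real (h z)) has_derivative (\<lambda>v. of_real (Re (G * v)))) (at z)"
    by (rule has_derivative_of_real[OF assms])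
  moreover have "of_real (Re (G * v)) = G / 2 * v + cnj G / 2 * cnj v" for v
    by (simp add: complex_eq_iff field_simps)
  ultimately show ?thesis by simp
qed

lemma rgrad_norm_diff_sq: "rgrad (\<lambda>z. (norm (z - a))\<^sup>2) (2 * cnj (z - a)) z"
proof -
  have eq: "(norm (z - a))\<^sup>2 = (z - a) \<bullet> (z - a)" for z by (simp add: power2_norm_eq_inner)
  have "((\<lambda>z. (z - a) \<bullet> (z - a)) has_derivative (\<lambda>v. (z - a) \<bullet> v + v \<bullet> (z - a))) (at z)"
    by (auto intro!: derivative_eq_intros)
  moreover have "(z - a) \<bullet> v + v \<bullet> (z - a) = Re (2 * cnj (z - a) * v)" for v
    by (simp add: inner_complex_def algebra_simps)
  ultimately show ?thesis unfolding eq by simp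
qed

lemma rgrad_compose:
  assumes "rgrad h G z" "(f has_real_derivative D) (at (h z))"
  shows "rgrad (\<lambda>z. f (h z)) (of_real D * G) z"
proof -
  have "((\<lambda>z. f (h z)) has_derivative (\<lambda>v. D * Re (G * v))) (at z)"
    by (rule has_derivative_compose[OF assms(1) assms(2)[unfolded has_field_derivative_def]])
  moreover have "D * Re (G * v) = Re (of_real D * G * v)" for v
    by (simp only: mult.assoc Re_complex_of_real times_complex.sel Im_complex_of_real)
  ultimately show ?thesis by (simp only:)
qed

text \<open>The sum \<open>B\<close> of finitely many bumps on balls inside \<open>U\<close> is
  bounded below on \<open>K\<close> by some \<open>m > 0\<close>. Then
  \<open>1 - sqpos (1 - B / m)\<close> equals 1 where \<open>B \<ge> m\<close>, and 0 where
  \<open>B = 0\<close>, in particular off the balls.\<close>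

lemma exists_C1_cutoff:
  fixes K :: "complex set"
  assumes K: "compact K" and U: "open U" "K \<subseteq> U"
  obtains ch :: "complex \<Rightarrow> real" and G L where "\<And>z. rgrad ch (G z) z" "continuous_on UNIV G"
    "\<And>z. z \<in> K \<Longrightarrow> ch z = 1" "compact L" "L \<subseteq> U" "\<And>z. z \<notin> L \<Longrightarrow> ch z = 0"
proof -
  have "\<forall>a\<in>K. \<exists>r>0. cball a r \<subseteq> U" using U open_contains_cball by blast
  then obtain r where r: "\<And>a. a \<in> K \<Longrightarrow> r a > 0 \<and> cball a (r a) \<subseteq> U" by metis
  obtain A where A: "A \<subseteq> K" "finite A" "K \<subseteq> (\<Union>a\<in>A. ball a (r a))"
  proof (rule compactE_image[OF K, of K "\<lambda>a. ball a (r a)"])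
    show "K \<subseteq> (\<Union>a\<in>K. ball a (r a))" using r by force
  qed auto
  define b where "b a z = sqpos ((r a)\<^sup>2 - (norm (z - a))\<^sup>2)" for a z
  define bG where "bG a z = of_real (2 * max 0 ((r a)\<^sup>2 - (norm (z - a))\<^sup>2)) * (- (2 * cnj (z - a)))" for a z
  define B where "B z = (\<Sum>a\<in>A. b a z)" for z
  define BG where "BG z = (\<Sum>a\<in>A. bG a z)" for z
  have bg: "rgrad (b a) (bG a z) z" for a z
  proof -
    have "rgrad (\<lambda>z. (r a)\<^sup>2 - (norm (z - a))\<^sup>2) (- (2 * cnj (z - a))) z"
      using has_derivative_diff[OF has_derivative_const rgrad_norm_diff_sq, of "(r a)\<^sup>2" a z]
      by (simp only: diff_0 mult_minus_left uminus_complex.sel)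
    from rgrad_compose[OF this sqpos_has_derivative] show ?thesis
      unfolding b_def bG_def .
  qed
  have Bg: "rgrad B (BG z) z" for z
    using has_derivative_sum[of A b "\<lambda>a v. Re (bG a z * v)" "at z", OF bg]
    unfolding B_def BG_def by (simp add: sum_distrib_right)
  have cB: "continuous_on S B" for S
    using Bg has_derivative_continuous by (intro continuous_at_imp_continuous_on ballI) blast
  have cBG: "continuous_on UNIV BG"
    unfolding BG_def bG_def by (intro continuous_intros)
  have b0: "b a z \<ge> 0" for a z by (simp add: b_def sqpos_def)
  have Bpos: "B z > 0" if zK: "z \<in> K" for z
  proof -
    obtain a where a: "a \<in> A" "z \<in> ball a (r a)" using A zK by blast
    have "(norm (z - a))\<^sup>2 < (r a)\<^sup>2"
      using a by (intro power_strict_mono) (auto simp: dist_norm norm_minus_commute)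
    then have "b a z > 0" by (simp add: b_def sqpos_def)
    then show ?thesis unfolding B_def using A a b0 by (intro sum_pos2[of A a]) auto
  qed
  obtain m where m: "m > 0" "\<And>z. z \<in> K \<Longrightarrow> B z \<ge> m"
  proof (cases "K = {}")
    case False
    then obtain x where "x \<in> K" "\<forall>y\<in>K. B x \<le> B y" using continuous_attains_inf[OF K _ cB] by blast
    with Bpos that show ?thesis by blast
  qed (use that[of 1] in auto)
  define ch where "ch z = 1 - sqpos (1 - B z / m)" for z
  define G where "G z = of_real (2 * max 0 (1 - B z / m) / m) * BG z" for z
  define L where "L = (\<Union>a\<in>A. cball a (r a))"
  show ?thesis
  proof (rule that[of ch G L])
    show "rgrad ch (G z) z" for z
    proof -
      have "((\<lambda>x. 1 - sqpos (1 - x / m)) has_real_derivative 2 * max 0 (1 - B z / m) / m) (at (B z))"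
      proof -
        have "((\<lambda>x. sqpos (1 - x / m)) has_real_derivative 2 * max 0 (1 - B z / m) * (- 1 / m)) (at (B z))"
          by (rule DERIV_chain2[OF sqpos_has_derivative]) (use m in \<open>auto intro!: derivative_eq_intros\<close>)
        from DERIV_diff[OF DERIV_const[of 1] this] show ?thesis by simp
      qed
      from rgrad_compose[OF Bg this] show ?thesis by (simp add: ch_def[abs_def] G_def)
    qed
    show "continuous_on UNIV G" unfolding G_def using m by (intro continuous_intros cBG cB) auto
    show "ch z = 1" if "z \<in> K" for z using m that by (simp add: ch_def sqpos_def)
    show "compact L" unfolding L_def using A by auto
    show "L \<subseteq> U" unfolding L_def using A r by blast
    show "ch z = 0" if "z \<notin> L" for z
    proof -
      have "b a z = 0" if "a \<in> A" for a
      proof -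
        have "norm (z - a) > r a" using \<open>z \<notin> L\<close> that by (auto simp: L_def dist_norm norm_minus_commute)
        moreover have "r a > 0" using r A that by blast
        ultimately have "(r a)\<^sup>2 \<le> (norm (z - a))\<^sup>2" by (intro power_mono) auto
        then show ?thesis by (simp add: b_def sqpos_def)
      qed
      then show ?thesis by (simp add: ch_def B_def sqpos_def)
    qed
  qed
qed

text \<open>What matters is the gradient bound of order \<open>1 / r\<close>: multiplied by a
  function of size \<open>o(1 / r)\<close> and by the area of the disc, it tends to 0 with
  \<open>r\<close>.\<close>

lemma exists_puncture_cutoff:
  fixes p :: complex and r :: real
  assumes r: "r > 0"
  obtains \<eta> :: "complex \<Rightarrow> real" and G where "\<And>z. rgrad \<eta> (G z) z" "continuous_on UNIV G"
    "\<And>z. norm (z - p) \<le> r / 2 \<Longrightarrow> \<eta> z = 0" "\<And>z. norm (z - p) \<ge> r \<Longrightarrow> \<eta> z = 1"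
    "\<And>z. 0 \<le> \<eta> z \<and> \<eta> z \<le> 1" 
    "\<And>z. norm (G z) \<le> 32 / r" "\<And>z. norm (z - p) < r / 2 \<Longrightarrow> G z = 0" "\<And>z. norm (z - p) > r \<Longrightarrow> G z = 0"
proof -
  define a where "a z = 1 - (norm (z - p))\<^sup>2 / r\<^sup>2" for z
  \<comment> \<open>The factor 4 makes \<open>b\<close> negative on the disc of radius
    \<open>r / 2\<close>: there \<open>a z \<ge> 3 / 4\<close>, hence
    \<open>4 * sqpos (a z) \<ge> 9 / 4\<close>.\<close>
  define b where "b z = 1 - 4 * sqpos (a z)" for z
  define \<eta> where "\<eta> z = sqpos (b z)" for z
  define G where "G z = of_real (2 * max 0 (b z) * (-4 * (2 * max 0 (a z))) * (- 1 / r\<^sup>2)) * (2 * cnj (z - p))" for z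
  have ga: "rgrad a (of_real (- 1 / r\<^sup>2) * (2 * cnj (z - p))) z" for z
  proof -
    have "((\<lambda>x. 1 - x / r\<^sup>2) has_real_derivative (- 1 / r\<^sup>2)) (at ((norm (z - p))\<^sup>2))"
      using r by (auto intro!: derivative_eq_intros simp: field_simps power2_eq_square power4_eq_xxxx)
    from rgrad_compose[OF rgrad_norm_diff_sq this] show ?thesis by (simp add: a_def[abs_def])
  qed
  have g: "rgrad \<eta> (G z) z" for z
  proof -
    have "((\<lambda>x. sqpos (1 - 4 * sqpos x)) has_real_derivative 2 * max 0 (b z) * (-4 * (2 * max 0 (a z)))) (at (a z))"
      unfolding b_def
    proof (rule DERIV_chain2[OF sqpos_has_derivative])
      from DERIV_diff[OF DERIV_const[of 1] DERIV_cmult[OF sqpos_has_derivative[of "a z"], of 4]]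
      show "((\<lambda>x. 1 - 4 * sqpos x) has_real_derivative -4 * (2 * max 0 (a z))) (at (a z))" by simp
    qed
    from rgrad_compose[OF ga this] show ?thesis by (simp add: \<eta>_def[abs_def] b_def[abs_def] G_def mult_ac)
  qed
  have ca: "continuous_on UNIV a" and cb: "continuous_on UNIV b"
    unfolding a_def b_def sqpos_def using r by (intro continuous_intros; simp)+
  have cG: "continuous_on UNIV G" unfolding G_def by (intro continuous_intros ca cb)
  have near: "b z < 0" if "norm (z - p) \<le> r / 2" for z
  proof -
    have "(norm (z - p))\<^sup>2 \<le> (r / 2)\<^sup>2" using that by (intro power_mono) auto
    then have "a z \<ge> 3 / 4" using r by (simp add: a_def field_simps power2_eq_square)
    then have "(3/4)\<^sup>2 \<le> sqpos (a z)" unfolding sqpos_def by (intro power_mono) auto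
    then show ?thesis by (simp add: b_def power2_eq_square)
  qed
  have far: "a z \<le> 0" if "norm (z - p) \<ge> r" for z
  proof -
    have "r\<^sup>2 \<le> (norm (z - p))\<^sup>2" using that r by (intro power_mono) auto
    then show ?thesis using r by (simp add: a_def)
  qed
  have b1: "b z \<le> 1" and a1: "a z \<le> 1" for z by (auto simp: b_def a_def sqpos_def)
  show ?thesis
  proof (rule that[of \<eta> G])
    show "\<eta> z = 0" if "norm (z - p) \<le> r / 2" for z using near[OF that] by (simp add: \<eta>_def sqpos_def)
    show "\<eta> z = 1" if "norm (z - p) \<ge> r" for z using far[OF that] by (simp add: \<eta>_def b_def sqpos_def)
    show "0 \<le> \<eta> z \<and> \<eta> z \<le> 1" for z using b1[of z] by (auto simp: \<eta>_def sqpos_def power_le_one)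
    show "G z = 0" if "norm (z - p) < r / 2" for z using near[of z] that by (simp add: G_def)
    show G0: "G z = 0" if "norm (z - p) > r" for z using far[of z] that by (simp add: G_def)
    show "norm (G z) \<le> 32 / r" for z
    proof (cases "norm (z - p) > r")
      case True then show ?thesis using r G0 by simp
    next
      case False
      \<comment> \<open>The constant is \<open>2 * 4 * 2 * 2\<close>: the derivative of the outer
        \<open>sqpos\<close>, the factor in \<open>b\<close>, the derivative of the inner
        \<open>sqpos\<close>, and that of the squared norm.\<close>
      have "norm (G z) = 32 * (max 0 (b z) * (max 0 (a z) * (norm (z - p) / r\<^sup>2)))"
        using r by (simp add: G_def norm_mult norm_divide norm_power del: complex_cnj_diff)
      also have "\<dots> \<le> 32 * (1 * (1 * (r / r\<^sup>2)))"
        using b1[of z] a1[of z] False r 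
        by (intro mult_left_mono mult_mono divide_right_mono) auto
      also have "\<dots> = 32 / r" using r by (simp add: power2_eq_square)
      finally show ?thesis .
    qed
  qed (use g cG in auto)
qed

section \<open>Contour integrals and Green's theorem\<close>

lemma path_image_negligible:
  assumes "\<And>t. t \<in> {0..1} \<Longrightarrow> (\<gamma> has_vector_derivative \<gamma>' t) (at t within {0..1})"
  shows "negligible (path_image (\<gamma> :: real \<Rightarrow> complex))"
  unfolding path_image_def
proof (rule negligible_differentiable_image_lowdim)
  show "\<gamma> differentiable_on {0..1}"
    using assms unfolding differentiable_on_def by (meson differentiableI_vector)
qed simp

lemma C1_path_valid:
  assumes der: "\<And>t. t \<in> {0..1} \<Longrightarrow> (\<gamma> has_vector_derivative \<gamma>' t) (at t within {0..1})"
    and cont: "continuous_on {0..1} \<gamma>'"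
  shows "valid_path (\<gamma> :: real \<Rightarrow> complex)"
  unfolding valid_path_def piecewise_C1_differentiable_on_def
\<comment> \<open>The derivative is only one-sided at 0 and 1, so the end points form the
  exceptional set.\<close>
proof (intro conjI exI[of _ "{0, 1}"])
  show "continuous_on {0..1} \<gamma>"
    using der by (meson continuous_on_eq_continuous_within has_vector_derivative_continuous)
  have "(\<gamma> has_vector_derivative \<gamma>' t) (at t)" if "t \<in> {0<..<1}" for t
    using der[of t] that by (simp add: at_within_Icc_at)
  then show "\<gamma> C1_differentiable_on {0..1} - {0, 1}"
    unfolding C1_differentiable_on_def
    by (intro exI[of _ \<gamma>'] conjI continuous_on_subset[OF cont]) (auto simp: less_le)
qed auto

text \<open>Two forms of the same integral: the Lebesgue form enters Fubini's theorem, the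
  Henstock--Kurzweil form the pointwise computations along the curve.\<close>

lemma C1_contour_integral:
  assumes der: "\<And>t. t \<in> {0..1} \<Longrightarrow> (\<gamma> has_vector_derivative \<gamma>' t) (at t within {0..1})"
    and cont: "continuous_on {0..1} \<gamma>'" and f: "continuous_on (path_image \<gamma>) f"
  shows "contour_integral \<gamma> f = (\<integral>t. indicator {0..1} t *\<^sub>R (f (\<gamma> t) * \<gamma>' t) \<partial>lborel)"
    and "contour_integral \<gamma> f = integral {0..1} (\<lambda>t. f (\<gamma> t) * \<gamma>' t)"
proof -
  have c\<gamma>: "continuous_on {0..1} \<gamma>"
    using der by (meson continuous_on_eq_continuous_within has_vector_derivative_continuous)
  have c: "continuous_on {0..1} (\<lambda>t. f (\<gamma> t) * \<gamma>' t)"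
    by (intro continuous_intros cont continuous_on_compose2[OF f c\<gamma>]) (auto simp: path_image_def)
  have "set_integrable lborel {0..1} (\<lambda>t. f (\<gamma> t) * \<gamma>' t)"
    using c by (intro borel_integrable_atLeastAtMost') auto
  from set_borel_integral_eq_integral(2)[OF this]
  have 1: "(\<integral>t. indicator {0..1} t *\<^sub>R (f (\<gamma> t) * \<gamma>' t) \<partial>lborel) = integral {0..1} (\<lambda>t. f (\<gamma> t) * \<gamma>' t)"
    by (simp add: set_lebesgue_integral_def)
  have "contour_integral \<gamma> f = integral {0..1} (\<lambda>t. f (\<gamma> t) * vector_derivative \<gamma> (at t))"
    by (rule contour_integral_integral)
  also have "\<dots> = integral {0..1} (\<lambda>t. f (\<gamma> t) * \<gamma>' t)"
  proof (rule integral_spike[of "{0,1}"])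
    show "f (\<gamma> t) * \<gamma>' t = f (\<gamma> t) * vector_derivative \<gamma> (at t)" if "t \<in> {0..1} - {0,1}" for t
    proof -
      have "(\<gamma> has_vector_derivative \<gamma>' t) (at t)"
        using der[of t] that by (simp add: at_within_Icc_at less_le)
      then show ?thesis by (simp add: vector_derivative_at)
    qed
  qed auto
  finally show 2: "contour_integral \<gamma> f = integral {0..1} (\<lambda>t. f (\<gamma> t) * \<gamma>' t)" .
  show "contour_integral \<gamma> f = (\<integral>t. indicator {0..1} t *\<^sub>R (f (\<gamma> t) * \<gamma>' t) \<partial>lborel)"
    using 1 2 by simp
qed

text \<open>After replacing \<open>of_real pi * g (\<gamma> t)\<close> by its representation, the
  integrals over \<open>t\<close> and \<open>z\<close> are exchanged; this is legitimate because the
  integral of \<open>norm (R z / (\<gamma> t - z))\<close> is bounded uniformly in \<open>t\<close>.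
  The inner integral is then a winding number: \<open>\<sigma>\<close> inside and 0 outside. The
  curve itself, where it is undefined, is a null set.\<close>

lemma green_winding_number:
  assumes g: "\<And>z. wirtinger g (P z) (R z) z"
    and cont: "continuous_on UNIV P" "continuous_on UNIV R"
    and supp: "\<And>z. norm z > M \<Longrightarrow> g z = 0"
    and der: "\<And>t. t \<in> {0..1} \<Longrightarrow> (\<gamma> has_vector_derivative \<gamma>' t) (at t within {0..1})"
    and cont': "continuous_on {0..1} \<gamma>'" and loop: "pathfinish \<gamma> = pathstart \<gamma>"
    and wn: "\<And>z. z \<in> inside (path_image \<gamma>) \<Longrightarrow> winding_number \<gamma> z = \<sigma>"
  shows "contour_integral \<gamma> g = 2 * \<i> * \<sigma> * (\<integral>z. indicator (inside (path_image \<gamma>)) z *\<^sub>R R z \<partial>lborel)"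
proof -
  obtain B where B: "B > 0" "\<And>z. norm (g z) \<le> B * indicator (cball 0 M) z" 
    "\<And>z. norm (R z) \<le> B * indicator (cball 0 M) z" 
    "\<And>x y. norm (g x - g y) \<le> B * norm (x - y)"
    using wirtinger_compact_support_bounds[OF g cont supp] by blast
  have contg: "continuous_on UNIV g"
    using g has_derivative_continuous by (intro continuous_at_imp_continuous_on) blast
  have c\<gamma>: "continuous_on {0..1} \<gamma>"
    using der by (meson continuous_on_eq_continuous_within has_vector_derivative_continuous)
  have vp: "valid_path \<gamma>" by (rule C1_path_valid[OF der cont'])
  define I where "I = {0..1::real}"
  define h where "h t z = indicator I t *\<^sub>R (\<gamma>' t * (R z / (\<gamma> t - z)))" for t z
  \<comment> \<open>Cutting \<open>\<gamma>\<close> and \<open>\<gamma>'\<close> off outside the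
    unit interval makes them Borel on the whole line, so that \<open>h\<close> is jointly
    measurable.\<close>
  define y where "y t = indicator I t *\<^sub>R \<gamma> t" for t
  define y' where "y' t = indicator I t *\<^sub>R \<gamma>' t" for t
  have [measurable]: "y \<in> borel_measurable borel" "y' \<in> borel_measurable borel"
    unfolding y_def y'_def I_def using c\<gamma> cont' by (auto intro: borel_measurable_continuous_on_indicator)
  have [measurable]: "R \<in> borel_measurable borel" 
    using cont by (auto intro: borel_measurable_continuous_onI)
  have h_eq: "h t z = y' t * (R z / (y t - z))" for t z
    by (simp add: h_def y'_def y_def indicator_def)
  have mh[measurable]: "case_prod h \<in> borel_measurable (lborel \<Otimes>\<^sub>M lborel)"
    unfolding h_eq by measurable
  obtain Bd where Bd: "Bd > 0" "\<And>t. t \<in> I \<Longrightarrow> norm (\<gamma>' t) \<le> Bd"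
  proof -
    have "compact (\<gamma>' ` I)" unfolding I_def using cont' by (intro compact_continuous_image) auto
    then show ?thesis using that compact_imp_bounded bounded_pos by (metis image_eqI)
  qed
  obtain Bg where Bg: "Bg > 0" "\<And>t. t \<in> I \<Longrightarrow> norm (\<gamma> t) \<le> Bg"
  proof -
    have "compact (\<gamma> ` I)" unfolding I_def using c\<gamma> by (intro compact_continuous_image) auto
    then show ?thesis using that compact_imp_bounded bounded_pos by (metis image_eqI)
  qed
  define M' where "M' = max Bg M"
  have M': "M' > 0" "M \<le> M'" "\<And>t. t \<in> I \<Longrightarrow> norm (\<gamma> t) \<le> M'" 
    using Bg by (auto simp: M'_def max_def intro: order_trans)
  \<comment> \<open>Finite by \<open>nn_integral_inverse_norm_cball_finite\<close>, so
    \<open>enn2real\<close> loses nothing.\<close>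
  define C where "C = enn2real (\<integral>\<^sup>+z. ennreal (indicator (cball 0 (2 * M')) z / norm (z::complex)) \<partial>lborel)"
  have Rb: "norm (R z / (w - z)) \<le> B * (indicator (cball 0 M') z / norm (z - w))" for z w
  proof -
    have "norm (R z) \<le> B * indicator (cball 0 M') z"
      using B(3)[of z] M'(2) B(1) by (cases "norm z \<le> M") (auto simp: indicator_def)
    then show ?thesis by (simp add: norm_divide norm_minus_commute divide_right_mono)
  qed
  have iR: "integrable lborel (\<lambda>z. R z / (w - z))" for w
    by (rule cauchy_pompeiu(1)[OF g cont supp])
  have CP: "(\<integral>z. R z / (w - z) \<partial>lborel) = of_real pi * g w" for w
    by (rule cauchy_pompeiu(2)[OF g cont supp])
  have Cb: "(\<integral>z. norm (R z / (\<gamma> t - z)) \<partial>lborel) \<le> B * C" if "t \<in> I" for t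
  proof -
    have i: "integrable lborel (\<lambda>z. indicator (cball 0 M') z / norm (z - \<gamma> t))"
      by (rule integrable_inverse_norm_cball)
    have "(\<integral>z. norm (R z / (\<gamma> t - z)) \<partial>lborel) \<le> (\<integral>z. B * (indicator (cball 0 M') z / norm (z - \<gamma> t)) \<partial>lborel)"
      by (intro integral_mono integrable_norm iR integrable_mult_right i Rb)
    also have "\<dots> = B * (\<integral>z. indicator (cball 0 M') z / norm (z - \<gamma> t) \<partial>lborel)"
      by (rule integral_mult_right_zero)
    also have "(\<integral>z. indicator (cball 0 M') z / norm (z - \<gamma> t) \<partial>lborel) \<le> C"
    proof -
      have "(\<integral>z. indicator (cball 0 M') z / norm (z - \<gamma> t) \<partial>lborel)
        = enn2real (\<integral>\<^sup>+z. ennreal (indicator (cball 0 M') z / norm (z - \<gamma> t)) \<partial>lborel)"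
        by (intro integral_eq_nn_integral) (use i in auto)
      also have "\<dots> \<le> C" unfolding C_def
        using nn_integral_inverse_norm_uniform[OF M'(1) M'(3)[OF that]] nn_integral_inverse_norm_cball_finite[of "2*M'"] M'(1)
        by (intro enn2real_mono) auto
      finally show ?thesis .
    qed
    finally show ?thesis using B(1) by (simp add: mult_left_mono)
  qed
  have ih: "integrable (lborel \<Otimes>\<^sub>M lborel) (case_prod h)"
  proof (rule lborel_pair.Fubini_integrable[OF mh])
    show "AE t in lborel. integrable lborel (\<lambda>z. case_prod h (t, z))"
      unfolding h_def case_prod_conv by (intro AE_I2 integrable_scaleR_right integrable_mult_right iR)
    show "integrable lborel (\<lambda>t. \<integral>z. norm (case_prod h (t, z)) \<partial>lborel)"
    proof (rule Bochner_Integration.integrable_bound)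
      show "integrable lborel (\<lambda>t. Bd * (B * C) * indicator I t)"
        unfolding I_def by (intro integrable_mult_right integrable_real_indicator) auto
      show "(\<lambda>t. \<integral>z. norm (case_prod h (t, z)) \<partial>lborel) \<in> borel_measurable lborel"
        by measurable
      have "norm (\<integral>z. norm (h t z) \<partial>lborel) \<le> norm (Bd * (B * C) * indicator I t)" for t
      proof (cases "t \<in> I")
        case True
        have "(\<integral>z. norm (h t z) \<partial>lborel) = norm (\<gamma>' t) * (\<integral>z. norm (R z / (\<gamma> t - z)) \<partial>lborel)"
          using True unfolding h_def norm_scaleR norm_mult[of "\<gamma>' t"]
          by (simp only: indicator_simps abs_one mult_1 integral_mult_right_zero)
        also have "\<dots> \<le> Bd * (B * C)"
          using True Bd by (intro mult_mono Cb) auto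
        finally show ?thesis using True by simp
      qed (simp add: h_def)
      then show "AE t in lborel. norm (\<integral>z. norm (case_prod h (t, z)) \<partial>lborel) \<le> norm (Bd * (B * C) * indicator I t)"
        by simp
    qed
  qed
  have F: "(\<integral>z. (\<integral>t. h t z \<partial>lborel) \<partial>lborel) = (\<integral>t. (\<integral>z. h t z \<partial>lborel) \<partial>lborel)"
    by (rule lborel_pair.Fubini_integral[OF ih])
  have "(\<integral>z. h t z \<partial>lborel) = of_real pi * (indicator I t *\<^sub>R (g (\<gamma> t) * \<gamma>' t))" for t
    unfolding h_def integral_scaleR_right integral_mult_right_zero CP by simp
  then have "(\<integral>t. (\<integral>z. h t z \<partial>lborel) \<partial>lborel) = of_real pi * contour_integral \<gamma> g"
    using C1_contour_integral(1)[OF der cont' continuous_on_subset[OF contg subset_UNIV]] 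
    by (simp only: I_def integral_mult_right_zero)
  moreover have "(\<integral>z. (\<integral>t. h t z \<partial>lborel) \<partial>lborel) 
      = (\<integral>z. 2 * pi * \<i> * \<sigma> * (indicator (inside (path_image \<gamma>)) z *\<^sub>R R z) \<partial>lborel)"
  proof (rule integral_cong_AE)
    have "path_image \<gamma> \<in> null_sets lborel"
    proof -
      have "compact (path_image \<gamma>)" using vp by (simp add: compact_path_image valid_path_imp_path)
      then have "path_image \<gamma> \<in> sets lborel" by (simp add: borel_closed compact_imp_closed)
      then show ?thesis using path_image_negligible[OF der] 
        by (simp add: negligible_iff_null_sets null_sets_completion_iff)
    qed
    from AE_not_in[OF this] show "AE z in lborel. (\<integral>t. h t z \<partial>lborel) 
        = 2 * pi * \<i> * \<sigma> * (indicator (inside (path_image \<gamma>)) z *\<^sub>R R z)"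
    proof eventually_elim
      case (elim z)
      have cz: "continuous_on (path_image \<gamma>) (\<lambda>w. 1 / (w - z))"
        using elim by (intro continuous_intros) auto
      have "(\<integral>t. h t z \<partial>lborel) = R z * (\<integral>t. indicator I t *\<^sub>R (1 / (\<gamma> t - z) * \<gamma>' t) \<partial>lborel)"
        unfolding h_def by (subst integral_mult_right_zero[symmetric]) (auto intro!: Bochner_Integration.integral_cong simp: indicator_def)
      also have "\<dots> = R z * contour_integral \<gamma> (\<lambda>w. 1 / (w - z))"
        unfolding I_def by (intro arg_cong[of _ _ "\<lambda>x. R z * x"] C1_contour_integral(1)[symmetric] der cont' cz)
      also have "contour_integral \<gamma> (\<lambda>w. 1 / (w - z)) = 2 * pi * \<i> * winding_number \<gamma> z"
        using winding_number_valid_path[OF vp elim] by simp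
      also have "winding_number \<gamma> z = (if z \<in> inside (path_image \<gamma>) then \<sigma> else 0)"
      proof (cases "z \<in> inside (path_image \<gamma>)")
        case False
        then have "z \<in> outside (path_image \<gamma>)" using elim union_with_outside[of "path_image \<gamma>"]
          by (metis ComplI Un_iff inside_Un_outside)
        then show ?thesis using False vp loop
          by (simp add: winding_number_zero_in_outside valid_path_imp_path)
      qed (simp add: wn)
      finally show ?case by (simp add: indicator_def)
    qed
    show "(\<lambda>z. \<integral>t. h t z \<partial>lborel) \<in> borel_measurable lborel" by measurable
    have "open (inside (path_image \<gamma>))" using vp 
      by (simp add: open_inside closed_path_image valid_path_imp_path)
    then have [measurable]: "inside (path_image \<gamma>) \<in> sets borel" by simp
    show "(\<lambda>z. 2 * pi * \<i> * \<sigma> * (indicator (inside (path_image \<gamma>)) z *\<^sub>R R z)) \<in> borel_measurable lborel" 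
      by measurable
  qed
  ultimately have "of_real pi * contour_integral \<gamma> g = of_real pi * (2 * \<i> * \<sigma> * (\<integral>z. indicator (inside (path_image \<gamma>)) z *\<^sub>R R z \<partial>lborel))"
    using F unfolding integral_mult_right_zero by (simp add: mult_ac)
  then show ?thesis by simp
qed

text \<open>The open sets \<open>V\<close> and \<open>- L\<close> cover the plane and the product
  vanishes on the second, so regularity can be checked on each of them. Functions with singularities
  outside \<open>V\<close> thus become accessible to \<open>green_winding_number\<close>.\<close>

lemma wirtinger_extend_mult:
  fixes ch :: "complex \<Rightarrow> real"
  assumes V: "open V" and G: "\<And>z. z \<in> V \<Longrightarrow> wirtinger G (P z) (R z) z"
    and cont: "continuous_on V P" "continuous_on V R"
    and ch: "\<And>z. rgrad ch (H z) z" "continuous_on UNIV H"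
    and L: "compact L" "L \<subseteq> V" "\<And>z. z \<notin> L \<Longrightarrow> ch z = 0"
  defines "P' \<equiv> \<lambda>z. if z \<in> V then of_real (ch z) * P z + H z / 2 * G z else 0"
    and "R' \<equiv> \<lambda>z. if z \<in> V then of_real (ch z) * R z + cnj (H z) / 2 * G z else 0"
  shows "\<And>z. wirtinger (\<lambda>z. if z \<in> V then of_real (ch z) * G z else 0) (P' z) (R' z) z"
    "continuous_on UNIV P'" "continuous_on UNIV R'"
proof -
  have VL: "open (- L)" using L by (simp add: compact_imp_closed open_Compl)
  have H0: "H z = 0" if "z \<notin> L" for z
  proof -
    from rgrad_wirtinger[OF ch(1)] have "H z / 2 = 0"
      by (rule wirtinger_zero_imp(1)[where S="- L"]) (use VL L that in auto)
    then show ?thesis by simp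
  qed
  let ?g = "\<lambda>z. if z \<in> V then of_real (ch z) * G z else 0"
  show "wirtinger ?g (P' z) (R' z) z" for z
  proof (cases "z \<in> V")
    case True
    from has_derivative_mult[OF rgrad_wirtinger[OF ch(1)] G[OF True]]
    have "wirtinger (\<lambda>z. of_real (ch z) * G z) (P' z) (R' z) z"
      by (rule has_derivative_eq_rhs) (use True in \<open>simp add: P'_def R'_def fun_eq_iff algebra_simps\<close>)
    then show ?thesis
      by (rule has_derivative_transform_within_open[OF _ V True]) auto
  next
    case False
    then have zL: "z \<in> - L" using L by auto
    have "P' z = 0" "R' z = 0" using False by (auto simp: P'_def R'_def)
    then have "wirtinger (\<lambda>z. 0) (P' z) (R' z) z" by simp
    then show ?thesis
      by (rule has_derivative_transform_within_open[OF _ VL zL]) (use L(3) in auto)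
  qed
  have cG: "continuous_on V G"
    using G has_derivative_continuous by (intro continuous_at_imp_continuous_on) blast
  have cch: "continuous_on UNIV ch"
    using ch(1) has_derivative_continuous by (intro continuous_at_imp_continuous_on) blast
  have glue: "continuous_on UNIV (\<lambda>z. if z \<in> V then f z else 0)"
    if f: "continuous_on V f" "\<And>z. z \<notin> L \<Longrightarrow> f z = 0" for f :: "complex \<Rightarrow> complex"
  proof -
    have "continuous_on (V \<union> - L) (\<lambda>z. if z \<in> V then f z else 0)"
    proof (rule continuous_on_open_Un[OF V VL])
      show "continuous_on V (\<lambda>z. if z \<in> V then f z else 0)"
        using f(1) by (rule continuous_on_eq) auto
      show "continuous_on (- L) (\<lambda>z. if z \<in> V then f z else 0)"
        using continuous_on_const[of "- L" 0] by (rule continuous_on_eq) (use f in auto)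
    qed
    moreover have "V \<union> - L = UNIV" using L by auto
    ultimately show ?thesis by simp
  qed
  show "continuous_on UNIV P'" unfolding P'_def
    using L(3) H0
    by (intro glue continuous_intros continuous_on_subset[OF cch] continuous_on_subset[OF ch(2)] cG cont) auto
  show "continuous_on UNIV R'" unfolding R'_def
    using L(3) H0
    by (intro glue continuous_intros continuous_on_subset[OF cch] continuous_on_subset[OF ch(2)] cG cont) auto
qed

text \<open>The cutoff \<open>ch\<close> makes \<open>G\<close> global, and the cutoffs
  \<open>\<eta> k\<close> erase the puncture. The gradient of \<open>\<eta> k\<close> is the only
  source of error: at most \<open>32 / r\<close> times \<open>o(1 / r)\<close> over an area
  \<open>O(r\<^sup>2)\<close>, which explains the hypothesis on \<open>(z - p) * G z\<close>. The
  main term converges by domination with the integrable function \<open>R\<close>.\<close>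

lemma green_inside_punctured:
  fixes \<gamma> :: "real \<Rightarrow> complex"
  defines "\<Omega> \<equiv> inside (path_image \<gamma>)"
  assumes der: "\<And>t. t \<in> {0..1} \<Longrightarrow> (\<gamma> has_vector_derivative \<gamma>' t) (at t within {0..1})"
    and cont': "continuous_on {0..1} \<gamma>'" and loop: "pathfinish \<gamma> = pathstart \<gamma>"
    and wn: "\<And>z. z \<in> \<Omega> \<Longrightarrow> winding_number \<gamma> z = \<sigma>"
    and p: "p \<in> \<Omega>" and U: "open U" "\<Omega> \<union> path_image \<gamma> \<subseteq> U"
    and G: "\<And>z. z \<in> U - {p} \<Longrightarrow> wirtinger G (P z) (R z) z"
    and cont: "continuous_on (U - {p}) P" "continuous_on (U - {p}) R"
    and lim: "((\<lambda>z. (z - p) * G z) \<longlongrightarrow> 0) (at p)"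
    and int: "integrable lborel (\<lambda>z. indicator (\<Omega> - {p}) z *\<^sub>R R z)"
  shows "contour_integral \<gamma> G = 2 * \<i> * \<sigma> * (\<integral>z. indicator (\<Omega> - {p}) z *\<^sub>R R z \<partial>lborel)"
proof -
  have vp: "valid_path \<gamma>" by (rule C1_path_valid[OF der cont'])
  then have cpi: "compact (path_image \<gamma>)" by (simp add: compact_path_image valid_path_imp_path)
  then have clpi: "closed (path_image \<gamma>)" by (rule compact_imp_closed)
  have op: "open \<Omega>" unfolding \<Omega>_def using clpi by (rule open_inside)
  have dis: "\<Omega> \<inter> path_image \<gamma> = {}" unfolding \<Omega>_def by (rule inside_no_overlap)
  define K where "K = \<Omega> \<union> path_image \<gamma>"
  have "K = - outside (path_image \<gamma>)" unfolding K_def \<Omega>_def by (simp add: union_with_inside Un_commute)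
  moreover have "open (outside (path_image \<gamma>))" using clpi by (rule open_outside)
  ultimately have "closed K" by (simp add: closed_def)
  moreover have "bounded K" unfolding K_def \<Omega>_def using cpi 
    by (simp add: bounded_inside compact_imp_bounded)
  ultimately have K: "compact K" by (simp add: compact_eq_bounded_closed)
  obtain ch H L where ch: "\<And>z. rgrad ch (H z) z" "continuous_on UNIV H"
    "\<And>z. z \<in> K \<Longrightarrow> ch z = 1" "compact L" "L \<subseteq> U" "\<And>z. z \<notin> L \<Longrightarrow> ch z = 0"
    using exists_C1_cutoff[OF K U(1)] U(2) unfolding K_def by metis
  \<comment> \<open>\<open>ch\<close> is constant on the open set \<open>\<Omega>\<close>, so its
    gradient contributes nothing to the area integral.\<close>
  have H0: "H z = 0" if "z \<in> \<Omega>" for z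
  proof -
    have "((\<lambda>_. 1) has_derivative (\<lambda>v. Re (H z * v))) (at z)"
      using ch(1) by (rule has_derivative_transform_within_open[OF _ op that]) (use ch(3) in \<open>auto simp: K_def\<close>)
    then have *: "(\<lambda>v. Re (H z * v)) = (\<lambda>_. 0)"
      by (rule has_derivative_unique[OF _ has_derivative_const])
    show ?thesis using fun_cong[OF *, of 1] fun_cong[OF *, of \<i>] by (simp add: complex_eq_iff)
  qed
  have ppi: "p \<notin> path_image \<gamma>" using dis p by blast
  obtain r0 where r0: "r0 > 0" "ball p r0 \<subseteq> \<Omega>" using op p openE by blast
  define V where "V = U - {p}"
  have V: "open V" unfolding V_def using U by auto
  \<comment> \<open>The double \<open>Suc\<close> keeps \<open>r k < r0\<close> even for
    \<open>k = 0\<close>, so all the cutoffs are 1 on the curve.\<close>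
  define r where "r k = r0 / real (Suc (Suc k))" for k
  have r: "r k > 0" "r k < r0" for k using r0 by (auto simp: r_def field_simps intro!: add_pos_nonneg)
  have rlim: "r \<longlonglongrightarrow> 0"
  proof -
    have "(\<lambda>k. r0 * (1 / real (Suc (Suc k)))) \<longlonglongrightarrow> r0 * 0"
      using LIMSEQ_Suc[OF LIMSEQ_inverse_real_of_nat] by (intro tendsto_mult tendsto_const) (simp add: inverse_eq_divide)
    then show ?thesis by (simp add: r_def[abs_def])
  qed
  have "\<forall>k. \<exists>\<eta> E. (\<forall>z. rgrad \<eta> (E z) z) \<and> continuous_on UNIV E \<and>
    (\<forall>z. norm (z - p) \<le> r k / 2 \<longrightarrow> \<eta> z = 0) \<and> (\<forall>z. norm (z - p) \<ge> r k \<longrightarrow> \<eta> z = 1) \<and>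
    (\<forall>z. 0 \<le> \<eta> z \<and> \<eta> z \<le> 1) \<and> (\<forall>z. norm (E z) \<le> 32 / r k) \<and> (\<forall>z. norm (z - p) < r k / 2 \<longrightarrow> E z = 0)
    \<and> (\<forall>z. norm (z - p) > r k \<longrightarrow> E z = 0)"
  proof
    fix k
    obtain \<eta> E where "\<And>z. rgrad \<eta> (E z) z" "continuous_on UNIV E"
    "\<And>z. norm (z - p) \<le> r k / 2 \<Longrightarrow> \<eta> z = 0" "\<And>z. norm (z - p) \<ge> r k \<Longrightarrow> \<eta> z = 1"
    "\<And>z. 0 \<le> \<eta> z \<and> \<eta> z \<le> 1" 
    "\<And>z. norm (E z) \<le> 32 / r k" "\<And>z. norm (z - p) < r k / 2 \<Longrightarrow> E z = 0" "\<And>z. norm (z - p) > r k \<Longrightarrow> E z = 0"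
      using exists_puncture_cutoff[OF r(1)[of k], of p] by blast
    then show "\<exists>\<eta> E. (\<forall>z. rgrad \<eta> (E z) z) \<and> continuous_on UNIV E \<and>
    (\<forall>z. norm (z - p) \<le> r k / 2 \<longrightarrow> \<eta> z = 0) \<and> (\<forall>z. norm (z - p) \<ge> r k \<longrightarrow> \<eta> z = 1) \<and>
    (\<forall>z. 0 \<le> \<eta> z \<and> \<eta> z \<le> 1) \<and> (\<forall>z. norm (E z) \<le> 32 / r k) \<and> (\<forall>z. norm (z - p) < r k / 2 \<longrightarrow> E z = 0)
    \<and> (\<forall>z. norm (z - p) > r k \<longrightarrow> E z = 0)"
      by (intro exI[of _ \<eta>] exI[of _ E]) simp
  qed
  then obtain \<eta> E where eta: "\<And>k z. rgrad (\<eta> k) (E k z) z" "\<And>k. continuous_on UNIV (E k)"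
    "\<And>k z. norm (z - p) \<le> r k / 2 \<Longrightarrow> \<eta> k z = 0" "\<And>k z. norm (z - p) \<ge> r k \<Longrightarrow> \<eta> k z = 1"
    "\<And>k z. 0 \<le> \<eta> k z" "\<And>k z. \<eta> k z \<le> 1" "\<And>k z. norm (E k z) \<le> 32 / r k" 
    "\<And>k z. norm (z - p) < r k / 2 \<Longrightarrow> E k z = 0" "\<And>k z. norm (z - p) > r k \<Longrightarrow> E k z = 0"
    unfolding choice_iff by blast
  define ce where "ce k z = ch z * \<eta> k z" for k z
  define CE where "CE k z = of_real (\<eta> k z) * H z + of_real (ch z) * E k z" for k z
  have ceg: "rgrad (ce k) (CE k z) z" for k z
    unfolding ce_def
    using has_derivative_mult[OF ch(1) eta(1)]
    by (rule has_derivative_eq_rhs) (simp add: CE_def fun_eq_iff algebra_simps)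
  have contch: "continuous_on UNIV ch" "continuous_on UNIV (\<eta> k)" for k
    using ch(1) eta(1) has_derivative_continuous by (intro continuous_at_imp_continuous_on; blast)+
  have CEc: "continuous_on UNIV (CE k)" for k
    unfolding CE_def by (intro continuous_intros contch ch eta)
  define Lk where "Lk k = L - ball p (r k / 2)" for k
  have Lk: "compact (Lk k)" "Lk k \<subseteq> V" "\<And>z. z \<notin> Lk k \<Longrightarrow> ce k z = 0" for k
  proof -
    show "compact (Lk k)" unfolding Lk_def using ch(4) by (intro compact_diff) auto
    show "Lk k \<subseteq> V" using ch(5) r[of k] by (auto simp: Lk_def V_def)
    show "ce k z = 0" if "z \<notin> Lk k" for z
      using that ch(6)[of z] eta(3)[of z k] by (auto simp: Lk_def ce_def dist_norm norm_minus_commute)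
  qed
  define g where "g k z = (if z \<in> V then of_real (ce k z) * G z else 0)" for k z
  define P' where "P' k z = (if z \<in> V then of_real (ce k z) * P z + CE k z / 2 * G z else 0)" for k z
  define R' where "R' k z = (if z \<in> V then of_real (ce k z) * R z + cnj (CE k z) / 2 * G z else 0)" for k z
  note ext = wirtinger_extend_mult[OF V G[folded V_def] cont[folded V_def] ceg CEc Lk, folded g_def P'_def R'_def]
  obtain M where M: "\<And>z. z \<in> L \<Longrightarrow> norm z \<le> M"
    using ch(4) compact_imp_bounded bounded_iff by metis
  have gsupp: "g k z = 0" if "norm z > M" for k z
  proof -
    have "z \<notin> Lk k" using M[of z] that by (auto simp: Lk_def)
    then show ?thesis using Lk(3) by (simp add: g_def)
  qed
  have green: "contour_integral \<gamma> (g k) = 2 * \<i> * \<sigma> * (\<integral>z. indicator \<Omega> z *\<^sub>R R' k z \<partial>lborel)" for k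
    unfolding \<Omega>_def
    by (rule green_winding_number[OF ext(1) ext(2) ext(3) gsupp der cont' loop])
       (use wn in \<open>auto simp: \<Omega>_def\<close>)
  have cg: "contour_integral \<gamma> (g k) = contour_integral \<gamma> G" for k
  proof (rule contour_integral_cong)
    fix x assume x: "x \<in> path_image \<gamma>"
    then have "x \<notin> ball p r0" using r0 dis by blast
    then have "norm (x - p) \<ge> r k" using r[of k] by (auto simp: dist_norm norm_minus_commute)
    moreover have "x \<in> V" using x U ppi by (auto simp: V_def)
    ultimately show "g k x = G x" using x ch(3) eta(4) by (simp add: g_def ce_def K_def)
  qed simp
  have Rin: "indicator \<Omega> z *\<^sub>R R' k z = \<eta> k z *\<^sub>R (indicator (\<Omega> - {p}) z *\<^sub>R R z) 
      + indicator (\<Omega> - {p}) z *\<^sub>R (cnj (E k z) / 2 * G z)" for k z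
  proof (cases "z \<in> \<Omega> - {p}")
    case True
    then have "z \<in> V" "ch z = 1" "H z = 0" using U ch(3) H0 by (auto simp: V_def K_def)
    then show ?thesis using True by (simp add: R'_def ce_def CE_def scaleR_conv_of_real)
  qed (auto simp: R'_def V_def indicator_def)
  have [measurable]: "\<Omega> \<in> sets borel" using op by simp
  have contG: "continuous_on V G"
    using G has_derivative_continuous unfolding V_def by (intro continuous_at_imp_continuous_on) blast
  have mG: "(\<lambda>z. indicator (\<Omega> - {p}) z *\<^sub>R G z) \<in> borel_measurable borel"
    using U by (intro borel_measurable_continuous_on_indicator continuous_on_subset[OF contG]) (auto simp: V_def)
  have [measurable]: "\<eta> k \<in> borel_measurable borel" "E k \<in> borel_measurable borel" for k
    using contch(2) eta(2) by (auto intro: borel_measurable_continuous_onI)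
  have mE: "(\<lambda>z. cnj (E k z)) \<in> borel_measurable borel" for k
    using eta(2) by (intro borel_measurable_continuous_onI continuous_intros)
  have mEG: "(\<lambda>z. indicator (\<Omega> - {p}) z *\<^sub>R (cnj (E k z) / 2 * G z)) \<in> borel_measurable lborel" for k
  proof -
    have "(\<lambda>z. cnj (E k z) / 2 * (indicator (\<Omega> - {p}) z *\<^sub>R G z)) \<in> borel_measurable borel"
      by (intro borel_measurable_times borel_measurable_divide mG mE) auto
    then show ?thesis by simp
  qed
  have mR: "(\<lambda>z. indicator (\<Omega> - {p}) z *\<^sub>R R z) \<in> borel_measurable borel"
    using borel_measurable_integrable[OF int] by simp
  have lim1: "(\<lambda>k. \<integral>z. \<eta> k z *\<^sub>R (indicator (\<Omega> - {p}) z *\<^sub>R R z) \<partial>lborel) \<longlonglongrightarrow> (\<integral>z. indicator (\<Omega> - {p}) z *\<^sub>R R z \<partial>lborel)"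
    and int1: "\<And>k. integrable lborel (\<lambda>z. \<eta> k z *\<^sub>R (indicator (\<Omega> - {p}) z *\<^sub>R R z))"
  proof -
    have m: "(\<lambda>z. \<eta> k z *\<^sub>R (indicator (\<Omega> - {p}) z *\<^sub>R R z)) \<in> borel_measurable lborel" for k
      using borel_measurable_scaleR[OF _ mR, of "\<eta> k" for k] by (simp del: scaleR_scaleR)
    have b: "norm (\<eta> k z *\<^sub>R (indicator (\<Omega> - {p}) z *\<^sub>R R z)) \<le> norm (indicator (\<Omega> - {p}) z *\<^sub>R R z)" for k z
      using eta(5,6)[of k z] mult_right_mono[of "\<bar>\<eta> k z\<bar>" 1 "norm (indicator (\<Omega> - {p}) z *\<^sub>R R z)"] by (simp only: norm_scaleR) simp
    show "integrable lborel (\<lambda>z. \<eta> k z *\<^sub>R (indicator (\<Omega> - {p}) z *\<^sub>R R z))" for k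
      by (rule Bochner_Integration.integrable_bound[OF int m]) (use b in auto)
    have l: "(\<lambda>k. \<eta> k z *\<^sub>R (indicator (\<Omega> - {p}) z *\<^sub>R R z)) \<longlonglongrightarrow> indicator (\<Omega> - {p}) z *\<^sub>R R z" for z
    proof (cases "z = p")
      case False
      then have "\<forall>\<^sub>F k in sequentially. r k < norm (z - p)" using rlim by (intro order_tendstoD) auto
      then have "\<forall>\<^sub>F k in sequentially. indicator (\<Omega> - {p}) z *\<^sub>R R z = \<eta> k z *\<^sub>R (indicator (\<Omega> - {p}) z *\<^sub>R R z)"
        by eventually_elim (simp add: eta(4))
      then show ?thesis by (rule Lim_transform_eventually[OF tendsto_const])
    qed simp
    show "(\<lambda>k. \<integral>z. \<eta> k z *\<^sub>R (indicator (\<Omega> - {p}) z *\<^sub>R R z) \<partial>lborel) \<longlonglongrightarrow> (\<integral>z. indicator (\<Omega> - {p}) z *\<^sub>R R z \<partial>lborel)"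
      by (rule integral_dominated_convergence[where w="\<lambda>z. norm (indicator (\<Omega> - {p}) z *\<^sub>R R z)"])
         (use mR m b l int in \<open>auto intro!: integrable_norm simp del: norm_scaleR\<close>)
  qed
  \<comment> \<open>\<open>E k\<close> lives on the annulus between \<open>r k / 2\<close> and
    \<open>r k\<close>, where \<open>norm (G z) \<le> d / (r k / 2)\<close>; the product
    \<open>(32 / r k / 2) * (d / (r k / 2))\<close> gives the constant.\<close>
  have bE: "norm (indicator (\<Omega> - {p}) z *\<^sub>R (cnj (E k z) / 2 * G z)) \<le> 32 * d / (r k)\<^sup>2 * indicator (cball p (r k)) z"
    if d: "\<And>z. z \<noteq> p \<Longrightarrow> norm (z - p) \<le> r k \<Longrightarrow> norm ((z - p) * G z) \<le> d" "d \<ge> 0" for k z d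
  proof (cases "z \<noteq> p \<and> norm (z - p) \<le> r k \<and> norm (z - p) \<ge> r k / 2")
    case True
    have "norm (G z) = norm ((z - p) * G z) / norm (z - p)" using True by (simp add: norm_mult)
    also have "\<dots> \<le> d / (r k / 2)"
      using True r[of k] d by (intro frac_le) auto
    finally have "norm (cnj (E k z) / 2 * G z) \<le> (32 / r k / 2) * (d / (r k / 2))"
      unfolding norm_mult norm_divide using eta(7)[of k z] r[of k]
      by (intro mult_mono) auto
    also have "\<dots> = 32 * d / (r k)\<^sup>2" using r[of k] by (simp add: power2_eq_square)
    finally show ?thesis using True d(2) r[of k] by (auto simp: indicator_def dist_norm norm_minus_commute)
  next
    case False
    then have "z = p \<or> E k z = 0" using eta(8)[of z k] eta(9)[of k z] by fastforce
    then show ?thesis using d(2) by auto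
  qed
  have lim2: "(\<lambda>k. \<integral>z. indicator (\<Omega> - {p}) z *\<^sub>R (cnj (E k z) / 2 * G z) \<partial>lborel) \<longlonglongrightarrow> 0"
  proof (rule metric_LIMSEQ_I)
    fix e :: real assume e: "e > 0"
    \<comment> \<open>The disc of area \<open>pi * (r k)\<^sup>2\<close> turns the bound into
      \<open>32 * d * pi\<close>, which is below \<open>128 * d = e / 2\<close>.\<close>
    define d where "d = e / 256"
    have d: "d > 0" using e by (simp add: d_def)
    obtain s where s: "s > 0" "\<And>z. z \<noteq> p \<Longrightarrow> norm (z - p) < s \<Longrightarrow> norm ((z - p) * G z) < d"
      using lim d unfolding LIM_def by (metis diff_zero dist_norm)
    obtain N where N: "\<And>k. k \<ge> N \<Longrightarrow> r k < s"
      using order_tendstoD(2)[OF rlim s(1)] by (auto simp: eventually_sequentially)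
    have "dist (\<integral>z. indicator (\<Omega> - {p}) z *\<^sub>R (cnj (E k z) / 2 * G z) \<partial>lborel) 0 < e" if "k \<ge> N" for k
    proof -
      have b: "norm (indicator (\<Omega> - {p}) z *\<^sub>R (cnj (E k z) / 2 * G z)) \<le> 32 * d / (r k)\<^sup>2 * indicator (cball p (r k)) z" for z
        by (rule bE) (use s N[OF that] d in \<open>auto intro: less_imp_le\<close>)
      have i: "integrable lborel (\<lambda>z. 32 * d / (r k)\<^sup>2 * indicator (cball p (r k)) z)"
        by (intro integrable_mult_right integrable_real_indicator) (auto simp: emeasure_lborel_cball_finite[unfolded infinity_ennreal_def])
      have "norm (\<integral>z. indicator (\<Omega> - {p}) z *\<^sub>R (cnj (E k z) / 2 * G z) \<partial>lborel) 
          \<le> (\<integral>z. 32 * d / (r k)\<^sup>2 * indicator (cball p (r k)) z \<partial>lborel)"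
        by (rule Bochner_Integration.integral_norm_bound_integral[OF Bochner_Integration.integrable_bound[OF i mEG] i])
           (use b order_trans[OF b abs_ge_self] in auto)
      also have "\<dots> = 32 * d / (r k)\<^sup>2 * measure lborel (cball p (r k))" by simp
      also have "measure lborel (cball p (r k)) = pi * (r k)\<^sup>2"
        using content_cball[of "r k" p] r[of k] by (simp add: unit_ball_vol_2)
      also have "32 * d / (r k)\<^sup>2 * (pi * (r k)\<^sup>2) = 32 * d * pi" using r[of k] by simp
      also have "\<dots> < e" using pi_less_4 e by (simp add: d_def)
      finally show ?thesis by simp
    qed
    then show "\<exists>N. \<forall>k\<ge>N. dist (\<integral>z. indicator (\<Omega> - {p}) z *\<^sub>R (cnj (E k z) / 2 * G z) \<partial>lborel) 0 < e" by blast
  qed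
  \<comment> \<open>The bound \<open>bE\<close> with \<open>d = 1\<close> is available once
    \<open>r k < s\<close>, so integrability is established for large \<open>k\<close>, as the limit
    requires.\<close>
  have int2: "\<forall>\<^sub>F k in sequentially. integrable lborel (\<lambda>z. indicator (\<Omega> - {p}) z *\<^sub>R (cnj (E k z) / 2 * G z))"
  proof -
    obtain s where s: "s > 0" "\<And>z. z \<noteq> p \<Longrightarrow> norm (z - p) < s \<Longrightarrow> norm ((z - p) * G z) < 1"
      using lim unfolding LIM_def by (metis diff_zero dist_norm zero_less_one)
    have "\<forall>\<^sub>F k in sequentially. r k < s" using order_tendstoD(2)[OF rlim s(1)] .
    then show ?thesis
    proof eventually_elim
      case (elim k)
      have b: "norm (indicator (\<Omega> - {p}) z *\<^sub>R (cnj (E k z) / 2 * G z)) \<le> 32 * 1 / (r k)\<^sup>2 * indicator (cball p (r k)) z" for z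
        by (rule bE) (use s elim in \<open>auto intro: less_imp_le\<close>)
      have i: "integrable lborel (\<lambda>z. 32 * 1 / (r k)\<^sup>2 * indicator (cball p (r k)) z)"
        by (intro integrable_mult_right integrable_real_indicator) (auto simp: emeasure_lborel_cball_finite[unfolded infinity_ennreal_def])
      show ?case
        by (rule Bochner_Integration.integrable_bound[OF i mEG]) (use order_trans[OF b abs_ge_self] in auto)
    qed
  qed
  have "(\<lambda>k. (\<integral>z. \<eta> k z *\<^sub>R (indicator (\<Omega> - {p}) z *\<^sub>R R z) \<partial>lborel) + 
      (\<integral>z. indicator (\<Omega> - {p}) z *\<^sub>R (cnj (E k z) / 2 * G z) \<partial>lborel)) \<longlonglongrightarrow> (\<integral>z. indicator (\<Omega> - {p}) z *\<^sub>R R z \<partial>lborel) + 0"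
    by (rule tendsto_add[OF lim1 lim2])
  moreover have "\<forall>\<^sub>F k in sequentially. (\<integral>z. \<eta> k z *\<^sub>R (indicator (\<Omega> - {p}) z *\<^sub>R R z) \<partial>lborel) + 
      (\<integral>z. indicator (\<Omega> - {p}) z *\<^sub>R (cnj (E k z) / 2 * G z) \<partial>lborel) = (\<integral>z. indicator \<Omega> z *\<^sub>R R' k z \<partial>lborel)"
    using int2 by eventually_elim (simp only: Rin Bochner_Integration.integral_add[OF int1])
  ultimately have "(\<lambda>k. \<integral>z. indicator \<Omega> z *\<^sub>R R' k z \<partial>lborel) \<longlonglongrightarrow> (\<integral>z. indicator (\<Omega> - {p}) z *\<^sub>R R z \<partial>lborel)"
    using Lim_transform_eventually by fastforce
  from tendsto_mult[OF tendsto_const[of "2 * \<i> * \<sigma>"] this]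
  have "(\<lambda>k. contour_integral \<gamma> G) \<longlonglongrightarrow> 2 * \<i> * \<sigma> * (\<integral>z. indicator (\<Omega> - {p}) z *\<^sub>R R z \<partial>lborel)"
    by (simp only: green[symmetric] cg)
  then show ?thesis by (simp only: LIMSEQ_const_iff)
qed

section \<open>Rotation of the tangent of a Jordan curve\<close>

text \<open>The difference of the two logarithms takes values in a coset of the integer multiples of
  \<open>2 * pi * \<i>\<close>, a discrete set. The factor \<open>k\<close> allows logarithms of
  rotated or rescaled functions to be compared; principal branches on different half-planes are
  joined in this way below.\<close>

lemma continuous_logs_differ_by_constant:
  fixes f g :: "'a::topological_space \<Rightarrow> complex"
  assumes S: "connected S" and cont: "continuous_on S f" "continuous_on S g"
    and k: "k \<noteq> 0" and eq: "\<And>x. x \<in> S \<Longrightarrow> exp (f x) = k * exp (g x)"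
    and xy: "x \<in> S" "y \<in> S"
  shows "f x - f y = g x - g y"
proof -
  have "(\<lambda>x. f x - g x) constant_on S"
  proof (rule continuous_discrete_range_constant[OF S])
    show "continuous_on S (\<lambda>x. f x - g x)" by (intro continuous_intros cont)
    fix x assume x: "x \<in> S"
    have "f y - g y = f x - g x" if y: "y \<in> S" and n: "norm (f y - g y - (f x - g x)) < 2 * pi" for y
    proof (rule exp_complex_eqI)
      show "\<bar>Im (f y - g y) - Im (f x - g x)\<bar> < 2 * pi"
        using abs_Im_le_cmod[of "f y - g y - (f x - g x)"] n by simp
      have "exp (f z - g z) = k" if "z \<in> S" for z using eq[OF that] by (simp add: exp_diff)
      then show "exp (f y - g y) = exp (f x - g x)" using x y by simp
    qed
    then show "\<exists>e>0. \<forall>y. y \<in> S \<and> f y - g y \<noteq> f x - g x \<longrightarrow> e \<le> norm (f y - g y - (f x - g x))"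
      by (intro exI[of _ "2 * pi"]) (auto simp: not_less[symmetric])
  qed
  then have "f x - g x = f y - g y" using xy by (auto simp: constant_on_def)
  then show ?thesis by (simp add: algebra_simps)
qed

lemma Ln_pos_mult_ii: "Re w > 0 \<Longrightarrow> Ln (\<i> * w) - Ln (- \<i> * w) = \<i> * pi"
proof -
  assume w: "Re w > 0"
  then have w0: "w \<noteq> 0" by auto
  have "\<bar>Im (Ln w)\<bar> < pi / 2" using w w0 Re_Ln_pos_lt by blast
  moreover have "exp (\<i> * (of_real pi / 2)) = \<i>"
    using cis_conv_exp[of "pi / 2"] by simp
  ultimately have "Ln (\<i> * w) = Ln w + \<i> * (pi / 2)" "Ln (- \<i> * w) = Ln w - \<i> * (pi / 2)"
    using w0 by (intro Ln_unique; simp add: exp_add exp_diff mult_ac)+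
  then show ?thesis by (simp add: complex_eq_iff)
qed

text \<open>\<open>Ln (- \<i> * w)\<close> is continuous on the upper half-plane and
  \<open>Ln (\<i> * w)\<close> on the lower one; their discrepancy off the imaginary axis is a
  signed half turn. The same half turn measures the rotation of the secants and the winding number
  near the lowest point, hence their common sign.\<close>

lemma Ln_mult_ii_diff: "Re w \<noteq> 0 \<Longrightarrow> Ln (\<i> * w) - Ln (- \<i> * w) = \<i> * pi * of_real (sgn (Re w))"
proof (cases "Re w > 0")
  case True then show ?thesis using Ln_pos_mult_ii[of w] by simp
next
  case False assume "Re w \<noteq> 0"
  then show ?thesis using Ln_pos_mult_ii[of "- w"] False by (simp add: algebra_simps minus_equation_iff)
qed

section \<open>Periodic curves, winding numbers and chords\<close>

locale periodic_C1_curve =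
  fixes \<Gamma> \<Gamma>' :: "real \<Rightarrow> complex"
  assumes der: "\<And>t. (\<Gamma> has_vector_derivative \<Gamma>' t) (at t)"
    and cont': "continuous_on UNIV \<Gamma>'"
    and per: "\<And>t. \<Gamma> (t + 1) = \<Gamma> t" and per': "\<And>t. \<Gamma>' (t + 1) = \<Gamma>' t"
begin

lemma cont: "continuous_on S \<Gamma>"
  using der by (meson continuous_at_imp_continuous_on has_vector_derivative_continuous)

lemma per_int: "\<Gamma> (t + of_int k) = \<Gamma> t"
proof (induction k rule: int_induct[where k=0])
  case (step1 i) then show ?case using per[of "t + of_int i"] by (simp add: add.assoc)
next
  case (step2 i) then show ?case using per[of "t + of_int (i - 1)"] by (simp add: add.assoc)
qed simp

lemma per_frac: "\<Gamma> (frac t) = \<Gamma> t"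
  using per_int[of "t" "- \<lfloor>t\<rfloor>"] by (simp add: frac_def)

lemma range_eq: "range \<Gamma> = path_image \<Gamma>"
proof -
  have "\<Gamma> t \<in> path_image \<Gamma>" for t
    unfolding path_image_def using per_frac[of t] frac_ge_0[of t] frac_lt_1[of t] 
    by (intro image_eqI[of _ _ "frac t"]) auto
  then show ?thesis by (auto simp: path_image_def)
qed

lemma path: "path \<Gamma>" unfolding path_def by (rule cont)

lemma loop: "pathfinish \<Gamma> = pathstart \<Gamma>"
  using per[of 0] by (simp add: pathfinish_def pathstart_def)

text \<open>Shifting a logarithm by one period yields another logarithm of the same function, so its
  increment over a period does not depend on where the period starts. Later it starts at
  \<open>- \<delta>\<close> or at the parameter of the lowest point.\<close>

lemma log_increment:
  assumes z: "z \<notin> range \<Gamma>" and c: "continuous_on {x..x+1} lg"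
    and e: "\<And>t. t \<in> {x..x+1} \<Longrightarrow> exp (lg t) = \<Gamma> t - z"
  shows "lg (x + 1) - lg x = 2 * pi * \<i> * winding_number \<Gamma> z"
proof -
  have "continuous_on UNIV (\<lambda>t. \<Gamma> t - z)" by (intro continuous_intros cont)
  then obtain m where m: "continuous_on UNIV m" "\<And>t. \<Gamma> t - z = exp (m t)"
    using continuous_logarithm_on_contractible[of UNIV "\<lambda>t. \<Gamma> t - z"] z convex_imp_contractible[OF convex_UNIV]
    by (metis UNIV_I eq_iff_diff_eq_0 rangeI)
  obtain q where q: "path q" "pathfinish q - pathstart q = 2 * pi * \<i> * winding_number \<Gamma> z"
    "\<And>t. t \<in> {0..1} \<Longrightarrow> \<Gamma> t = z + exp (q t)"
    using winding_number_as_continuous_log[OF path, of z] z range_eq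
    by (metis of_real_mult of_real_numeral)
  have "q 1 - q 0 = m 1 - m 0"
    by (rule continuous_logs_differ_by_constant[of "{0..1}" q m 1])
       (use q(1,3) m in \<open>auto simp: path_def m(2)[symmetric] intro: continuous_on_subset\<close>)
  also have "m 1 - m 0 = m (x + 1) - m x"
  proof -
    have "(m \<circ> (\<lambda>t. t + 1)) x - (m \<circ> (\<lambda>t. t + 1)) 0 = m x - m 0"
    proof (rule continuous_logs_differ_by_constant[of UNIV _ m 1])
      show "continuous_on UNIV (m \<circ> (\<lambda>t. t + 1))"
        by (intro continuous_on_compose continuous_intros continuous_on_subset[OF m(1)]) auto
    qed (use m per in \<open>auto simp: m(2)[symmetric]\<close>)
    then show ?thesis by (simp add: algebra_simps)
  qed
  also have "\<dots> = lg (x + 1) - lg x"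
    by (rule continuous_logs_differ_by_constant[of "{x..x+1}" m lg 1])
       (use m e c in \<open>auto simp: m(2)[symmetric] intro: continuous_on_subset\<close>)
  finally show ?thesis using q(2) by (simp add: pathfinish_def pathstart_def)
qed

text \<open>Hadamard's form of the difference quotient of \<open>\<Gamma>\<close>. As a parameter
  integral of \<open>\<Gamma>'\<close> it is continuous across the diagonal without a case
  distinction.\<close>

definition chord :: "real \<Rightarrow> real \<Rightarrow> complex" where
  "chord s t = integral {0..1} (\<lambda>\<tau>. \<Gamma>' (s + \<tau> * (t - s)))"

lemma chord_same: "chord t t = \<Gamma>' t"
  by (simp add: chord_def)

lemma chord_mult: "(t - s) *\<^sub>R chord s t = \<Gamma> t - \<Gamma> s"
proof -
  have "((\<lambda>\<tau>. (t - s) *\<^sub>R \<Gamma>' (s + \<tau> * (t - s))) has_integral \<Gamma> (s + 1 * (t - s)) - \<Gamma> (s + 0 * (t - s))) {0..1}"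
  proof (rule fundamental_theorem_of_calculus)
    fix x :: real
    have "((\<Gamma> \<circ> (\<lambda>\<tau>. s + \<tau> * (t - s))) has_vector_derivative (t - s) *\<^sub>R \<Gamma>' (s + x * (t - s))) (at x within {0..1})"
      by (rule vector_diff_chain_within[where f'="t - s"])
         (auto intro!: derivative_eq_intros has_vector_derivative_at_within[OF der])
    then show "((\<lambda>\<tau>. \<Gamma> (s + \<tau> * (t - s))) has_vector_derivative (t - s) *\<^sub>R \<Gamma>' (s + x * (t - s))) (at x within {0..1})"
      by (simp add: o_def)
  qed simp
  from integral_unique[OF this] show ?thesis by (simp add: chord_def)
qed

lemma continuous_chord: "continuous_on UNIV (\<lambda>p. chord (fst p) (snd p))"
  unfolding chord_def cbox_interval[symmetric]
  by (rule integral_continuous_on_param)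
     (auto simp: case_prod_beta intro!: continuous_intros continuous_on_compose2[OF cont'])

end

section \<open>Hopf's secant map\<close>

locale periodic_C1_jordan_curve = periodic_C1_curve +
  assumes nz: "\<And>t. \<Gamma>' t \<noteq> 0" and inj: "\<And>s t. \<Gamma> s = \<Gamma> t \<Longrightarrow> t - s \<in> \<int>"
begin

text \<open>
  The chord divided by \<open>(t - s) (1 - (t - s))\<close>, extended continuously by \<open>\<Gamma>'\<close> to the diagonal and by
  \<open>- \<Gamma>'\<close> to \<open>t = s + 1\<close>. The case distinction only avoids the removable singularities.
\<close>

definition secant :: "real \<Rightarrow> real \<Rightarrow> complex" where
  "secant s t = (if t - s \<le> 1 / 2 then chord s t /\<^sub>R (1 - (t - s)) else - (chord (s + 1) t /\<^sub>R (t - s)))"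

lemma secant_mult: 
  assumes "0 \<le> t - s" "t - s \<le> 1"
  shows "((t - s) * (1 - (t - s))) *\<^sub>R secant s t = \<Gamma> t - \<Gamma> s"
proof (cases "t - s \<le> 1 / 2")
  case True
  then have "((t - s) * (1 - (t - s))) *\<^sub>R secant s t = (t - s) *\<^sub>R chord s t"
    using assms by (simp add: secant_def)
  then show ?thesis by (simp add: chord_mult)
next
  case False
  define d where "d = t - s"
  have "((t - s) * (1 - (t - s))) *\<^sub>R secant s t = (- (d * (1 - d) * inverse d)) *\<^sub>R chord (s + 1) t"
    using False by (simp add: secant_def d_def)
  also have "- (d * (1 - d) * inverse d) = t - (s + 1)" using False by (simp add: d_def field_simps)
  finally have "((t - s) * (1 - (t - s))) *\<^sub>R secant s t = (t - (s + 1)) *\<^sub>R chord (s + 1) t" .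
  then show ?thesis by (simp add: chord_mult per)
qed

lemma secant_eq:
  assumes "0 < t - s" "t - s < 1"
  shows "secant s t = (\<Gamma> t - \<Gamma> s) /\<^sub>R ((t - s) * (1 - (t - s)))"
proof -
  have "(t - s) * (1 - (t - s)) \<noteq> 0" using assms by simp
  then show ?thesis using secant_mult[of t s] assms
    by (metis less_imp_le scaleR_left_imp_eq scaleR_scaleR right_inverse scaleR_one)
qed

lemma secant_same: "secant t t = \<Gamma>' t"
  by (simp add: secant_def chord_same)

lemma secant_period: "secant s (s + 1) = - \<Gamma>' s"
  by (simp add: secant_def chord_same per')

definition triangle :: "(real \<times> real) set" where
  "triangle = {p. 0 \<le> fst p \<and> fst p \<le> snd p \<and> snd p \<le> 1}"

text \<open>Convexity gives contractibility, which provides a continuous logarithm of the secant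
  map.\<close>

lemma convex_triangle: "convex triangle"
proof -
  have eq: "triangle = {p. 0 \<le> fst p} \<inter> {p. fst p - snd p \<le> 0} \<inter> {p. snd p \<le> 1}"
    by (auto simp: triangle_def)
  have c1: "convex {p::real \<times> real. 0 \<le> fst p}"
    by (auto simp: convex_def intro!: add_nonneg_nonneg)
  have c2: "convex {p::real \<times> real. fst p - snd p \<le> 0}"
    unfolding convex_def
  proof clarsimp
    fix a b a' b' u v :: real assume "a \<le> b" "a' \<le> b'" "0 \<le> u" "0 \<le> v"
    then show "u * a + v * a' \<le> u * b + v * b'" by (intro add_mono mult_left_mono)
  qed
  have c3: "convex {p::real \<times> real. snd p \<le> 1}"
    unfolding convex_def by (auto intro!: convex_bound_le)
  show ?thesis unfolding eq by (intro convex_Int c1 c2 c3)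
qed

lemma secant_continuous: "continuous_on triangle (\<lambda>p. secant (fst p) (snd p))"
proof -
  have c2: "continuous_on UNIV (\<lambda>p. chord (fst p + 1) (snd p))"
    using continuous_on_compose2[OF continuous_chord, of UNIV "\<lambda>p. (fst p + 1, snd p)"]
    by (simp add: continuous_intros)
  let ?A = "triangle \<inter> {p. snd p - fst p \<le> 1 / 2}" and ?B = "triangle \<inter> {p. snd p - fst p \<ge> 1 / 2}"
  have cl: "closed triangle"
    unfolding triangle_def by (intro closed_Collect_conj closed_Collect_le continuous_intros)
  have "continuous_on (?A \<union> ?B) (\<lambda>p. if snd p - fst p \<le> 1 / 2 then chord (fst p) (snd p) /\<^sub>R (1 - (snd p - fst p)) 
     else - (chord (fst p + 1) (snd p) /\<^sub>R (snd p - fst p)))"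
  proof (rule continuous_on_cases)
    show "closed ?A" "closed ?B"
      by (intro closed_Int cl closed_Collect_le continuous_intros)+
    show "continuous_on ?A (\<lambda>p. chord (fst p) (snd p) /\<^sub>R (1 - (snd p - fst p)))"
      by (intro continuous_intros continuous_on_subset[OF continuous_chord]) auto
    show "continuous_on ?B (\<lambda>p. - (chord (fst p + 1) (snd p) /\<^sub>R (snd p - fst p)))"
      by (intro continuous_intros continuous_on_subset[OF c2]) auto
    show "\<forall>p. p \<in> ?A \<and> \<not> snd p - fst p \<le> 1 / 2 \<or> p \<in> ?B \<and> snd p - fst p \<le> 1 / 2 \<longrightarrow>
      chord (fst p) (snd p) /\<^sub>R (1 - (snd p - fst p)) = - (chord (fst p + 1) (snd p) /\<^sub>R (snd p - fst p))"
    proof (intro allI impI)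
      fix p assume p: "p \<in> ?A \<and> \<not> snd p - fst p \<le> 1 / 2 \<or> p \<in> ?B \<and> snd p - fst p \<le> 1 / 2"
      define s t where "s = fst p" and "t = snd p"
      have "1 \<le> (t - s) * 2" "(t - s) * 2 \<le> 1" using p by (auto simp: s_def t_def)
      then have ts: "t - s = 1 / 2" and ts': "t - (s + 1) = - (1 / 2)" by simp_all
      \<comment> \<open>On the seam the two chords, multiplied by \<open>1 / 2\<close> and
        \<open>- (1 / 2)\<close>, give the same increment \<open>\<Gamma> t - \<Gamma> s\<close>,
        because \<open>\<Gamma> (s + 1) = \<Gamma> s\<close>.\<close>
      have "(1 / 2) *\<^sub>R chord s t = (1 / 2) *\<^sub>R (- chord (s + 1) t)"
        using chord_mult[of t s, unfolded ts] chord_mult[of t "s + 1", unfolded ts'] per[of s] by simp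
      then have "chord s t = - chord (s + 1) t" unfolding scaleR_cancel_left by simp
      then show "chord (fst p) (snd p) /\<^sub>R (1 - (snd p - fst p)) = - (chord (fst p + 1) (snd p) /\<^sub>R (snd p - fst p))"
        unfolding s_def[symmetric] t_def[symmetric] ts by simp
    qed
  qed
  moreover have "?A \<union> ?B = triangle" by auto
  ultimately show ?thesis unfolding secant_def by simp
qed

text \<open>Off the diagonal and the corner \<open>(0, 1)\<close> this is injectivity modulo the
  period; there it is regularity of the curve.\<close>

lemma secant_nonzero:
  assumes "p \<in> triangle" shows "secant (fst p) (snd p) \<noteq> 0"
proof -
  obtain s t where p: "p = (s, t)" by force
  have st: "0 \<le> s" "s \<le> t" "t \<le> 1" using assms by (auto simp: triangle_def p)
  consider "s = t" | "0 < t - s" "t - s < 1" | "t = s + 1" using st by linarith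
  then show ?thesis
  proof cases
    case 2
    have "\<Gamma> t \<noteq> \<Gamma> s"
    proof
      assume "\<Gamma> t = \<Gamma> s"
      then have "t - s \<in> \<int>" using inj[of s t] by simp
      then obtain k where "t - s = of_int k" by (auto elim: Ints_cases)
      then show False using 2 by simp
    qed
    then show ?thesis using 2 by (simp add: p secant_eq)
  qed (auto simp: p secant_same secant_period nz)
qed

text \<open>
  Hopf's homotopy: a logarithm of the secant map on the triangle compares the rotation of the tangent
  (the diagonal) with that of the secants through the lowest point (the two legs), which stay in a
  half-plane.
\<close>

lemma log_derivative_increment_at_lowest:
  assumes low: "\<And>t. Im (\<Gamma> t) \<ge> Im (\<Gamma> 0)"
  obtains lg where "continuous_on {0..1} lg" "\<And>t. t \<in> {0..1} \<Longrightarrow> exp (lg t) = \<Gamma>' t"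
    "Im (\<Gamma>' 0) = 0" "lg 1 - lg 0 = 2 * pi * \<i> * of_real (sgn (Re (\<Gamma>' 0)))"
proof -
  have "((\<lambda>t. Im (\<Gamma> t)) has_real_derivative Im (\<Gamma>' 0)) (at 0)"
    using bounded_linear.has_vector_derivative[OF bounded_linear_Im der]
    by (simp add: has_real_derivative_iff_has_vector_derivative)
  then have im: "Im (\<Gamma>' 0) = 0"
    by (rule DERIV_local_min[of _ _ _ 1]) (use low in auto)
  then have re: "Re (\<Gamma>' 0) \<noteq> 0" using nz[of 0] by (auto simp: complex_eq_iff)
  obtain m where m: "continuous_on triangle m" "\<And>p. p \<in> triangle \<Longrightarrow> secant (fst p) (snd p) = exp (m p)"
    using continuous_logarithm_on_contractible[OF secant_continuous convex_imp_contractible[OF convex_triangle] secant_nonzero]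
    by blast
  have c: "continuous_on {0..1} (\<lambda>t. m (h t))" 
    if "continuous_on {0..1} h" "\<And>t. t \<in> {0..1} \<Longrightarrow> h t \<in> triangle" for h :: "real \<Rightarrow> real \<times> real"
    using continuous_on_compose2[OF m(1) that(1)] that(2) by blast
  have c1: "continuous_on {0..1} (\<lambda>t. m (0, t))" and c2: "continuous_on {0..1} (\<lambda>t. m (t, 1))" and c3: "continuous_on {0..1} (\<lambda>t. m (t, t))"
    by (intro c continuous_intros; simp add: triangle_def)+
  have e: "exp (m (s, t)) = secant s t" if "0 \<le> s" "s \<le> t" "t \<le> 1" for s t
    using m(2)[of "(s, t)"] that by (simp add: triangle_def)
  have sec1: "secant 0 1 = - \<Gamma>' 0" "\<Gamma>' 1 = \<Gamma>' 0" using secant_period[of 0] per'[of 0] by auto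
  have up: "Im (secant 0 t) \<ge> 0" if t: "t \<in> {0..1}" for t
  proof -
    consider "t = 0" | "t = 1" | "0 < t" "t < 1" using t unfolding atLeastAtMost_iff by linarith
    then show ?thesis
    proof cases
      case 3
      then show ?thesis using low[of t] by (simp add: secant_eq mult_nonneg_nonneg)
    qed (use im sec1 in \<open>auto simp: secant_same\<close>)
  qed
  have nzs: "secant 0 t \<noteq> 0" if "t \<in> {0..1}" for t
    using secant_nonzero[of "(0, t)"] that by (simp add: triangle_def)
  \<comment> \<open>On this leg the secants lie in the closed upper half-plane without 0, which
    multiplication by \<open>- \<i>\<close> moves off the branch cut.\<close>
  have 1: "m (0, 1) - m (0, 0) = Ln (- \<i> * secant 0 1) - Ln (- \<i> * secant 0 0)"
  proof (rule continuous_logs_differ_by_constant[of "{0..1}" "\<lambda>t. m (0, t)" "\<lambda>t. Ln (- \<i> * secant 0 t)" \<i> 1 0])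
    show "continuous_on {0..1} (\<lambda>t. Ln (- \<i> * secant 0 t))"
    proof (intro continuous_intros)
      show "continuous_on {0..1} (secant 0)"
        using continuous_on_compose2[OF secant_continuous, of "{0..1}" "\<lambda>t. (0, t)"]
        by (simp add: continuous_intros triangle_def image_subset_iff)
      show "- \<i> * secant 0 t \<notin> \<real>\<^sub>\<le>\<^sub>0" if "t \<in> {0..1}" for t
        using up[OF that] nzs[OF that] by (auto simp: complex_nonpos_Reals_iff complex_eq_iff)
    qed
  qed (use c1 e nzs in auto)
  \<comment> \<open>Since \<open>\<Gamma> 1 = \<Gamma> 0\<close>, the secant from \<open>t\<close>
    to 1 is the negative of the one from 0 to \<open>t\<close>. The second leg repeats the rotation
    of the first, so two half turns make the full one.\<close>
  have 2: "m (1, 1) - m (0, 1) = m (0, 1) - m (0, 0)"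
  proof (rule continuous_logs_differ_by_constant[of "{0..1}" "\<lambda>t. m (t, 1)" "\<lambda>t. m (0, t)" "-1" 1 0])
    show "exp (m (t, 1)) = -1 * exp (m (0, t))" if t: "t \<in> {0..1}" for t
    proof -
      consider "t = 0" | "t = 1" | "0 < t" "t < 1" using t unfolding atLeastAtMost_iff by linarith
      then have "secant t 1 = - secant 0 t"
      proof cases
        case 3
        have "\<Gamma> 1 = \<Gamma> 0" using per[of 0] by simp
        with 3 show ?thesis by (simp add: secant_eq mult.commute flip: scaleR_minus_right)
      qed (use sec1 in \<open>auto simp: secant_same\<close>)
      then show ?thesis using e[of 0 t] e[of t 1] that by simp
    qed
  qed (use c1 c2 in auto)
  have "Ln (- \<i> * secant 0 1) - Ln (- \<i> * secant 0 0) = \<i> * pi * of_real (sgn (Re (\<Gamma>' 0)))"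
    using Ln_mult_ii_diff[OF re] by (simp add: sec1 secant_same)
  with 1 2 have "m (1, 1) - m (0, 0) = 2 * pi * \<i> * of_real (sgn (Re (\<Gamma>' 0)))"
    by (simp add: algebra_simps)
  then show ?thesis
    by (intro that[OF c3 _ im]) (use e in \<open>auto simp: secant_same\<close>)
qed

text \<open>For \<open>c = \<Gamma> 0 + \<i> * e\<close> a logarithm of
  \<open>\<Gamma> t - c\<close> is pieced together from \<open>Ln (\<i> * (u t - \<i> * e))\<close>
  on a short arc around the lowest point, and \<open>Ln (- \<i> * u t)\<close> with the correction
  \<open>Ln (1 - \<i> * e / u t)\<close> on the rest. As \<open>e\<close> tends to 0 the total tends
  to two half turns of the same sign. The winding number is an integer, so it equals
  \<open>sgn a\<close> for small \<open>e\<close>; being nonzero, it places \<open>c\<close>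
  inside.\<close>

lemma winding_number_above_lowest:
  assumes low: "\<And>t. Im (\<Gamma> t) \<ge> Im (\<Gamma> 0)" and im: "Im (\<Gamma>' 0) = 0"
  obtains z where "z \<in> inside (path_image \<Gamma>)" "winding_number \<Gamma> z = of_real (sgn (Re (\<Gamma>' 0)))"
proof -
  define u where "u t = \<Gamma> t - \<Gamma> 0" for t
  define a where "a = Re (\<Gamma>' 0)"
  have a: "a \<noteq> 0" using nz[of 0] im by (auto simp: complex_eq_iff a_def)
  have "((\<lambda>t. Re (\<Gamma> t)) has_real_derivative a) (at 0)"
    using bounded_linear.has_vector_derivative[OF bounded_linear_Re der]
    by (simp add: has_real_derivative_iff_has_vector_derivative a_def)
  then have "((\<lambda>t. Re (u t) / t) \<longlongrightarrow> a) (at 0)"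
    by (simp add: DERIV_def u_def)
  then have "((\<lambda>t. a * (Re (u t) / t)) \<longlongrightarrow> a * a) (at 0)"
    by (intro tendsto_intros)
  moreover have "a * a > 0" using a by (simp add: zero_less_mult_iff linorder_neq_iff disj_commute)
  ultimately have "\<forall>\<^sub>F t in at 0. a * (Re (u t) / t) > 0" by (rule order_tendstoD)
  then obtain d where d: "d > 0" "\<And>t. t \<noteq> 0 \<Longrightarrow> \<bar>t\<bar> < d \<Longrightarrow> a * (Re (u t) / t) > 0"
    unfolding eventually_at by (auto simp: dist_real_def)
  \<comment> \<open>Small enough for \<open>Re (u t)\<close> to have the sign of
    \<open>a * t\<close>, and below \<open>1 / 2\<close> so that
    \<open>{- \<delta>..\<delta>}\<close> and \<open>{\<delta>..1 - \<delta>}\<close> make up one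
    period.\<close>
  define \<delta> where "\<delta> = min (d / 2) (1 / 4)"
  have \<delta>: "0 < \<delta>" "\<delta> < d" "\<delta> < 1 / 2" using d by (auto simp: \<delta>_def)
  have ure: "a * (Re (u t) / t) > 0" if "t \<noteq> 0" "\<bar>t\<bar> \<le> \<delta>" for t using d(2)[of t] \<delta> that by simp
  have u0: "u 0 = 0" by (simp add: u_def)
  have cu: "continuous_on S u" for S unfolding u_def by (intro continuous_intros cont)
  have uper: "u (1 - \<delta>) = u (- \<delta>)" using per[of "- \<delta>"] by (simp add: u_def)
  have unz: "u t \<noteq> 0" if "\<delta> \<le> t" "t \<le> 1 - \<delta>" for t
  proof
    assume "u t = 0"
    then have "t - 0 \<in> \<int>" using inj[of 0 t] by (simp add: u_def)
    then obtain k where k: "t = of_int k" by (auto elim: Ints_cases)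
    then have "0 < real_of_int k" "real_of_int k < 1" using that \<delta> by linarith+
    then show False by simp
  qed
  obtain m where m: "m > 0" "\<And>t. t \<in> {\<delta>..1-\<delta>} \<Longrightarrow> m \<le> norm (u t)"
  proof -
    have "\<exists>x\<in>{\<delta>..1-\<delta>}. \<forall>y\<in>{\<delta>..1-\<delta>}. norm (u x) \<le> norm (u y)"
      using \<delta> by (intro continuous_attains_inf continuous_intros cu) auto
    then obtain x where "x \<in> {\<delta>..1-\<delta>}" "\<forall>y\<in>{\<delta>..1-\<delta>}. norm (u x) \<le> norm (u y)" by blast
    then show ?thesis using unz[of x] by (intro that[of "norm (u x)"]) auto
  qed
  \<comment> \<open>The mismatch of the logarithms of the two arcs at a junction \<open>w\<close>.
    Periodicity identifies \<open>u (1 - \<delta>)\<close> with \<open>u (- \<delta>)\<close>, so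
    the total increment is a difference of two values of \<open>\<Phi>\<close>.\<close>
  define \<Phi> where "\<Phi> w e = Ln (\<i> * (w - \<i> * of_real e)) - Ln (- \<i> * w) - Ln (1 - \<i> * of_real e / w)" for w and e :: real
  have wn: "c \<notin> range \<Gamma> \<and> 2 * pi * \<i> * winding_number \<Gamma> c = \<Phi> (u \<delta>) e - \<Phi> (u (- \<delta>)) e"
    if e: "0 < e" "e < m" and c_def: "c = \<Gamma> 0 + \<i> * of_real e" for e c
  proof -
    have inner: "\<i> * (u t - \<i> * of_real e) \<notin> \<real>\<^sub>\<le>\<^sub>0" if "\<bar>t\<bar> \<le> \<delta>" for t
    proof (cases "t = 0")
      case False
      then have "Re (u t) \<noteq> 0" using ure[of t] that by auto
      then show ?thesis by (auto simp: complex_nonpos_Reals_iff)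
    qed (use e in \<open>auto simp: u0 complex_nonpos_Reals_iff\<close>)
    have small: "norm (\<i> * of_real e / u t) < 1" if "t \<in> {\<delta>..1-\<delta>}" for t
    proof -
      have "norm (u t) > e" using m(2)[OF that] e by simp
      then show ?thesis using e by (simp add: norm_divide norm_mult divide_simps)
    qed
    have outer1: "- \<i> * u t \<notin> \<real>\<^sub>\<le>\<^sub>0" if "t \<in> {\<delta>..1-\<delta>}" for t
      using low[of t] unz[of t] that by (auto simp: complex_nonpos_Reals_iff u_def complex_eq_iff)
    have outer2: "1 - \<i> * of_real e / u t \<notin> \<real>\<^sub>\<le>\<^sub>0" if "t \<in> {\<delta>..1-\<delta>}" for t
    proof -
      have "Re (\<i> * of_real e / u t) < 1" using small[OF that] complex_Re_le_cmod le_less_trans by blast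
      then show ?thesis by (auto simp: complex_nonpos_Reals_iff simp del: Re_divide)
    qed
    have nz2: "u t - \<i> * of_real e \<noteq> 0" if "- \<delta> \<le> t" "t \<le> 1 - \<delta>" for t
    proof (cases "\<bar>t\<bar> \<le> \<delta>")
      case True
      then show ?thesis using inner[OF True] by auto
    next
      case False
      then have "t \<in> {\<delta>..1-\<delta>}" using that by auto
      from outer2[OF this] unz[of t] this show ?thesis by auto
    qed
    have cr: "c \<notin> range \<Gamma>"
    proof
      assume "c \<in> range \<Gamma>"
      then obtain t where t: "\<Gamma> t = c" by auto
      \<comment> \<open>The representative of \<open>t\<close> in the period that starts at
        \<open>- \<delta>\<close>, which the two arcs cover.\<close>
      define t' where "t' = frac (t + \<delta>) - \<delta>"
      have "t' = t + of_int (- \<lfloor>t + \<delta>\<rfloor>)" by (simp add: t'_def frac_def)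
      then have "\<Gamma> t' = c" using t per_int by metis
      moreover have "- \<delta> \<le> t'" "t' \<le> 1 - \<delta>" 
        using frac_ge_0[of "t + \<delta>"] frac_lt_1[of "t + \<delta>"] by (auto simp: t'_def)
      ultimately show False using nz2[of t'] by (simp add: u_def c_def)
    qed
    have "continuous_on UNIV (\<lambda>t. \<Gamma> t - c)" by (intro continuous_intros cont)
    then obtain lg where lg: "continuous_on UNIV lg" "\<And>t. \<Gamma> t - c = exp (lg t)"
      using continuous_logarithm_on_contractible[of UNIV "\<lambda>t. \<Gamma> t - c"] cr convex_imp_contractible[OF convex_UNIV]
      by (metis UNIV_I eq_iff_diff_eq_0 rangeI)
    have uc: "\<Gamma> t - c = u t - \<i> * of_real e" for t by (simp add: c_def u_def)
    have 1: "lg \<delta> - lg (- \<delta>) = Ln (\<i> * (u \<delta> - \<i> * of_real e)) - Ln (\<i> * (u (- \<delta>) - \<i> * of_real e))"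
    proof (rule continuous_logs_differ_by_constant[of "{-\<delta>..\<delta>}" lg "\<lambda>t. Ln (\<i> * (u t - \<i> * of_real e))" "- \<i>"])
      show "continuous_on {-\<delta>..\<delta>} (\<lambda>t. Ln (\<i> * (u t - \<i> * of_real e)))"
        using inner by (intro continuous_intros cu) auto
      show "exp (lg t) = - \<i> * exp (Ln (\<i> * (u t - \<i> * of_real e)))" if "t \<in> {-\<delta>..\<delta>}" for t
        using inner[of t] that lg(2)[of t, symmetric] by (subst exp_Ln) (auto simp: uc)
    qed (use lg \<delta> in \<open>auto intro: continuous_on_subset\<close>)
    have 2: "lg (1 - \<delta>) - lg \<delta> = (Ln (- \<i> * u (1 - \<delta>)) + Ln (1 - \<i> * of_real e / u (1 - \<delta>)))
       - (Ln (- \<i> * u \<delta>) + Ln (1 - \<i> * of_real e / u \<delta>))"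
    proof (rule continuous_logs_differ_by_constant[of "{\<delta>..1-\<delta>}" lg "\<lambda>t. Ln (- \<i> * u t) + Ln (1 - \<i> * of_real e / u t)" "\<i>"])
      show "continuous_on {\<delta>..1-\<delta>} (\<lambda>t. Ln (- \<i> * u t) + Ln (1 - \<i> * of_real e / u t))"
        using outer1 outer2 unz by (intro continuous_intros cu) auto
      show "exp (lg t) = \<i> * exp (Ln (- \<i> * u t) + Ln (1 - \<i> * of_real e / u t))" if t: "t \<in> {\<delta>..1-\<delta>}" for t
      proof -
        have E: "exp (Ln (- \<i> * u t) + Ln (1 - \<i> * of_real e / u t)) = (- \<i> * u t) * (1 - \<i> * of_real e / u t)"
          using unz[of t] t outer2[OF t] unfolding exp_add by (subst (1 2) exp_Ln) auto
        show ?thesis unfolding E lg(2)[symmetric] uc using unz[of t] t by (simp add: field_simps)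
      qed
    qed (use lg \<delta> in \<open>auto intro: continuous_on_subset\<close>)
    have "lg (- \<delta> + 1) - lg (- \<delta>) = 2 * pi * \<i> * winding_number \<Gamma> c"
      by (rule log_increment[OF cr]) (use lg in \<open>auto intro: continuous_on_subset\<close>)
    moreover have "lg (- \<delta> + 1) - lg (- \<delta>) = (lg (1 - \<delta>) - lg \<delta>) + (lg \<delta> - lg (- \<delta>))" by simp
    ultimately have "2 * pi * \<i> * winding_number \<Gamma> c = (lg (1 - \<delta>) - lg \<delta>) + (lg \<delta> - lg (- \<delta>))" by simp
    then show ?thesis using cr unfolding 1 2 by (simp add: \<Phi>_def uper)
  qed
  have lim: "((\<Phi> w) \<longlongrightarrow> \<i> * pi * of_real (sgn (Re w))) (at_right 0)" if w: "Re w \<noteq> 0" for w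
  proof -
    have "((\<Phi> w) \<longlongrightarrow> Ln (\<i> * (w - \<i> * of_real 0)) - Ln (- \<i> * w) - Ln (1 - \<i> * of_real 0 / w)) (at_right 0)"
      unfolding \<Phi>_def using w by (intro tendsto_intros) (auto simp: complex_nonpos_Reals_iff)
    then show ?thesis using Ln_mult_ii_diff[OF w] by simp
  qed
  have r1: "a * Re (u \<delta>) > 0" using ure[of \<delta>] \<delta> by (simp add: zero_less_divide_iff)
  have r2: "a * Re (u (- \<delta>)) < 0" using ure[of "- \<delta>"] \<delta> 
    by (simp add: zero_less_divide_iff divide_less_0_iff)
  have s1: "sgn (Re (u \<delta>)) = sgn a" and s2: "sgn (Re (u (- \<delta>))) = - sgn a"
    using r1 r2 by (auto simp: zero_less_mult_iff mult_less_0_iff)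
  have "((\<lambda>e. (\<Phi> (u \<delta>) e - \<Phi> (u (- \<delta>)) e) / (2 * pi * \<i>)) \<longlongrightarrow> (\<i> * pi * of_real (sgn a) - \<i> * pi * of_real (- sgn a)) / (2 * pi * \<i>)) (at_right 0)"
  proof -
    have "Re (u \<delta>) \<noteq> 0" "Re (u (- \<delta>)) \<noteq> 0" using r1 r2 by auto
    from lim[OF this(1)] lim[OF this(2)] show ?thesis
      unfolding s1 s2 by (intro tendsto_intros) auto
  qed
  then have L: "((\<lambda>e. (\<Phi> (u \<delta>) e - \<Phi> (u (- \<delta>)) e) / (2 * pi * \<i>)) \<longlongrightarrow> of_real (sgn a)) (at_right 0)"
    by (simp add: field_simps)
  have "\<forall>\<^sub>F e in at_right 0. dist ((\<Phi> (u \<delta>) e - \<Phi> (u (- \<delta>)) e) / (2 * pi * \<i>)) (of_real (sgn a)) < 1"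
    using tendstoD[OF L, of 1] by simp
  moreover have "\<forall>\<^sub>F e in at_right 0. e \<in> {0<..<m}" 
    by (rule eventually_at_right_real[OF m(1)])
  ultimately have "\<forall>\<^sub>F e in at_right 0. dist ((\<Phi> (u \<delta>) e - \<Phi> (u (- \<delta>)) e) / (2 * pi * \<i>)) (of_real (sgn a)) < 1 \<and> e \<in> {0<..<m}"
    by (rule eventually_conj)
  then obtain e where e: "dist ((\<Phi> (u \<delta>) e - \<Phi> (u (- \<delta>)) e) / (2 * pi * \<i>)) (of_real (sgn a)) < 1" "0 < e" "e < m"
    using eventually_happens[of _ "at_right (0::real)"] trivial_limit_at_right_real by fastforce
  define c where "c = \<Gamma> 0 + \<i> * of_real e"
  have c: "c \<notin> path_image \<Gamma>" "2 * pi * \<i> * winding_number \<Gamma> c = \<Phi> (u \<delta>) e - \<Phi> (u (- \<delta>)) e"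
    using wn[OF e(2,3) c_def] range_eq by auto
  have "winding_number \<Gamma> c \<in> \<int>" using integer_winding_number[OF path loop c(1)] .
  then obtain k where k: "winding_number \<Gamma> c = of_int k" by (auto elim: Ints_cases)
  obtain j :: int where j: "sgn a = of_int j" using a by (cases "a > 0") (auto intro: that[of 1] that[of "-1"])
  have "(\<Phi> (u \<delta>) e - \<Phi> (u (- \<delta>)) e) / (2 * pi * \<i>) = of_int k"
    using c(2) k by (simp add: field_simps)
  with e(1) j have "norm (of_int k - of_int j :: complex) < 1" by (simp add: dist_norm)
  then have "norm (of_int (k - j) :: complex) < 1" by simp
  then have "k = j" unfolding norm_of_int by linarith
  then have w: "winding_number \<Gamma> c = of_real (sgn a)" using k j by simp
  moreover have "c \<in> inside (path_image \<Gamma>)"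
  proof (rule ccontr)
    assume "c \<notin> inside (path_image \<Gamma>)"
    then have "c \<in> outside (path_image \<Gamma>)" using c(1) inside_Un_outside[of "path_image \<Gamma>"] by blast
    then have "winding_number \<Gamma> c = 0" using winding_number_zero_in_outside[OF path loop] by blast
    then show False using w a by (simp add: sgn_zero_iff)
  qed
  ultimately show ?thesis using that a_def by blast
qed

text \<open>The hypothesis \<open>wn\<close> is applied at a single point, the one found above the
  lowest point; the shift of the parameter by \<open>t0\<close> changes neither the winding number
  there nor the increment of a logarithm of \<open>\<Gamma>'\<close> over a period.\<close>

theorem umlaufsatz:
  assumes wn: "\<And>z. z \<in> inside (path_image \<Gamma>) \<Longrightarrow> winding_number \<Gamma> z = \<sigma>"
    and lg: "continuous_on UNIV lg" "\<And>t. exp (lg t) = \<Gamma>' t"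
  shows "lg (x + 1) - lg x = 2 * pi * \<i> * \<sigma>"
proof -
  have "\<exists>t0\<in>{0..1}. \<forall>t\<in>{0..1}. Im (\<Gamma> t0) \<le> Im (\<Gamma> t)"
    by (intro continuous_attains_inf continuous_intros cont) auto
  then obtain t0 where t0: "\<forall>t\<in>{0..1}. Im (\<Gamma> t0) \<le> Im (\<Gamma> t)" by blast
  have low: "Im (\<Gamma> t0) \<le> Im (\<Gamma> t)" for t
    using t0[rule_format, of "frac t"] frac_ge_0[of t] frac_lt_1[of t] by (simp add: per_frac)
  interpret S: periodic_C1_jordan_curve "\<lambda>t. \<Gamma> (t + t0)" "\<lambda>t. \<Gamma>' (t + t0)"
  proof
    fix t
    have "((\<Gamma> \<circ> (\<lambda>t. t + t0)) has_vector_derivative 1 *\<^sub>R \<Gamma>' (t + t0)) (at t)"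
      by (rule vector_diff_chain_at[where f'=1]) (auto intro!: derivative_eq_intros der)
    then show "((\<lambda>t. \<Gamma> (t + t0)) has_vector_derivative \<Gamma>' (t + t0)) (at t)" by (simp add: o_def)
    show "\<Gamma> (t + 1 + t0) = \<Gamma> (t + t0)" "\<Gamma>' (t + 1 + t0) = \<Gamma>' (t + t0)"
      using per[of "t + t0"] per'[of "t + t0"] by (simp_all add: algebra_simps)
    show "continuous_on UNIV (\<lambda>t. \<Gamma>' (t + t0))"
      by (intro continuous_on_compose2[OF cont'] continuous_intros) auto
    show "\<Gamma>' (t + t0) \<noteq> 0" by (rule nz)
  next
    fix s t assume "\<Gamma> (s + t0) = \<Gamma> (t + t0)"
    then show "t - s \<in> \<int>" using inj by fastforce
  qed
  have pim: "path_image (\<lambda>t. \<Gamma> (t + t0)) = path_image \<Gamma>"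
  proof -
    have "range (\<lambda>t. \<Gamma> (t + t0)) = range \<Gamma>"
      by (auto intro: image_eqI[of _ _ "_ - t0"])
    then show ?thesis using range_eq S.range_eq by simp
  qed
  have low': "\<And>t. Im (\<Gamma> (t + t0)) \<ge> Im (\<Gamma> (0 + t0))" using low by simp
  obtain m where m: "continuous_on {0..1} m" "\<And>t. t \<in> {0..1} \<Longrightarrow> exp (m t) = \<Gamma>' (t + t0)"
    "Im (\<Gamma>' (0 + t0)) = 0" "m 1 - m 0 = 2 * pi * \<i> * of_real (sgn (Re (\<Gamma>' (0 + t0))))"
    using S.log_derivative_increment_at_lowest[OF low'] by metis
  obtain z where z: "z \<in> inside (path_image \<Gamma>)" "winding_number (\<lambda>t. \<Gamma> (t + t0)) z = of_real (sgn (Re (\<Gamma>' (0 + t0))))"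
    using S.winding_number_above_lowest[OF low' m(3)] pim by metis
  have zr: "z \<notin> path_image \<Gamma>" using z(1) inside_no_overlap by blast
  have "continuous_on UNIV (\<lambda>t. \<Gamma> t - z)" by (intro continuous_intros cont)
  then obtain n where n: "continuous_on UNIV n" "\<And>t. \<Gamma> t - z = exp (n t)"
    using continuous_logarithm_on_contractible[of UNIV "\<lambda>t. \<Gamma> t - z"] zr range_eq convex_imp_contractible[OF convex_UNIV]
    by (metis UNIV_I eq_iff_diff_eq_0 rangeI)
  have "n (t0 + 1) - n t0 = 2 * pi * \<i> * winding_number \<Gamma> z"
    by (rule log_increment) (use n zr range_eq in \<open>auto intro: continuous_on_subset\<close>)
  moreover have "n (0 + 1 + t0) - n (0 + t0) = 2 * pi * \<i> * winding_number (\<lambda>t. \<Gamma> (t + t0)) z"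
    by (rule S.log_increment[where lg="\<lambda>t. n (t + t0)"]) 
       (use n zr pim S.range_eq in \<open>auto intro!: continuous_on_compose2[OF n(1)] continuous_intros\<close>)
  ultimately have "winding_number (\<lambda>t. \<Gamma> (t + t0)) z = winding_number \<Gamma> z" by (simp add: add.commute)
  then have s: "of_real (sgn (Re (\<Gamma>' (0 + t0)))) = \<sigma>" using z wn by simp
  have "(\<lambda>t. lg (t + t0)) 1 - (\<lambda>t. lg (t + t0)) 0 = m 1 - m 0"
    by (rule continuous_logs_differ_by_constant[of "{0..1}" _ _ 1])
       (use m lg in \<open>auto intro!: continuous_on_compose2[OF lg(1)] continuous_intros\<close>)
  then have "lg (t0 + 1) - lg t0 = 2 * pi * \<i> * \<sigma>" using m(4) s by (simp add: add.commute)
  moreover have "(lg \<circ> (\<lambda>t. t + 1)) x - (lg \<circ> (\<lambda>t. t + 1)) t0 = lg x - lg t0"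
  proof (rule continuous_logs_differ_by_constant[of UNIV _ lg 1])
    show "continuous_on UNIV (lg \<circ> (\<lambda>t. t + 1))"
      by (intro continuous_on_compose continuous_intros continuous_on_subset[OF lg(1)]) auto
  qed (use lg per' in auto)
  ultimately show ?thesis by (simp add: algebra_simps)
qed

end

section \<open>Derivatives of the potential and of its pullback\<close>

lemma rgrad_norm_diff:
  assumes "z \<noteq> a"
  shows "rgrad (\<lambda>z. norm (z - a)) (cnj (z - a) / of_real (norm (z - a))) z"
proof -
  have "(sqrt has_real_derivative inverse (sqrt ((norm (z - a))\<^sup>2)) / 2) (at ((norm (z - a))\<^sup>2))"
    by (rule DERIV_real_sqrt) (use assms in auto)
  from rgrad_compose[OF rgrad_norm_diff_sq this]
  have 1: "rgrad (\<lambda>z. norm (z - a)) (of_real (inverse (norm (z - a)) / 2) * (2 * cnj (z - a))) z"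
    by (simp only: real_sqrt_abs abs_norm_cancel)
  have 2: "of_real (inverse n / 2) * (2 * c) = c / of_real n" for n :: real and c :: complex
    by (cases "n = 0") (simp_all add: field_simps)
  show ?thesis using 1 unfolding 2 .
qed

lemma rgrad_inverse_norm_diff:
  assumes "z \<noteq> a"
  shows "rgrad (\<lambda>z. 1 / norm (z - a)) (- cnj (z - a) / of_real (norm (z - a) ^ 3)) z"
proof -
  have "((\<lambda>x. 1 / x) has_real_derivative - 1 / (norm (z - a))\<^sup>2) (at (norm (z - a)))"
    using assms by (auto intro!: derivative_eq_intros simp: power2_eq_square)
  note 1 = rgrad_compose[OF rgrad_norm_diff[OF assms] this]
  have 2: "of_real (- 1 / n\<^sup>2) * (c / of_real n) = - c / of_real (n ^ 3)" for n :: real and c :: complex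
    by (simp add: power3_eq_cube power2_eq_square)
  show ?thesis using 1 unfolding 2 .
qed

text \<open>Up to sign this is the gradient of the Newtonian potential \<open>1 / r\<close>. In the
  conjugate derivative the contribution \<open>1 / r ^ 3\<close> of \<open>cnj\<close> and
  \<open>- 3 / 2 * (v * cnj v) / r ^ 5\<close> combine, since
  \<open>v * cnj v = r * r\<close>.\<close>

lemma wirtinger_cnj_over_norm_cube:
  assumes "z \<noteq> a"
  shows "wirtinger (\<lambda>z. cnj (z - a) / of_real (norm (z - a) ^ 3)) 
     (- 3 / 2 * (cnj (z - a))\<^sup>2 / of_real (norm (z - a) ^ 5)) (- 1 / 2 / of_real (norm (z - a) ^ 3)) z"
proof -
  define v where "v = z - a"
  define r where "r = norm v"
  have r: "r > 0" "r \<noteq> 0" using assms by (auto simp: r_def v_def)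
  have vv: "v * cnj v = of_real r * of_real r" using complex_norm_square[of v] by (simp add: r_def power2_eq_square)
  have "((\<lambda>x. 1 / x ^ 3) has_real_derivative - 3 / r ^ 4) (at r)"
    using r by (auto intro!: derivative_eq_intros simp: eval_nat_numeral field_simps)
  from rgrad_wirtinger[OF rgrad_compose[OF rgrad_norm_diff[OF assms] this[unfolded r_def v_def]]]
  have 1: "wirtinger (\<lambda>z. of_real (1 / norm (z - a) ^ 3)) 
    (of_real (- 3 / r ^ 4) * (cnj v / of_real r) / 2) (cnj (of_real (- 3 / r ^ 4) * (cnj v / of_real r)) / 2) z"
    by (simp only: r_def v_def)
  have 2: "((\<lambda>z. cnj (z - a)) has_derivative cnj) (at z)"
    by (auto intro!: derivative_eq_intros)
  have "((\<lambda>z. of_real (1 / norm (z - a) ^ 3) * cnj (z - a)) has_derivative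
      (\<lambda>w. - 3 / 2 * (cnj v)\<^sup>2 / of_real (r ^ 5) * w + (- 1 / 2 / of_real (r ^ 3)) * cnj w)) (at z)"
  proof (rule has_derivative_eq_rhs[OF has_derivative_mult[OF 1 2]], rule ext)
    fix w
    have "of_real (1 / norm (z - a) ^ 3) * cnj w + (of_real (- 3 / r ^ 4) * (cnj v / of_real r) / 2 * w + cnj (of_real (- 3 / r ^ 4) * (cnj v / of_real r)) / 2 * cnj w) * cnj (z - a)
      = cnj w / of_real r ^ 3 + (- 3 / 2 * (cnj v)\<^sup>2 / of_real r ^ 5) * w - 3 / 2 * (v * cnj v) / of_real r ^ 5 * cnj w"
      unfolding v_def[symmetric] r_def[symmetric] using r
      by (simp add: field_simps eval_nat_numeral)
    also have "\<dots> = - 3 / 2 * (cnj v)\<^sup>2 / of_real (r ^ 5) * w + (- 1 / 2 / of_real (r ^ 3)) * cnj w"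
      unfolding vv using r by (simp add: field_simps eval_nat_numeral)
    finally show "of_real (1 / norm (z - a) ^ 3) * cnj w + (of_real (- 3 / r ^ 4) * (cnj v / of_real r) / 2 * w + cnj (of_real (- 3 / r ^ 4) * (cnj v / of_real r)) / 2 * cnj w) * cnj (z - a)
      = - 3 / 2 * (cnj v)\<^sup>2 / of_real (r ^ 5) * w + (- 1 / 2 / of_real (r ^ 3)) * cnj w" .
  qed
  then show ?thesis unfolding r_def v_def by (simp add: mult.commute)
qed

section \<open>Partial derivatives and the Laplacian in complex notation\<close>

lemma partial_deriv_rgrad:
  assumes "rgrad h G z" shows "partial_deriv v h z = Re (G * v)"
proof -
  have "((\<lambda>s::real. z + of_real s * v) has_derivative (\<lambda>s. of_real s * v)) (at 0)"
    by (auto intro!: derivative_eq_intros)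
  then have "((\<lambda>s::real. h (z + of_real s * v)) has_derivative (\<lambda>s. Re (G * (of_real s * v)))) (at 0)"
    by (rule has_derivative_compose) (use assms in simp)
  moreover have "(\<lambda>s. Re (G * (of_real s * v))) = (*) (Re (G * v))" by (auto simp: algebra_simps)
  ultimately show ?thesis 
    unfolding partial_deriv_def by (intro DERIV_imp_deriv) (simp add: has_field_derivative_def)
qed

lemma second_partial_deriv_rgrad:
  assumes "open S" "z \<in> S" "\<And>w. w \<in> S \<Longrightarrow> rgrad h (G w) w" "wirtinger G P R z"
  shows "partial_deriv v (partial_deriv v h) z = Re ((P * v + R * cnj v) * v)"
proof -
  have "((\<lambda>w. Re (G w * v)) has_derivative (\<lambda>w. Re ((P * w + R * cnj w) * v))) (at z)"
    using assms(4) by (auto intro!: derivative_eq_intros)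
  then have *: "(partial_deriv v h has_derivative (\<lambda>w. Re ((P * w + R * cnj w) * v))) (at z)"
    by (rule has_derivative_transform_within_open[OF _ assms(1,2)])
       (use partial_deriv_rgrad[OF assms(3)] in simp)
  have "((\<lambda>s::real. z + of_real s * v) has_derivative (\<lambda>s. of_real s * v)) (at 0)"
    by (auto intro!: derivative_eq_intros)
  then have "((\<lambda>s::real. partial_deriv v h (z + of_real s * v)) has_derivative 
       (\<lambda>s. Re ((P * (of_real s * v) + R * cnj (of_real s * v)) * v))) (at 0)"
    by (rule has_derivative_compose) (use * in simp)
  moreover have "(\<lambda>s. Re ((P * (of_real s * v) + R * cnj (of_real s * v)) * v)) = (*) (Re ((P * v + R * cnj v) * v))"
    by (auto simp: algebra_simps)
  ultimately show ?thesis 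
    unfolding partial_deriv_def[of v "partial_deriv v h"]
    by (intro DERIV_imp_deriv) (simp add: has_field_derivative_def)
qed

text \<open>The second derivatives in the directions 1 and \<open>\<i>\<close> are
  \<open>Re (R + P)\<close> and \<open>Re (R - P)\<close>, so \<open>P\<close> cancels in the
  sum.\<close>

lemma laplacian_rgrad:
  assumes "open S" "z \<in> S" "\<And>w. w \<in> S \<Longrightarrow> rgrad h (G w) w" "wirtinger G P R z"
  shows "laplacian h z = 2 * Re R"
proof -
  have "partial_deriv v (partial_deriv v h) z = Re ((P * v + R * cnj v) * v)" for v
    by (rule second_partial_deriv_rgrad[OF assms(1,2) _ assms(4)]) (rule assms(3))
  from this[of 1] this[of \<i>] show ?thesis
    by (simp add: laplacian_def)
qed

section \<open>Derivatives of the potential\<close>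

definition omega_grad :: "real \<Rightarrow> complex \<Rightarrow> complex" where
  "omega_grad \<mu> y = cnj y - (1 - \<mu>) * (cnj (y + \<mu>) / of_real (norm (y + \<mu>) ^ 3))
     - \<mu> * (cnj (y + \<mu> - 1) / of_real (norm (y + \<mu> - 1) ^ 3))"

definition omega_dd :: "real \<Rightarrow> complex \<Rightarrow> complex" where
  "omega_dd \<mu> y = 3 / 2 * ((1 - \<mu>) * (cnj (y + \<mu>))\<^sup>2 / of_real (norm (y + \<mu>) ^ 5) 
     + \<mu> * (cnj (y + \<mu> - 1))\<^sup>2 / of_real (norm (y + \<mu> - 1) ^ 5))"

text \<open>Half the Laplacian of \<open>omega\<close>. In the plane \<open>1 / r\<close> is not
  harmonic: its Laplacian is \<open>1 / r ^ 3\<close>.\<close>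

definition omega_ddbar :: "real \<Rightarrow> complex \<Rightarrow> real" where
  "omega_ddbar \<mu> y = 1 + 1 / 2 * ((1 - \<mu>) / norm (y + \<mu>) ^ 3 + \<mu> / norm (y + \<mu> - 1) ^ 3)"

lemma omega_norm: "omega \<mu> y = 1 / 2 * (norm y)\<^sup>2 + (1 - \<mu>) / norm (y + \<mu>) + \<mu> / norm (y + \<mu> - 1)"
  by (simp add: omega_def cmod_def cmod_power2)

lemma notin_primariesD: "y \<notin> primaries \<mu> \<Longrightarrow> y \<noteq> - of_real \<mu>" "y \<notin> primaries \<mu> \<Longrightarrow> y \<noteq> 1 - of_real \<mu>"
  by (auto simp: primaries_def)

lemma omega_rgrad:
  assumes "y \<notin> primaries \<mu>"
  shows "rgrad (omega \<mu>) (omega_grad \<mu> y) y"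
proof -
  have 1: "rgrad (\<lambda>y. (norm y)\<^sup>2) (2 * cnj y) y" using rgrad_norm_diff_sq[of 0 y] by simp
  have 2: "rgrad (\<lambda>y. 1 / norm (y + \<mu>)) (- cnj (y + \<mu>) / of_real (norm (y + \<mu>) ^ 3)) y"
    using rgrad_inverse_norm_diff[OF notin_primariesD(1)[OF assms]] by simp
  have 3: "rgrad (\<lambda>y. 1 / norm (y + \<mu> - 1)) (- cnj (y + \<mu> - 1) / of_real (norm (y + \<mu> - 1) ^ 3)) y"
    using rgrad_inverse_norm_diff[OF notin_primariesD(2)[OF assms]] by (simp add: algebra_simps)
  have "((\<lambda>y. 1 / 2 * (norm y)\<^sup>2 + (1 - \<mu>) * (1 / norm (y + \<mu>)) + \<mu> * (1 / norm (y + \<mu> - 1))) has_derivative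
     (\<lambda>v. 1 / 2 * Re (2 * cnj y * v) + (1 - \<mu>) * Re (- cnj (y + \<mu>) / of_real (norm (y + \<mu>) ^ 3) * v)
       + \<mu> * Re (- cnj (y + \<mu> - 1) / of_real (norm (y + \<mu> - 1) ^ 3) * v))) (at y)"
    by (intro has_derivative_add has_derivative_mult_right 1 2 3)
  moreover have "1 / 2 * Re (2 * cnj y * v) + (1 - \<mu>) * Re (- cnj (y + \<mu>) / of_real (norm (y + \<mu>) ^ 3) * v)
       + \<mu> * Re (- cnj (y + \<mu> - 1) / of_real (norm (y + \<mu> - 1) ^ 3) * v) = Re (omega_grad \<mu> y * v)" for v
  proof -
    have "1 / 2 * Re (2 * cnj y * v) + (1 - \<mu>) * Re (- cnj (y + \<mu>) / of_real (norm (y + \<mu>) ^ 3) * v)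
       + \<mu> * Re (- cnj (y + \<mu> - 1) / of_real (norm (y + \<mu> - 1) ^ 3) * v)
      = Re (of_real (1 / 2) * (2 * cnj y * v)) + Re (of_real (1 - \<mu>) * (- cnj (y + \<mu>) / of_real (norm (y + \<mu>) ^ 3) * v))
       + Re (of_real \<mu> * (- cnj (y + \<mu> - 1) / of_real (norm (y + \<mu> - 1) ^ 3) * v))"
    proof -
      have R: "c * Re x = Re (of_real c * x)" for c x by simp
      show ?thesis by (simp only: R)
    qed
    also have "\<dots> = Re (of_real (1 / 2) * (2 * cnj y * v) + of_real (1 - \<mu>) * (- cnj (y + \<mu>) / of_real (norm (y + \<mu>) ^ 3) * v)
       + of_real \<mu> * (- cnj (y + \<mu> - 1) / of_real (norm (y + \<mu> - 1) ^ 3) * v))"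
      by (simp only: plus_complex.sel)
    also have "\<dots> = Re (omega_grad \<mu> y * v)"
    proof -
      have R: "of_real (1 / 2) * (2 * c * v) + of_real (1 - \<mu>) * (- a / A * v) + of_real \<mu> * (- b / B * v)
        = (c - of_real (1 - \<mu>) * (a / A) - of_real \<mu> * (b / B)) * v" for c a b A B :: complex
        by (simp only: minus_divide_left[symmetric] mult_minus_left mult_minus_right left_diff_distrib mult.assoc) simp
      show ?thesis unfolding R omega_grad_def by simp
    qed
    finally show ?thesis .
  qed
  ultimately show ?thesis by (simp add: omega_norm[abs_def])
qed

lemma omega_grad_wirtinger:
  assumes "y \<notin> primaries \<mu>"
  shows "wirtinger (omega_grad \<mu>) (omega_dd \<mu> y) (of_real (omega_ddbar \<mu> y)) y"
proof -
  have 1: "wirtinger cnj 0 1 y" by (auto intro!: derivative_eq_intros)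
  have 2: "wirtinger (\<lambda>y. cnj (y + \<mu>) / of_real (norm (y + \<mu>) ^ 3)) (- 3 / 2 * (cnj (y + \<mu>))\<^sup>2 / of_real (norm (y + \<mu>) ^ 5)) (- 1 / 2 / of_real (norm (y + \<mu>) ^ 3)) y"
    using wirtinger_cnj_over_norm_cube[OF notin_primariesD(1)[OF assms]] by simp
  have 3: "wirtinger (\<lambda>y. cnj (y + \<mu> - 1) / of_real (norm (y + \<mu> - 1) ^ 3)) (- 3 / 2 * (cnj (y + \<mu> - 1))\<^sup>2 / of_real (norm (y + \<mu> - 1) ^ 5)) (- 1 / 2 / of_real (norm (y + \<mu> - 1) ^ 3)) y"
    using wirtinger_cnj_over_norm_cube[OF notin_primariesD(2)[OF assms]] by (simp add: algebra_simps)
  show ?thesis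
    unfolding omega_grad_def[abs_def]
    by (rule has_derivative_eq_rhs[OF has_derivative_diff[OF has_derivative_diff[OF 1 has_derivative_mult_right[OF 2]] has_derivative_mult_right[OF 3]]])
       (simp add: fun_eq_iff omega_dd_def omega_ddbar_def algebra_simps add_divide_distrib diff_divide_distrib)
qed

lemma wirtinger_compose_holomorphic:
  assumes "(f has_field_derivative f') (at z)" "wirtinger g P R (f z)"
  shows "wirtinger (\<lambda>z. g (f z)) (P * f') (R * cnj f') z"
proof -
  have "((\<lambda>z. g (f z)) has_derivative (\<lambda>v. P * (f' * v) + R * cnj (f' * v))) (at z)"
    by (rule has_derivative_compose[OF assms(1)[unfolded has_field_derivative_def] assms(2)])
  then show ?thesis by (simp add: mult_ac)
qed

lemma rgrad_compose_holomorphic: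
  assumes "(f has_field_derivative f') (at z)" "rgrad h G (f z)"
  shows "rgrad (\<lambda>z. h (f z)) (G * f') z"
proof -
  have "((\<lambda>z. h (f z)) has_derivative (\<lambda>v. Re (G * (f' * v)))) (at z)"
    by (rule has_derivative_compose[OF assms(1)[unfolded has_field_derivative_def] assms(2)])
  then show ?thesis by (simp add: mult.assoc)
qed

lemma wirtinger_mult:
  assumes "wirtinger f P R z" "wirtinger g P' R' z"
  shows "wirtinger (\<lambda>z. f z * g z) (f z * P' + P * g z) (f z * R' + R * g z) z"
  by (rule has_derivative_eq_rhs[OF has_derivative_mult[OF assms]]) (simp add: fun_eq_iff algebra_simps)

lemma wirtinger_field_derivative:
  assumes "(f has_field_derivative f') (at z)" shows "wirtinger f f' 0 z"
  using assms by (simp add: has_field_derivative_def)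

section \<open>The pullback by the branched covering\<close>

definition phi' :: "real \<Rightarrow> nat \<Rightarrow> complex \<Rightarrow> complex" where
  "phi' \<mu> n z = of_nat n * (z + \<mu>) ^ (n - 1)"

definition phi'' :: "real \<Rightarrow> nat \<Rightarrow> complex \<Rightarrow> complex" where
  "phi'' \<mu> n z = of_nat n * (of_nat (n - 1) * (z + \<mu>) ^ (n - 1 - 1))"

lemma phi_deriv: "(phi \<mu> n has_field_derivative phi' \<mu> n z) (at z)"
  unfolding phi_def[abs_def] phi'_def by (auto intro!: derivative_eq_intros)

lemma phi'_deriv: "(phi' \<mu> n has_field_derivative phi'' \<mu> n z) (at z)"
  unfolding phi'_def[abs_def] phi''_def by (auto intro!: derivative_eq_intros)

text \<open>The radicand of \<open>f_tilde\<close>. Working with it avoids the square root, since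
  \<open>h_tilde\<close> is half its logarithm where it is positive.\<close>

definition f_sq :: "real \<Rightarrow> real \<Rightarrow> nat \<Rightarrow> complex \<Rightarrow> real" where
  "f_sq \<mu> C n z = 2 * omega \<mu> (phi \<mu> n z) - C"

definition f_sq_grad :: "real \<Rightarrow> nat \<Rightarrow> complex \<Rightarrow> complex" where
  "f_sq_grad \<mu> n z = 2 * (omega_grad \<mu> (phi \<mu> n z) * phi' \<mu> n z)"

definition f_sq_dd :: "real \<Rightarrow> nat \<Rightarrow> complex \<Rightarrow> complex" where
  "f_sq_dd \<mu> n z = 2 * (omega_dd \<mu> (phi \<mu> n z) * (phi' \<mu> n z)\<^sup>2 + omega_grad \<mu> (phi \<mu> n z) * phi'' \<mu> n z)"

definition f_sq_ddbar :: "real \<Rightarrow> nat \<Rightarrow> complex \<Rightarrow> real" where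
  "f_sq_ddbar \<mu> n z = 2 * (omega_ddbar \<mu> (phi \<mu> n z) * (norm (phi' \<mu> n z))\<^sup>2)"

definition regular_set :: "real \<Rightarrow> nat \<Rightarrow> complex set" where
  "regular_set \<mu> n = {z. phi \<mu> n z \<notin> primaries \<mu>}"

lemma continuous_phi: "continuous_on S (phi \<mu> n)" "continuous_on S (phi' \<mu> n)" "continuous_on S (phi'' \<mu> n)"
  unfolding phi_def phi'_def phi''_def by (intro continuous_intros)+

lemma open_regular_set: "open (regular_set \<mu> n)"
proof -
  have "regular_set \<mu> n = phi \<mu> n -` (- primaries \<mu>)" by (auto simp: regular_set_def)
  moreover have "open (- primaries \<mu>)" by (simp add: open_Compl finite_imp_closed primaries_def)
  ultimately show ?thesis using open_vimage continuous_phi by metis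
qed

lemma f_sq_rgrad:
  assumes "z \<in> regular_set \<mu> n"
  shows "rgrad (f_sq \<mu> C n) (f_sq_grad \<mu> n z) z"
proof -
  have 1: "rgrad (\<lambda>z. omega \<mu> (phi \<mu> n z)) (omega_grad \<mu> (phi \<mu> n z) * phi' \<mu> n z) z"
    using assms by (intro rgrad_compose_holomorphic phi_deriv omega_rgrad) (simp add: regular_set_def)
  have "((\<lambda>x. 2 * x - C) has_real_derivative 2) (at (omega \<mu> (phi \<mu> n z)))"
    by (auto intro!: derivative_eq_intros)
  from rgrad_compose[OF 1 this] show ?thesis
    by (simp add: f_sq_def[abs_def] f_sq_grad_def)
qed

lemma f_sq_grad_wirtinger:
  assumes "z \<in> regular_set \<mu> n"
  shows "wirtinger (f_sq_grad \<mu> n) (f_sq_dd \<mu> n z) (of_real (f_sq_ddbar \<mu> n z)) z"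
proof -
  have 1: "wirtinger (\<lambda>z. omega_grad \<mu> (phi \<mu> n z)) (omega_dd \<mu> (phi \<mu> n z) * phi' \<mu> n z) (of_real (omega_ddbar \<mu> (phi \<mu> n z)) * cnj (phi' \<mu> n z)) z"
    using assms by (intro wirtinger_compose_holomorphic phi_deriv omega_grad_wirtinger) (simp add: regular_set_def)
  have n: "of_real ((norm w)\<^sup>2) = cnj w * w" for w by (simp only: complex_norm_square mult.commute)
  have F: "of_real (f_sq_ddbar \<mu> n z) = 2 * (of_real (omega_ddbar \<mu> (phi \<mu> n z)) * (cnj (phi' \<mu> n z) * phi' \<mu> n z))"
    by (simp only: f_sq_ddbar_def of_real_mult n of_real_numeral)
  show ?thesis unfolding f_sq_grad_def[abs_def] F
    by (rule has_derivative_eq_rhs[OF has_derivative_mult_right[OF wirtinger_mult[OF 1 wirtinger_field_derivative[OF phi'_deriv]]]])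
       (simp add: fun_eq_iff f_sq_dd_def power2_eq_square algebra_simps)
qed

lemma continuous_omega_parts:
  "continuous_on (- primaries \<mu>) (omega \<mu>)" "continuous_on (- primaries \<mu>) (omega_grad \<mu>)"
  "continuous_on (- primaries \<mu>) (omega_dd \<mu>)" "continuous_on (- primaries \<mu>) (omega_ddbar \<mu>)"
proof -
  have z: "y + of_real \<mu> \<noteq> 0" "y + of_real \<mu> - 1 \<noteq> 0" if "y \<in> - primaries \<mu>" for y
    using that by (auto simp: primaries_def add_eq_0_iff2 algebra_simps)
  show "continuous_on (- primaries \<mu>) (omega \<mu>)" "continuous_on (- primaries \<mu>) (omega_grad \<mu>)"
    "continuous_on (- primaries \<mu>) (omega_dd \<mu>)" "continuous_on (- primaries \<mu>) (omega_ddbar \<mu>)"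
    unfolding omega_norm omega_grad_def omega_dd_def omega_ddbar_def
    by (intro continuous_intros; use z in force)+
qed

lemma continuous_f_sq_parts:
  "continuous_on (regular_set \<mu> n) (f_sq \<mu> C n)" "continuous_on (regular_set \<mu> n) (f_sq_grad \<mu> n)"
  "continuous_on (regular_set \<mu> n) (f_sq_dd \<mu> n)" "continuous_on (regular_set \<mu> n) (f_sq_ddbar \<mu> n)"
proof -
  have c: "continuous_on (regular_set \<mu> n) (\<lambda>z. g (phi \<mu> n z))" if "continuous_on (- primaries \<mu>) g" 
    for g :: "complex \<Rightarrow> 'a::topological_space"
    by (rule continuous_on_compose2[OF that continuous_phi(1)]) (auto simp: regular_set_def)
  show "continuous_on (regular_set \<mu> n) (f_sq \<mu> C n)" "continuous_on (regular_set \<mu> n) (f_sq_grad \<mu> n)"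
  "continuous_on (regular_set \<mu> n) (f_sq_dd \<mu> n)" "continuous_on (regular_set \<mu> n) (f_sq_ddbar \<mu> n)"
    unfolding f_sq_def f_sq_grad_def f_sq_dd_def f_sq_ddbar_def
    by (intro continuous_intros c continuous_omega_parts continuous_phi)+
qed

definition positive_set :: "real \<Rightarrow> real \<Rightarrow> nat \<Rightarrow> complex set" where
  "positive_set \<mu> C n = {z \<in> regular_set \<mu> n. f_sq \<mu> C n z > 0}"

lemma open_positive_set: "open (positive_set \<mu> C n)"
proof -
  have "positive_set \<mu> C n = regular_set \<mu> n \<inter> f_sq \<mu> C n -` {0<..}" by (auto simp: positive_set_def)
  then show ?thesis
    using continuous_open_preimage[OF continuous_f_sq_parts(1) open_regular_set open_greaterThan] by metis
qed

text \<open>Obtained from \<open>h = ln F / 2\<close> with \<open>F = f_sq\<close> by the quotient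
  rule; \<open>h_ddbar\<close> is half the Laplacian of \<open>h\<close>.\<close>

definition h_grad :: "real \<Rightarrow> real \<Rightarrow> nat \<Rightarrow> complex \<Rightarrow> complex" where
  "h_grad \<mu> C n z = f_sq_grad \<mu> n z / (2 * of_real (f_sq \<mu> C n z))"

definition h_dd :: "real \<Rightarrow> real \<Rightarrow> nat \<Rightarrow> complex \<Rightarrow> complex" where
  "h_dd \<mu> C n z = f_sq_dd \<mu> n z / (2 * of_real (f_sq \<mu> C n z)) - (f_sq_grad \<mu> n z)\<^sup>2 / (4 * (of_real (f_sq \<mu> C n z))\<^sup>2)"

definition h_ddbar :: "real \<Rightarrow> real \<Rightarrow> nat \<Rightarrow> complex \<Rightarrow> real" where
  "h_ddbar \<mu> C n z = f_sq_ddbar \<mu> n z / (2 * f_sq \<mu> C n z) - (norm (f_sq_grad \<mu> n z))\<^sup>2 / (4 * (f_sq \<mu> C n z)\<^sup>2)"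

lemma h_rgrad:
  assumes "z \<in> positive_set \<mu> C n"
  shows "rgrad (h_tilde \<mu> C n) (h_grad \<mu> C n z) z"
proof -
  have z: "z \<in> regular_set \<mu> n" "f_sq \<mu> C n z > 0" using assms by (auto simp: positive_set_def)
  have "((\<lambda>x. ln x / 2) has_real_derivative 1 / (2 * f_sq \<mu> C n z)) (at (f_sq \<mu> C n z))"
    using z by (auto intro!: derivative_eq_intros)
  from rgrad_compose[OF f_sq_rgrad[OF z(1)] this]
  have "rgrad (\<lambda>z. ln (f_sq \<mu> C n z) / 2) (h_grad \<mu> C n z) z" by (simp add: h_grad_def)
  then show ?thesis
    by (rule has_derivative_transform_within_open[OF _ open_positive_set assms])
       (simp add: h_tilde_def f_tilde_def f_sq_def[symmetric] positive_set_def ln_sqrt)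
qed

lemma h_grad_wirtinger:
  assumes "z \<in> positive_set \<mu> C n"
  shows "wirtinger (h_grad \<mu> C n) (h_dd \<mu> C n z) (of_real (h_ddbar \<mu> C n z)) z"
proof -
  have z: "z \<in> regular_set \<mu> n" "f_sq \<mu> C n z > 0" using assms by (auto simp: positive_set_def)
  have "((\<lambda>x. 1 / (2 * x)) has_real_derivative - 1 / (2 * (f_sq \<mu> C n z)\<^sup>2)) (at (f_sq \<mu> C n z))"
    using z by (auto intro!: derivative_eq_intros simp: power2_eq_square field_simps)
  note 1 = rgrad_wirtinger[OF rgrad_compose[OF f_sq_rgrad[OF z(1)] this]]
  have n: "of_real ((norm w)\<^sup>2) = w * cnj w" for w by (rule complex_norm_square)
  have "wirtinger (\<lambda>z. f_sq_grad \<mu> n z * of_real (1 / (2 * f_sq \<mu> C n z))) (h_dd \<mu> C n z) (of_real (h_ddbar \<mu> C n z)) z"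
  proof (rule has_derivative_eq_rhs[OF wirtinger_mult[OF f_sq_grad_wirtinger[OF z(1)] 1]], rule ext)
    fix v
    define F G P R where "F = f_sq \<mu> C n z" and "G = f_sq_grad \<mu> n z" and "P = f_sq_dd \<mu> n z" and "R = f_sq_ddbar \<mu> n z"
    have F: "F > 0" using z by (simp add: F_def)
    have h1: "h_dd \<mu> C n z = P / (2 * of_real F) - G\<^sup>2 / (4 * (of_real F)\<^sup>2)"
      by (simp add: h_dd_def F_def G_def P_def)
    have h2: "of_real (h_ddbar \<mu> C n z) = of_real R / (2 * of_real F) - (G * cnj G) / (4 * (of_real F)\<^sup>2)"
      unfolding h_ddbar_def of_real_diff of_real_divide n F_def G_def R_def by simp
    show "(f_sq_grad \<mu> n z * (of_real (- 1 / (2 * (f_sq \<mu> C n z)\<^sup>2)) * f_sq_grad \<mu> n z / 2) +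
          f_sq_dd \<mu> n z * of_real (1 / (2 * f_sq \<mu> C n z))) * v +
         (f_sq_grad \<mu> n z * (cnj (of_real (- 1 / (2 * (f_sq \<mu> C n z)\<^sup>2)) * f_sq_grad \<mu> n z) / 2) +
          of_real (f_sq_ddbar \<mu> n z) * of_real (1 / (2 * f_sq \<mu> C n z))) * cnj v
       = h_dd \<mu> C n z * v + of_real (h_ddbar \<mu> C n z) * cnj v"
    proof -
      \<comment> \<open>With the inverse as an atom the claim becomes a polynomial identity.\<close>
      define k where "k = inverse (complex_of_real F)"
      have k: "of_real (- 1 / (2 * F\<^sup>2)) = - (k * k) / 2" "of_real (1 / (2 * F)) = k / 2" 
        "P / (2 * of_real F) = P * k / 2" "of_real R / (2 * of_real F) = of_real R * k / 2"
        "G\<^sup>2 / (4 * (of_real F)\<^sup>2) = G * G * k * k / 4" "(G * cnj G) / (4 * (of_real F)\<^sup>2) = G * cnj G * k * k / 4"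
        by (simp_all add: k_def power2_eq_square inverse_eq_divide)
      have ck: "cnj k = k" by (simp add: k_def)
      show ?thesis
        unfolding h1 h2 unfolding F_def[symmetric] G_def[symmetric] P_def[symmetric] R_def[symmetric] k
        by (simp only: ck complex_cnj_mult complex_cnj_divide complex_cnj_minus complex_cnj_numeral) algebra
    qed
  qed
  moreover have "f_sq_grad \<mu> n z * of_real (1 / (2 * f_sq \<mu> C n z)) = h_grad \<mu> C n z" for z
    by (simp add: h_grad_def)
  ultimately show ?thesis by simp
qed

lemma laplacian_h:
  assumes "z \<in> positive_set \<mu> C n"
  shows "laplacian (h_tilde \<mu> C n) z = 2 * h_ddbar \<mu> C n z"
  using laplacian_rgrad[OF open_positive_set assms h_rgrad h_grad_wirtinger[OF assms]] by simp

lemma continuous_h_parts: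
  "continuous_on (positive_set \<mu> C n) (h_grad \<mu> C n)" "continuous_on (positive_set \<mu> C n) (h_dd \<mu> C n)"
  "continuous_on (positive_set \<mu> C n) (h_ddbar \<mu> C n)"
proof -
  have s: "positive_set \<mu> C n \<subseteq> regular_set \<mu> n" by (auto simp: positive_set_def)
  note c = continuous_f_sq_parts[THEN continuous_on_subset, OF s]
  have nz: "f_sq \<mu> C n z \<noteq> 0" if "z \<in> positive_set \<mu> C n" for z using that by (auto simp: positive_set_def)
  show "continuous_on (positive_set \<mu> C n) (h_grad \<mu> C n)" "continuous_on (positive_set \<mu> C n) (h_dd \<mu> C n)"
  "continuous_on (positive_set \<mu> C n) (h_ddbar \<mu> C n)"
    unfolding h_grad_def h_dd_def h_ddbar_def
    by (intro continuous_intros c; use nz in simp)+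
qed

section \<open>Asymptotics at the primary\<close>

context
  fixes \<mu> C :: real and n :: nat
  assumes mu: "\<mu> < 1" and n: "n \<ge> 1"
begin

text \<open>
  With \<open>r = |z + \<mu>|^n\<close> the functions below are the parts of \<open>\<nabla>\<omega>\<close>, of \<open>2 \<omega> - C\<close> and of the Laplacian of
  \<open>\<omega>\<close> that stay bounded at the primary. In the Laplacian of \<open>h\<close> the leading terms cancel, which leaves a
  singularity of order \<open>|z + \<mu>|^(n - 2)\<close> only.
\<close>

definition omega_grad_rest :: "complex \<Rightarrow> complex" where
  "omega_grad_rest z = cnj (phi \<mu> n z) - of_real \<mu> * (cnj ((z + \<mu>) ^ n - 1) / of_real (norm ((z + \<mu>) ^ n - 1) ^ 3))"

definition f_sq_rest :: "complex \<Rightarrow> real" where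
  "f_sq_rest z = (norm (phi \<mu> n z))\<^sup>2 + 2 * \<mu> / norm ((z + \<mu>) ^ n - 1) - C"

definition omega_ddbar_rest :: "complex \<Rightarrow> real" where
  "omega_ddbar_rest z = 1 + 1 / 2 * (\<mu> / norm ((z + \<mu>) ^ n - 1) ^ 3)"

definition dist_pow :: "complex \<Rightarrow> real" where "dist_pow z = norm (z + \<mu>) ^ n"

definition h_ddbar_scaled :: "complex \<Rightarrow> real" where
  "h_ddbar_scaled z = (real n)\<^sup>2 * norm (z + \<mu>) ^ (n - 1) * ((1 - \<mu>) * f_sq_rest z / 2 + 2 * (1 - \<mu>) * (dist_pow z)\<^sup>2 * omega_ddbar_rest z
     + (dist_pow z) ^ 3 * omega_ddbar_rest z * f_sq_rest z + 2 * (1 - \<mu>) * Re ((z + \<mu>) ^ n * omega_grad_rest z) - dist_pow z * (norm ((z + \<mu>) ^ n * omega_grad_rest z))\<^sup>2)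
     / (2 * (1 - \<mu>) + dist_pow z * f_sq_rest z)\<^sup>2"

lemma phi_plus: "phi \<mu> n z + \<mu> = (z + \<mu>) ^ n"
  by (simp add: phi_def)

lemma dist_pow_0: "dist_pow (- of_real \<mu>) = 0" and power_0: "(- of_real \<mu> + complex_of_real \<mu>) ^ n = 0"
  using n by (auto simp: dist_pow_def power_0_left)

lemma cont_near:
  "isCont omega_grad_rest (- of_real \<mu>)" "isCont f_sq_rest (- of_real \<mu>)" "isCont omega_ddbar_rest (- of_real \<mu>)" "isCont dist_pow (- of_real \<mu>)"
proof -
  have nz: "(- of_real \<mu> + complex_of_real \<mu>) ^ n - 1 \<noteq> 0" unfolding power_0 by simp
  show "isCont omega_grad_rest (- of_real \<mu>)" "isCont f_sq_rest (- of_real \<mu>)" "isCont omega_ddbar_rest (- of_real \<mu>)" "isCont dist_pow (- of_real \<mu>)"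
    unfolding omega_grad_rest_def f_sq_rest_def omega_ddbar_rest_def dist_pow_def phi_def
    by (intro continuous_intros; use nz in force)+
qed

lemma denom_near: "\<forall>\<^sub>F z in at (- of_real \<mu>). 2 * (1 - \<mu>) + dist_pow z * f_sq_rest z > 0"
proof -
  have "isCont (\<lambda>z. 2 * (1 - \<mu>) + dist_pow z * f_sq_rest z) (- of_real \<mu>)"
    by (intro continuous_intros cont_near)
  then have "((\<lambda>z. 2 * (1 - \<mu>) + dist_pow z * f_sq_rest z) \<longlongrightarrow> 2 * (1 - \<mu>)) (at (- of_real \<mu>))"
    unfolding isCont_def by (simp add: dist_pow_0)
  then show ?thesis by (rule order_tendstoD) (use mu in simp)
qed

lemma parts_near:
  assumes z: "z \<noteq> - of_real \<mu>"
  shows "dist_pow z > 0" "norm ((z + \<mu>) ^ n) = dist_pow z"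
    "f_sq \<mu> C n z = (2 * (1 - \<mu>) + dist_pow z * f_sq_rest z) / dist_pow z"
    "(z + \<mu>) ^ n * omega_grad \<mu> (phi \<mu> n z) = (- of_real (1 - \<mu>) + of_real (dist_pow z) * ((z + \<mu>) ^ n * omega_grad_rest z)) / of_real (dist_pow z)"
    "omega_ddbar \<mu> (phi \<mu> n z) = (1 - \<mu>) / (2 * dist_pow z ^ 3) + omega_ddbar_rest z"
proof -
  have u: "z + \<mu> \<noteq> 0" using z by (simp add: add_eq_0_iff2)
  show r: "dist_pow z > 0" using u by (simp add: dist_pow_def)
  show nr: "norm ((z + \<mu>) ^ n) = dist_pow z" by (simp add: dist_pow_def norm_power)
  show "f_sq \<mu> C n z = (2 * (1 - \<mu>) + dist_pow z * f_sq_rest z) / dist_pow z"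
    unfolding f_sq_def omega_norm phi_plus nr f_sq_rest_def using r by (simp add: field_simps)
  have w: "(z + \<mu>) ^ n * cnj ((z + \<mu>) ^ n) = of_real (dist_pow z) * of_real (dist_pow z)"
    using complex_norm_square[of "(z + \<mu>) ^ n"] nr by (simp add: power2_eq_square)
  have "omega_grad \<mu> (phi \<mu> n z) = omega_grad_rest z - of_real (1 - \<mu>) * (cnj ((z + \<mu>) ^ n) / of_real (dist_pow z ^ 3))"
    unfolding omega_grad_def phi_plus nr omega_grad_rest_def by simp
  then have "(z + \<mu>) ^ n * omega_grad \<mu> (phi \<mu> n z) 
    = (z + \<mu>) ^ n * omega_grad_rest z - of_real (1 - \<mu>) * (((z + \<mu>) ^ n * cnj ((z + \<mu>) ^ n)) / of_real (dist_pow z ^ 3))"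
  proof -
    have "w * (B - a * (c / q)) = w * B - a * ((w * c) / q)" for w B a c q :: complex
      by (simp add: algebra_simps)
    then show ?thesis unfolding \<open>omega_grad \<mu> (phi \<mu> n z) = _\<close> by blast
  qed
  also have "\<dots> = (- of_real (1 - \<mu>) + of_real (dist_pow z) * ((z + \<mu>) ^ n * omega_grad_rest z)) / of_real (dist_pow z)"
    unfolding w using r by (simp add: field_simps power3_eq_cube)
  finally show "(z + \<mu>) ^ n * omega_grad \<mu> (phi \<mu> n z) = (- of_real (1 - \<mu>) + of_real (dist_pow z) * ((z + \<mu>) ^ n * omega_grad_rest z)) / of_real (dist_pow z)" .
  show "omega_ddbar \<mu> (phi \<mu> n z) = (1 - \<mu>) / (2 * dist_pow z ^ 3) + omega_ddbar_rest z"
    unfolding omega_ddbar_def phi_plus nr omega_ddbar_rest_def using r by (simp add: field_simps)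
qed

text \<open>Near the centre \<open>f_sq\<close> behaves like
  \<open>2 * (1 - \<mu>) / norm (z + \<mu>) ^ n\<close>, so \<open>h\<close> has a logarithmic pole
  with coefficient \<open>- n / 2\<close>. The function \<open>R\<close> is the expression with the
  common denominator \<open>dist_pow z\<close> cleared, which is continuous at the centre.\<close>

lemma h_grad_near: "((\<lambda>z. (z + \<mu>) * h_grad \<mu> C n z) \<longlongrightarrow> - of_nat n / 2) (at (- complex_of_real \<mu>))"
proof -
  define R where "R z = of_nat n * (- of_real (1 - \<mu>) + of_real (dist_pow z) * ((z + \<mu>) ^ n * omega_grad_rest z)) / of_real (2 * (1 - \<mu>) + dist_pow z * f_sq_rest z)" for z
  have "isCont R (- of_real \<mu>)"
    unfolding R_def using mu by (intro continuous_intros cont_near) (simp add: dist_pow_0 flip: of_real_diff)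
  then have "(R \<longlongrightarrow> R (- of_real \<mu>)) (at (- of_real \<mu>))" by (simp add: isCont_def)
  moreover have "R (- of_real \<mu>) = - of_nat n / 2"
  proof -
    have "R (- of_real \<mu>) = of_nat n * (- of_real (1 - \<mu>)) / of_real (2 * (1 - \<mu>))"
      by (simp add: R_def dist_pow_0)
    also have "\<dots> = - of_nat n / 2" 
    proof -
      have "complex_of_real (1 - \<mu>) \<noteq> 0" using mu by (simp del: of_real_diff)
      then show ?thesis unfolding of_real_mult by (simp add: field_simps del: of_real_diff)
    qed
    finally show ?thesis .
  qed
  moreover have "\<forall>\<^sub>F z in at (- of_real \<mu>). R z = (z + \<mu>) * h_grad \<mu> C n z"
    using denom_near eventually_at_ball'[of 1 "- complex_of_real \<mu>" UNIV, OF zero_less_one]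
  proof eventually_elim
    case (elim z)
    then have z: "z \<noteq> - of_real \<mu>" by simp
    note P = parts_near[OF z]
    define d where "d = 2 * (1 - \<mu>) + dist_pow z * f_sq_rest z"
    have d: "d > 0" using elim by (simp add: d_def)
    have "(z + \<mu>) * h_grad \<mu> C n z = ((z + \<mu>) * (z + \<mu>) ^ (n - 1)) * of_nat n * omega_grad \<mu> (phi \<mu> n z) / of_real (f_sq \<mu> C n z)"
      by (simp add: h_grad_def f_sq_grad_def phi'_def)
    also have "(z + \<mu>) * (z + \<mu>) ^ (n - 1) = (z + \<mu>) ^ n" using n by (cases n) auto
    also have "(z + \<mu>) ^ n * of_nat n * omega_grad \<mu> (phi \<mu> n z) / of_real (f_sq \<mu> C n z)
       = of_nat n * ((z + \<mu>) ^ n * omega_grad \<mu> (phi \<mu> n z)) / of_real (f_sq \<mu> C n z)" by (simp add: mult_ac)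
    also have "\<dots> = R z" 
    proof -
      have "of_nat n * (X / of_real a) / of_real (b / a) = of_nat n * X / of_real b" if "a > 0" for X :: complex and a b :: real
        using that by (simp add: field_simps)
      then show ?thesis unfolding P(3,4) R_def d_def[symmetric] using P(1) by blast
    qed
    finally show ?case by simp
  qed
  ultimately show ?thesis using Lim_transform_eventually[of R _ "at (- of_real \<mu>)"] by simp
qed

text \<open>The exponent kept here is that of the worst case \<open>n = 1\<close>; it is integrable
  in the plane and therefore serves for all \<open>n\<close>.\<close>

lemma h_ddbar_near: 
  obtains r M where "r > 0" "\<And>z. z \<noteq> - complex_of_real \<mu> \<Longrightarrow> norm (z + \<mu>) < r \<Longrightarrow> \<bar>h_ddbar \<mu> C n z\<bar> \<le> M / norm (z + \<mu>)"
proof -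
  have "isCont h_ddbar_scaled (- of_real \<mu>)"
    unfolding h_ddbar_scaled_def
  proof (intro continuous_intros cont_near)
    show "(2 * (1 - \<mu>) + dist_pow (- of_real \<mu>) * f_sq_rest (- of_real \<mu>))\<^sup>2 \<noteq> 0"
      using mu by (simp add: dist_pow_0)
    show "isCont (\<lambda>z. Re ((z + complex_of_real \<mu>) ^ n * omega_grad_rest z)) (- complex_of_real \<mu>)"
      by (rule isCont_o2[OF _ isCont_Re[OF continuous_ident]]) (intro continuous_intros cont_near)
  qed simp
  then have "(h_ddbar_scaled \<longlongrightarrow> h_ddbar_scaled (- of_real \<mu>)) (at (- of_real \<mu>))" by (simp add: isCont_def)
  then have "\<forall>\<^sub>F z in at (- of_real \<mu>). dist (h_ddbar_scaled z) (h_ddbar_scaled (- of_real \<mu>)) < 1" by (rule tendstoD) simp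
  then have "\<forall>\<^sub>F z in at (- of_real \<mu>). \<bar>h_ddbar \<mu> C n z\<bar> \<le> (\<bar>h_ddbar_scaled (- of_real \<mu>)\<bar> + 1) / norm (z + \<mu>)"
    using denom_near eventually_at_ball'[of 1 "- complex_of_real \<mu>" UNIV, OF zero_less_one]
  proof eventually_elim
    case (elim z)
    then have z: "z \<noteq> - of_real \<mu>" by simp
    note P = parts_near[OF z]
    have u: "norm (z + \<mu>) > 0" using z by (simp add: add_eq_0_iff2)
    define d where "d = 2 * (1 - \<mu>) + dist_pow z * f_sq_rest z"
    have d: "d > 0" using elim by (simp add: d_def)
    define a where "a = 1 - \<mu>"
    define r where "r = dist_pow z"
    define W where "W = (z + \<mu>) ^ n * omega_grad_rest z"
    have r: "r > 0" using P(1) by (simp add: r_def)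
    have g2: "(norm (omega_grad \<mu> (phi \<mu> n z)))\<^sup>2 = (a\<^sup>2 - 2 * a * r * Re W + r\<^sup>2 * (norm W)\<^sup>2) / r ^ 4"
    proof -
      have "norm ((z + \<mu>) ^ n * omega_grad \<mu> (phi \<mu> n z)) = norm (- of_real a + of_real r * W) / r"
        unfolding P(4) a_def r_def W_def using P(1) by (simp add: norm_divide)
      then have "norm (omega_grad \<mu> (phi \<mu> n z)) = norm (- of_real a + of_real r * W) / r / r"
        using P(2) r by (simp add: norm_mult r_def field_simps)
      moreover have "(norm (- of_real a + of_real r * W))\<^sup>2 = a\<^sup>2 - 2 * a * r * Re W + r\<^sup>2 * (norm W)\<^sup>2"
        unfolding cmod_power2 by (simp add: power2_eq_square algebra_simps)
      ultimately show ?thesis by (simp add: power_divide power2_eq_square[of r] eval_nat_numeral)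
    qed
    have p2: "(norm (phi' \<mu> n z))\<^sup>2 = (real n)\<^sup>2 * (norm (z + \<mu>) ^ (n - 1))\<^sup>2"
      by (simp add: phi'_def norm_mult norm_power power_mult_distrib)
    have "h_ddbar \<mu> C n z = (norm (phi' \<mu> n z))\<^sup>2 * (omega_ddbar \<mu> (phi \<mu> n z) / f_sq \<mu> C n z 
        - (norm (omega_grad \<mu> (phi \<mu> n z)))\<^sup>2 / (f_sq \<mu> C n z)\<^sup>2)"
      by (simp add: h_ddbar_def f_sq_ddbar_def f_sq_grad_def norm_mult power_mult_distrib algebra_simps)
    also have "omega_ddbar \<mu> (phi \<mu> n z) / f_sq \<mu> C n z - (norm (omega_grad \<mu> (phi \<mu> n z)))\<^sup>2 / (f_sq \<mu> C n z)\<^sup>2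
      = (a * f_sq_rest z / 2 + 2 * a * r\<^sup>2 * omega_ddbar_rest z + r ^ 3 * omega_ddbar_rest z * f_sq_rest z + 2 * a * Re W - r * (norm W)\<^sup>2) / (r * d\<^sup>2)"
    proof -
      have F: "f_sq \<mu> C n z = d / r" by (simp only: P(3) d_def r_def)
      have d2: "d = 2 * a + r * f_sq_rest z" by (simp add: d_def a_def r_def)
      have w: "omega_ddbar \<mu> (phi \<mu> n z) = (a + 2 * r ^ 3 * omega_ddbar_rest z) / (2 * r ^ 3)"
        using r by (simp add: P(5) a_def r_def field_simps)
      have "omega_ddbar \<mu> (phi \<mu> n z) / f_sq \<mu> C n z - (norm (omega_grad \<mu> (phi \<mu> n z)))\<^sup>2 / (f_sq \<mu> C n z)\<^sup>2
        = ((a + 2 * r ^ 3 * omega_ddbar_rest z) * d / 2 - (a\<^sup>2 - 2 * a * r * Re W + r\<^sup>2 * (norm W)\<^sup>2)) / (r\<^sup>2 * d\<^sup>2)"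
        unfolding F g2 w using r d by (simp add: field_simps eval_nat_numeral)
      \<comment> \<open>Inserting \<open>d = 2 * a + r * f_sq_rest z\<close> cancels
        \<open>a\<^sup>2\<close>, and the numerator acquires the factor \<open>r\<close> that lowers
        the order of the singularity.\<close>
      also have "(a + 2 * r ^ 3 * omega_ddbar_rest z) * d / 2 - (a\<^sup>2 - 2 * a * r * Re W + r\<^sup>2 * (norm W)\<^sup>2)
        = r * (a * f_sq_rest z / 2 + 2 * a * r\<^sup>2 * omega_ddbar_rest z + r ^ 3 * omega_ddbar_rest z * f_sq_rest z + 2 * a * Re W - r * (norm W)\<^sup>2)"
        unfolding d2 by (simp add: field_simps eval_nat_numeral)
      also have "\<dots> / (r\<^sup>2 * d\<^sup>2) = (a * f_sq_rest z / 2 + 2 * a * r\<^sup>2 * omega_ddbar_rest z + r ^ 3 * omega_ddbar_rest z * f_sq_rest z + 2 * a * Re W - r * (norm W)\<^sup>2) / (r * d\<^sup>2)"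
        using r by (simp add: power2_eq_square[of r])
      finally show ?thesis .
    qed
    finally have "h_ddbar \<mu> C n z = (norm (phi' \<mu> n z))\<^sup>2 * ((a * f_sq_rest z / 2 + 2 * a * r\<^sup>2 * omega_ddbar_rest z + r ^ 3 * omega_ddbar_rest z * f_sq_rest z + 2 * a * Re W - r * (norm W)\<^sup>2) / (r * d\<^sup>2))" .
    moreover define m where "m = norm (z + \<mu>) ^ (n - 1)"
    moreover define N where "N = a * f_sq_rest z / 2 + 2 * a * r\<^sup>2 * omega_ddbar_rest z + r ^ 3 * omega_ddbar_rest z * f_sq_rest z + 2 * a * Re W - r * (norm W)\<^sup>2"
    ultimately have h: "h_ddbar \<mu> C n z = (real n)\<^sup>2 * m\<^sup>2 * (N / (r * d\<^sup>2))" by (simp only: p2)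
    have rm: "r = norm (z + \<mu>) * m" using n unfolding r_def dist_pow_def m_def by (cases n) auto
    have E: "h_ddbar_scaled z = (real n)\<^sup>2 * m * N / d\<^sup>2"
      unfolding h_ddbar_scaled_def N_def m_def d_def W_def r_def a_def by (rule refl)
    have "m > 0" using u by (simp add: m_def)
    then have "h_ddbar \<mu> C n z * norm (z + \<mu>) = h_ddbar_scaled z"
      unfolding h E rm using u d by (simp add: power2_eq_square)
    moreover have "\<bar>h_ddbar_scaled z\<bar> \<le> \<bar>h_ddbar_scaled (- of_real \<mu>)\<bar> + 1" using elim by (simp add: dist_real_def)
    ultimately have "\<bar>h_ddbar \<mu> C n z\<bar> * norm (z + \<mu>) \<le> \<bar>h_ddbar_scaled (- of_real \<mu>)\<bar> + 1"
      by (metis abs_mult abs_norm_cancel)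
    then show ?case using u by (simp add: pos_le_divide_eq)
  qed
  then show ?thesis unfolding eventually_at using that by (metis diff_minus_eq_add dist_norm UNIV_I)
qed

end

section \<open>Zeros of the speed function\<close>

text \<open>
  If the second derivative vanished at a critical point, the vectors from the two primaries would be
  orthogonal, hence independent, so both would have length 1; but the primaries have distance 1.
\<close>

lemma critical_point_anisotropic:
  assumes mu: "0 < \<mu>" "\<mu> < 1" and y: "y \<notin> primaries \<mu>" and crit: "omega_grad \<mu> y = 0"
  shows "omega_dd \<mu> y \<noteq> 0"
proof
  assume dd: "omega_dd \<mu> y = 0"
  define a b where "a = y + of_real \<mu>" and "b = y + of_real \<mu> - 1"
  define r s where "r = norm a" and "s = norm b"
  have rs: "r > 0" "s > 0" using notin_primariesD[OF y] by (auto simp: r_def s_def a_def b_def add_eq_0_iff2 algebra_simps)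
  have ab: "a - b = 1" by (simp add: a_def b_def)
  have "cnj (omega_dd \<mu> y) = 0" using dd by simp
  then have 1: "of_real (1 - \<mu>) * a\<^sup>2 / of_real (r ^ 5) = - (of_real \<mu> * b\<^sup>2 / of_real (s ^ 5))"
  proof -
    have eq: "cnj (omega_dd \<mu> y) = 3 / 2 * (of_real (1 - \<mu>) * a\<^sup>2 / of_real (r ^ 5) + of_real \<mu> * b\<^sup>2 / of_real (s ^ 5))"
      unfolding omega_dd_def r_def s_def a_def b_def by simp
    have "of_real (1 - \<mu>) * a\<^sup>2 / of_real (r ^ 5) + of_real \<mu> * b\<^sup>2 / of_real (s ^ 5) = 0"
    proof -
      have "X = 0" if "3 / 2 * X = 0" for X :: complex using that by simp
      then show ?thesis using \<open>cnj (omega_dd \<mu> y) = 0\<close> eq by metis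
    qed
    then show ?thesis by (simp only: add_eq_0_iff2)
  qed
  then have "norm (of_real (1 - \<mu>) * a\<^sup>2 / of_real (r ^ 5)) = norm (of_real \<mu> * b\<^sup>2 / of_real (s ^ 5))"
    by (metis norm_minus_cancel)
  moreover have "norm (of_real (1 - \<mu>) * a\<^sup>2 / of_real (r ^ 5)) = (1 - \<mu>) / r ^ 3"
    unfolding norm_mult norm_divide norm_power norm_of_real r_def[symmetric]
    using mu rs by (simp add: field_simps eval_nat_numeral)
  moreover have "norm (of_real \<mu> * b\<^sup>2 / of_real (s ^ 5)) = \<mu> / s ^ 3"
    unfolding norm_mult norm_divide norm_power norm_of_real s_def[symmetric]
    using mu rs by (simp add: field_simps eval_nat_numeral)
  ultimately have k: "(1 - \<mu>) / r ^ 3 = \<mu> / s ^ 3" by simp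
  \<comment> \<open>The vanishing second derivative makes \<open>(1 - \<mu>) / r ^ 3\<close> and
    \<open>\<mu> / s ^ 3\<close> coincide. With the common value \<open>k\<close> the critical point
    equation becomes a linear relation between \<open>a\<close> and \<open>b\<close>.\<close>
  define k where "k = \<mu> / s ^ 3"
  have kp: "k > 0" using mu rs by (simp add: k_def)
  have k1: "1 - \<mu> = k * r ^ 3" "\<mu> = k * s ^ 3"
    using k rs unfolding k_def[symmetric] by (auto simp: k_def field_simps)
  have "of_real (1 - \<mu>) * a\<^sup>2 / of_real (r ^ 5) = of_real k * (a\<^sup>2 / of_real (r\<^sup>2))"
    unfolding k1(1) using rs by (simp add: field_simps eval_nat_numeral)
  moreover have "of_real \<mu> * b\<^sup>2 / of_real (s ^ 5) = of_real k * (b\<^sup>2 / of_real (s\<^sup>2))"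
    unfolding k1(2) using rs by (simp add: field_simps eval_nat_numeral)
  ultimately have "of_real k * (a\<^sup>2 / of_real (r\<^sup>2)) = of_real k * (- (b\<^sup>2 / of_real (s\<^sup>2)))" using 1 by simp
  then have "a\<^sup>2 / of_real (r\<^sup>2) = - (b\<^sup>2 / of_real (s\<^sup>2))" using kp by (subst (asm) mult_cancel_left) auto
  then have q: "of_real (s\<^sup>2) * a\<^sup>2 + of_real (r\<^sup>2) * b\<^sup>2 = 0" using rs by (simp add: field_simps)
  have "cnj (omega_grad \<mu> y) = 0" using crit by simp
  then have g: "y = of_real (1 - \<mu>) * (a / of_real (r ^ 3)) + of_real \<mu> * (b / of_real (s ^ 3))"
  proof -
    have "cnj (omega_grad \<mu> y) = y - of_real (1 - \<mu>) * (a / of_real (r ^ 3)) - of_real \<mu> * (b / of_real (s ^ 3))"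
      unfolding omega_grad_def r_def s_def a_def b_def by simp
    then have "y - of_real (1 - \<mu>) * (a / of_real (r ^ 3)) - of_real \<mu> * (b / of_real (s ^ 3)) = 0"
      using \<open>cnj (omega_grad \<mu> y) = 0\<close> by metis
    then show ?thesis by (simp only: diff_diff_eq right_minus_eq)
  qed
  have "of_real (1 - \<mu>) * (a / of_real (r ^ 3)) = of_real k * a" unfolding k1(1) using rs by simp
  moreover have "of_real \<mu> * (b / of_real (s ^ 3)) = of_real k * b" unfolding k1(2) using rs by simp
  \<comment> \<open>The origin is the centre of mass of the primaries.\<close>
  moreover have "y = of_real (1 - \<mu>) * a + of_real \<mu> * b" by (simp add: a_def b_def algebra_simps)
  ultimately have lin: "of_real (1 - \<mu> - k) * a + of_real (\<mu> - k) * b = 0"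
    using g by (simp add: algebra_simps)
  have b0: "b \<noteq> 0" using rs by (auto simp: s_def)
  \<comment> \<open>Otherwise \<open>a\<close> would be a real multiple of \<open>b\<close>, and
    \<open>q\<close> would say that a positive multiple of \<open>b\<^sup>2\<close>
    vanishes.\<close>
  have l0: "1 - \<mu> - k = 0"
  proof (rule ccontr)
    assume l: "1 - \<mu> - k \<noteq> 0"
    define l m where "l = 1 - \<mu> - k" and "m = \<mu> - k"
    define t where "t = - m / l"
    have "of_real l * a = - (of_real m * b)" using lin unfolding l_def m_def by (simp only: add_eq_0_iff2)
    moreover have "l \<noteq> 0" using l by (simp add: l_def)
    ultimately have at: "a = of_real t * b" unfolding t_def by (simp add: field_simps)
    have "of_real (s\<^sup>2 * t\<^sup>2 + r\<^sup>2) * b\<^sup>2 = 0"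
      using q unfolding at by (simp add: algebra_simps power_mult_distrib)
    then have "s\<^sup>2 * t\<^sup>2 + r\<^sup>2 = 0" using b0 by (simp del: of_real_add of_real_mult of_real_power)
    moreover have "s\<^sup>2 * t\<^sup>2 + r\<^sup>2 > 0" using rs by (intro add_nonneg_pos) auto
    ultimately show False by simp
  qed
  then have "of_real (\<mu> - k) * b = 0" using lin by simp
  then have "\<mu> - k = 0" using b0 by (simp del: of_real_diff)
  with l0 have mk: "\<mu> = k" "1 - \<mu> = k" by auto
  have "r ^ 3 = 1" "s ^ 3 = 1"
  proof -
    have "k * r ^ 3 = k * 1" "k * s ^ 3 = k * 1" using k1 mk by linarith+
    then show "r ^ 3 = 1" "s ^ 3 = 1" using kp by (simp_all only: mult_cancel_left) auto
  qed
  then have "r = 1" "s = 1" using rs power_eq_1_iff[of r 3] power_eq_1_iff[of s 3] by (auto simp: power_eq_1_iff)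
  then have "a\<^sup>2 + b\<^sup>2 = 0" "norm (a * b) = 1" using q r_def s_def by (auto simp: norm_mult)
  moreover have "(a - b)\<^sup>2 = a\<^sup>2 + b\<^sup>2 - 2 * (a * b)" by (simp add: power2_eq_square algebra_simps)
  ultimately have "1 = - 2 * (a * b)" using ab by simp
  then have "norm (1::complex) = 2 * norm (a * b)" by (metis norm_minus_cancel norm_mult norm_numeral mult_minus_left)
  then show False using \<open>norm (a * b) = 1\<close> by simp
qed

text \<open>
  Near a zero of \<open>F\<close> that is a local minimum, \<open>F\<close> is approximated by a quadratic form; unless this
  form is isotropic (\<open>P = 0\<close>), the Laplacian of \<open>ln F\<close> has a nonzero homogeneous leading part of
  degree \<open>-2\<close>, which is not integrable in the plane.
\<close>

lemma log_singularity_lower_bound: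
  fixes F Rf :: "complex \<Rightarrow> real" and G :: "complex \<Rightarrow> complex"
  assumes S: "open S" "z0 \<in> S" and F: "\<And>z. z \<in> S \<Longrightarrow> rgrad F (G z) z"
    and G: "wirtinger G P (of_real (Rf z0)) z0" and Rf: "isCont Rf z0" and R: "Rf z0 > 0" and P: "P \<noteq> 0"
    and zero: "F z0 = 0" "G z0 = 0"
  obtains v c \<epsilon>\<^sub>0 \<delta> where "v \<noteq> 0" "c > 0" "\<epsilon>\<^sub>0 > 0" "\<delta> > 0"
    "\<And>\<epsilon> w. 0 < \<epsilon> \<Longrightarrow> \<epsilon> < \<epsilon>\<^sub>0 \<Longrightarrow> dist w v < \<delta> \<Longrightarrow> F (z0 + of_real \<epsilon> * w) > 0 \<and>
       c / \<epsilon>\<^sup>2 \<le> \<bar>Rf (z0 + of_real \<epsilon> * w) / (2 * F (z0 + of_real \<epsilon> * w)) - (norm (G (z0 + of_real \<epsilon> * w)))\<^sup>2 / (4 * (F (z0 + of_real \<epsilon> * w))\<^sup>2)\<bar>"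
proof -
  define R where "R = Rf z0"
  \<comment> \<open>This direction makes \<open>P * v\<^sup>2\<close> equal to the positive number
    \<open>(norm P)\<^sup>2\<close>. Both the quadratic form and its gradient then have explicit
    values at \<open>v\<close>, and the form is positive there.\<close>
  define v where "v = csqrt (cnj P)"
  have v2: "v\<^sup>2 = cnj P" by (simp add: v_def)
  have nv: "(norm v)\<^sup>2 = norm P" using arg_cong[OF v2, of norm] by (simp add: norm_power)
  have v0: "v \<noteq> 0" using P v2 by auto
  define p where "p = norm P"
  have p: "p > 0" using P by (simp add: p_def)
  have R0: "R > 0" using R by (simp add: R_def)
  have Pv: "P * v\<^sup>2 = of_real (p\<^sup>2)" unfolding v2 p_def by (rule complex_norm_square[symmetric])
  define q where "q h = 1 / 2 * (R * (norm h)\<^sup>2 + Re (P * h\<^sup>2))" for h :: complex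
  define L where "L h = P * h + of_real R * cnj h" for h
  have qv: "q v = p * (R + p) / 2" unfolding q_def nv Pv by (simp add: p_def power2_eq_square algebra_simps)
  have Lv: "(norm (L v))\<^sup>2 = p * (p + R)\<^sup>2"
  proof -
    have "L v * v = of_real (p * (p + R))"
    proof -
      have "L v * v = P * v\<^sup>2 + of_real R * (v * cnj v)" by (simp add: L_def power2_eq_square algebra_simps)
      also have "v * cnj v = of_real p" using complex_norm_square[of v] nv by (simp add: p_def)
      finally show ?thesis unfolding Pv by (simp add: power2_eq_square algebra_simps)
    qed
    then have "norm (L v * v) = p * (p + R)" using p R0 by (simp only: norm_of_real) simp
    then have "(norm (L v))\<^sup>2 * (norm v)\<^sup>2 = (p * (p + R))\<^sup>2" by (simp add: norm_mult flip: power_mult_distrib)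
    then have "(norm (L v))\<^sup>2 * p = (p * (p + R)\<^sup>2) * p" 
      unfolding nv p_def[symmetric] by (simp add: power2_eq_square mult_ac)
    then show ?thesis using p by simp
  qed
  \<comment> \<open>At \<open>h = 0\<close> the quotient is 0 by the convention on division, so the
    limit holds for \<open>nhds 0\<close>, and the point \<open>h = 0\<close> need not be excluded
    when \<open>h\<close> is replaced by a product.\<close>
  define err where "err h = norm (G (z0 + h) - L h) / norm h" for h
  have err0: "(err \<longlongrightarrow> 0) (nhds 0)"
  proof -
    have "((\<lambda>h. norm (G (z0 + h) - G z0 - L h) / norm h) \<longlongrightarrow> 0) (at 0)"
      using G unfolding has_derivative_at L_def R_def by simp
    then have "(err \<longlongrightarrow> 0) (at 0)" by (simp add: zero err_def[abs_def])
    then show ?thesis using tendsto_at_iff_tendsto_nhds[of err 0] by (simp add: err_def)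
  qed
  define Ferr where "Ferr h = \<bar>F (z0 + h) - q h\<bar> / (norm h)\<^sup>2" for h
  have Ferr0: "(Ferr \<longlongrightarrow> 0) (nhds 0)"
  proof (rule tendstoI)
    fix e :: real assume e: "e > 0"
    obtain s where s: "s > 0" "ball z0 s \<subseteq> S" using S openE by blast
    have "\<forall>\<^sub>F h in nhds 0. dist (err h) 0 < e / 2" using err0 e by (intro tendstoD) auto
    then obtain t where t: "t > 0" "\<And>h. dist h 0 < t \<Longrightarrow> dist (err h) 0 < e / 2"
      unfolding eventually_nhds_metric by blast
    have "dist (Ferr h) 0 < e" if h: "dist h 0 < min s t" for h
    proof -
      \<comment> \<open>The mean value inequality on the ball of radius \<open>norm h\<close>: the
        gradients of \<open>F\<close> and of its model \<open>q\<close> differ by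
        \<open>o(norm h)\<close>, hence the functions by \<open>o((norm h)\<^sup>2)\<close>. For
        this, differentiability of \<open>G\<close> at the single point \<open>z0\<close> is
        enough.\<close>
      have "norm ((F (z0 + h) - q h) - (F (z0 + 0) - q 0)) \<le> (e / 2 * norm h) * norm (h - 0)"
      proof (rule differentiable_bound[of "cball 0 (norm h)"])
        fix x :: complex assume x: "x \<in> cball 0 (norm h)"
        then have xs: "norm x < s" "norm x < t" using h by auto
        then have "z0 + x \<in> S" using s by (auto simp: dist_norm)
        then have Fx: "rgrad F (G (z0 + x)) (z0 + x)" by (rule F)
        have "((\<lambda>x. z0 + x) has_derivative (\<lambda>u. u)) (at x)" by (auto intro!: derivative_eq_intros)
        from has_derivative_compose[OF this, of F "\<lambda>u. Re (G (z0 + x) * u)"] Fx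
        have 1: "((\<lambda>x. F (z0 + x)) has_derivative (\<lambda>u. Re (G (z0 + x) * u))) (at x)" by simp
        have 2: "(q has_derivative (\<lambda>u. Re (L x * u))) (at x)"
        proof -
          have a: "((\<lambda>h. (norm h)\<^sup>2) has_derivative (\<lambda>u. Re (2 * cnj x * u))) (at x)" 
            using rgrad_norm_diff_sq[of 0 x] by simp
          have b: "((\<lambda>h. Re (P * h\<^sup>2)) has_derivative (\<lambda>u. Re (P * (2 * x * u)))) (at x)"
            by (auto intro!: derivative_eq_intros simp: power2_eq_square algebra_simps)
          show ?thesis unfolding q_def[abs_def]
            by (rule has_derivative_eq_rhs[OF has_derivative_mult_right[OF has_derivative_add[OF has_derivative_mult_right[OF a] b]]])
               (simp add: fun_eq_iff L_def algebra_simps)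
        qed
        show "((\<lambda>x. F (z0 + x) - q x) has_derivative (\<lambda>u. Re ((G (z0 + x) - L x) * u))) (at x within cball 0 (norm h))"
          by (rule has_derivative_at_withinI[OF has_derivative_eq_rhs[OF has_derivative_diff[OF 1 2]]])
             (simp add: left_diff_distrib)
        have nb: "norm (G (z0 + x) - L x) \<le> e / 2 * norm h"
        proof (cases "x = 0")
          case False
          have "err x < e / 2" using t(2)[of x] xs by simp
          then have "norm (G (z0 + x) - L x) \<le> e / 2 * norm x" using False by (simp add: err_def divide_less_eq less_imp_le)
          also have "\<dots> \<le> e / 2 * norm h" using x e by (intro mult_left_mono) auto
          finally show ?thesis .
        qed (use e in \<open>simp add: L_def zero\<close>)
        show "onorm (\<lambda>u. Re ((G (z0 + x) - L x) * u)) \<le> e / 2 * norm h"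
        proof (rule onorm_le)
          fix u
          have "norm (Re ((G (z0 + x) - L x) * u)) \<le> norm ((G (z0 + x) - L x) * u)" by (simp only: real_norm_def abs_Re_le_cmod)
          also have "\<dots> \<le> e / 2 * norm h * norm u" unfolding norm_mult by (intro mult_right_mono nb) auto
          finally show "norm (Re ((G (z0 + x) - L x) * u)) \<le> e / 2 * norm h * norm u" .
        qed
      qed auto
      then have "\<bar>F (z0 + h) - q h\<bar> \<le> e / 2 * (norm h)\<^sup>2" by (simp add: zero q_def power2_eq_square)
      then have "Ferr h \<le> e / 2" unfolding Ferr_def using e by (cases "h = 0") (auto simp: divide_le_eq)
      moreover have "0 \<le> Ferr h" by (simp add: Ferr_def)
      ultimately show ?thesis using e by (simp add: dist_real_def)
    qed
    then show "\<forall>\<^sub>F h in nhds 0. dist (Ferr h) 0 < e"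
      unfolding eventually_nhds_metric using s t by (intro exI[of _ "min s t"]) auto
  qed
  \<comment> \<open>Scale and direction vary together: the product filter yields estimates uniform
    in \<open>w\<close> near \<open>v\<close>, that is, on a truncated cone with apex
    \<open>z0\<close>.\<close>
  define Fi where "Fi = (at_right (0::real) \<times>\<^sub>F nhds v)"
  have fe: "filterlim fst (at_right 0) Fi" and fw: "filterlim snd (nhds v) Fi"
    unfolding Fi_def by (rule filterlim_fst, rule filterlim_snd)
  have fe0: "(fst \<longlongrightarrow> 0) Fi" using fe by (simp add: filterlim_at)
  have epos: "\<forall>\<^sub>F x in Fi. fst x > 0"
    using filterlim_iff[THEN iffD1, OF fe, rule_format, OF eventually_at_right_less] by simp
  have h0: "((\<lambda>x. of_real (fst x) * snd x) \<longlongrightarrow> 0) Fi"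
    using tendsto_mult[OF tendsto_of_real[OF fe0] fw] by simp
  note c1 = filterlim_compose[OF err0 h0] and c2 = filterlim_compose[OF Ferr0 h0]
  have Llim: "((\<lambda>x. L (snd x)) \<longlongrightarrow> L v) Fi" unfolding L_def by (intro tendsto_intros fw)
  have qlim: "((\<lambda>x. q (snd x)) \<longlongrightarrow> q v) Fi" unfolding q_def by (intro tendsto_intros fw)
  have limG: "((\<lambda>x. G (z0 + of_real (fst x) * snd x) /\<^sub>R fst x) \<longlongrightarrow> L v) Fi"
  proof -
    have "((\<lambda>x. G (z0 + of_real (fst x) * snd x) /\<^sub>R fst x - L (snd x)) \<longlongrightarrow> 0) Fi"
    proof (rule Lim_null_comparison)
      show "((\<lambda>x. err (of_real (fst x) * snd x) * norm (snd x)) \<longlongrightarrow> 0) Fi"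
        using tendsto_mult[OF c1 tendsto_norm[OF fw]] by simp
      show "\<forall>\<^sub>F x in Fi. norm (G (z0 + of_real (fst x) * snd x) /\<^sub>R fst x - L (snd x)) \<le> err (of_real (fst x) * snd x) * norm (snd x)"
        using epos
      proof eventually_elim
        case (elim x)
        obtain e w where x: "x = (e, w)" by force
        have e: "e > 0" using elim x by simp
        have "G (z0 + of_real e * w) /\<^sub>R e - L w = (G (z0 + of_real e * w) - L (of_real e * w)) /\<^sub>R e"
          using e by (simp add: L_def scaleR_conv_of_real algebra_simps)
        then have "norm (G (z0 + of_real e * w) /\<^sub>R e - L w) = norm (G (z0 + of_real e * w) - L (of_real e * w)) / e"
          using e by (simp add: divide_inverse mult.commute)
        also have "\<dots> = err (of_real e * w) * norm w"
          using e by (cases "w = 0") (auto simp: err_def norm_mult L_def zero)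
        finally show ?case by (simp add: x)
      qed
    qed
    from tendsto_add[OF this Llim] show ?thesis by simp
  qed
  have limF: "((\<lambda>x. F (z0 + of_real (fst x) * snd x) / (fst x)\<^sup>2) \<longlongrightarrow> q v) Fi"
  proof -
    have "((\<lambda>x. F (z0 + of_real (fst x) * snd x) / (fst x)\<^sup>2 - q (snd x)) \<longlongrightarrow> 0) Fi"
    proof (rule Lim_null_comparison)
      show "((\<lambda>x. Ferr (of_real (fst x) * snd x) * (norm (snd x))\<^sup>2) \<longlongrightarrow> 0) Fi"
        using tendsto_mult[OF c2 tendsto_power[OF tendsto_norm[OF fw]]] by simp
      show "\<forall>\<^sub>F x in Fi. norm (F (z0 + of_real (fst x) * snd x) / (fst x)\<^sup>2 - q (snd x)) \<le> Ferr (of_real (fst x) * snd x) * (norm (snd x))\<^sup>2"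
        using epos
      proof eventually_elim
        case (elim x)
        obtain e w where x: "x = (e, w)" by force
        have e: "e > 0" using elim x by simp
        have "q (of_real e * w) = e\<^sup>2 * q w"
        proof -
          have "P * (of_real e * w)\<^sup>2 = of_real (e\<^sup>2) * (P * w\<^sup>2)" by (simp add: power_mult_distrib)
          then have "Re (P * (of_real e * w)\<^sup>2) = e\<^sup>2 * Re (P * w\<^sup>2)" by (simp only: Re_complex_of_real Im_complex_of_real times_complex.sel)
          then show ?thesis unfolding q_def norm_mult power_mult_distrib norm_of_real by (simp add: algebra_simps)
        qed
        then have "F (z0 + of_real e * w) / e\<^sup>2 - q w = (F (z0 + of_real e * w) - q (of_real e * w)) / e\<^sup>2"
          using e by (simp add: field_simps)
        then have "norm (F (z0 + of_real e * w) / e\<^sup>2 - q w) = \<bar>F (z0 + of_real e * w) - q (of_real e * w)\<bar> / e\<^sup>2"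
          by simp
        also have "\<dots> = Ferr (of_real e * w) * (norm w)\<^sup>2"
          using e by (cases "w = 0") (auto simp: Ferr_def norm_mult power_mult_distrib q_def zero)
        finally show ?case by (simp add: x)
      qed
    qed
    from tendsto_add[OF this qlim] show ?thesis by simp
  qed
  have limR: "((\<lambda>x. Rf (z0 + of_real (fst x) * snd x)) \<longlongrightarrow> R) Fi"
  proof -
    have "((\<lambda>x. z0 + of_real (fst x) * snd x) \<longlongrightarrow> z0) Fi" using tendsto_add[OF tendsto_const h0] by simp
    from isCont_tendsto_compose[OF Rf this] show ?thesis by (simp add: R_def)
  qed
  have qp: "q v > 0" unfolding qv using p R0 by simp
  \<comment> \<open>The limit of the rescaled expression, \<open>\<epsilon>\<^sup>2\<close> times
    the bracket in the conclusion. It evaluates to \<open>- 1 / (R + p)\<close>.\<close>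
  define \<Lambda> where "\<Lambda> = R / (2 * q v) - (norm (L v))\<^sup>2 / (4 * (q v)\<^sup>2)"
  have "\<Lambda> = - 1 / (R + p)"
  proof -
    define m where "m = R + p"
    have m: "m > 0" using p R0 by (simp add: m_def)
    have "\<Lambda> = R / (2 * (p * m / 2)) - p * m\<^sup>2 / (4 * (p * m / 2)\<^sup>2)"
      unfolding \<Lambda>_def Lv qv m_def by (simp only: add.commute)
    also have "\<dots> = (R - m) / (p * m)" using p m by (simp add: field_simps power2_eq_square)
    also have "\<dots> = - 1 / m" using p m by (simp add: m_def)
    finally show ?thesis by (simp add: m_def)
  qed
  then have \<Lambda>: "\<Lambda> \<noteq> 0" using p R0 by simp
  have lim: "((\<lambda>x. Rf (z0 + of_real (fst x) * snd x) / (2 * (F (z0 + of_real (fst x) * snd x) / (fst x)\<^sup>2))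
     - (norm (G (z0 + of_real (fst x) * snd x) /\<^sub>R fst x))\<^sup>2 / (4 * (F (z0 + of_real (fst x) * snd x) / (fst x)\<^sup>2)\<^sup>2)) \<longlongrightarrow> \<Lambda>) Fi"
    unfolding \<Lambda>_def by (intro tendsto_intros limR limF limG) (use qp in auto)
  have "\<forall>\<^sub>F x in Fi. \<bar>\<Lambda>\<bar> / 2 < norm (Rf (z0 + of_real (fst x) * snd x) / (2 * (F (z0 + of_real (fst x) * snd x) / (fst x)\<^sup>2))
     - (norm (G (z0 + of_real (fst x) * snd x) /\<^sub>R fst x))\<^sup>2 / (4 * (F (z0 + of_real (fst x) * snd x) / (fst x)\<^sup>2)\<^sup>2))"
    using order_tendstoD(1)[OF tendsto_norm[OF lim], of "\<bar>\<Lambda>\<bar> / 2"] \<Lambda> by simp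
  then have "\<forall>\<^sub>F x in Fi. F (z0 + of_real (fst x) * snd x) > 0 \<and>
       (\<bar>\<Lambda>\<bar> / 2) / (fst x)\<^sup>2 \<le> \<bar>Rf (z0 + of_real (fst x) * snd x) / (2 * F (z0 + of_real (fst x) * snd x)) - (norm (G (z0 + of_real (fst x) * snd x)))\<^sup>2 / (4 * (F (z0 + of_real (fst x) * snd x))\<^sup>2)\<bar>"
    using order_tendstoD(1)[OF limF qp] epos
  proof eventually_elim
    case (elim x)
    define e f g h where "e = fst x" and "f = F (z0 + of_real (fst x) * snd x)" and "g = G (z0 + of_real (fst x) * snd x)"
      and "h = Rf (z0 + of_real (fst x) * snd x)"
    have e: "e > 0" and l: "\<bar>\<Lambda>\<bar> / 2 < \<bar>h / (2 * (f / e\<^sup>2)) - (norm (g /\<^sub>R e))\<^sup>2 / (4 * (f / e\<^sup>2)\<^sup>2)\<bar>" and "f / e\<^sup>2 > 0" 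
      using elim by (simp_all add: e_def f_def g_def h_def)
    then have f: "f > 0" by (simp add: zero_less_divide_iff)
    have "norm (g /\<^sub>R e) = norm g / e" using e by (simp add: divide_inverse mult.commute)
    then have "h / (2 * (f / e\<^sup>2)) - (norm (g /\<^sub>R e))\<^sup>2 / (4 * (f / e\<^sup>2)\<^sup>2) = e\<^sup>2 * (h / (2 * f) - (norm g)\<^sup>2 / (4 * f\<^sup>2))"
      using e f by (simp only:) (simp add: field_simps power2_eq_square)
    then have "\<bar>\<Lambda>\<bar> / 2 < e\<^sup>2 * \<bar>h / (2 * f) - (norm g)\<^sup>2 / (4 * f\<^sup>2)\<bar>"
      using l e by (simp add: abs_mult)
    then have "(\<bar>\<Lambda>\<bar> / 2) / e\<^sup>2 \<le> \<bar>h / (2 * f) - (norm g)\<^sup>2 / (4 * f\<^sup>2)\<bar>"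
      using e by (simp add: divide_le_eq mult.commute less_imp_le)
    then show ?case using f by (simp add: e_def f_def g_def h_def)
  qed
  then obtain P1 P2 where PP: "eventually P1 (at_right (0::real))" "eventually P2 (nhds v)"
    "\<And>e w. P1 e \<Longrightarrow> P2 w \<Longrightarrow> F (z0 + of_real e * w) > 0 \<and>
       (\<bar>\<Lambda>\<bar> / 2) / e\<^sup>2 \<le> \<bar>Rf (z0 + of_real e * w) / (2 * F (z0 + of_real e * w)) - (norm (G (z0 + of_real e * w)))\<^sup>2 / (4 * (F (z0 + of_real e * w))\<^sup>2)\<bar>"
    unfolding Fi_def eventually_prod_filter by auto
  obtain e0 where e0: "e0 > 0" "\<And>e. 0 < e \<Longrightarrow> e < e0 \<Longrightarrow> P1 e"
    using PP(1) unfolding eventually_at_right_field by auto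
  obtain d where d: "d > 0" "\<And>w. dist w v < d \<Longrightarrow> P2 w"
    using PP(2) unfolding eventually_nhds_metric by auto
  show ?thesis
    by (rule that[of v "\<bar>\<Lambda>\<bar> / 2" e0 d]) (use v0 \<Lambda> e0 d PP(3) in auto)
qed

text \<open>The balls of radius \<open>e k * d\<close> about \<open>z0 + e k * v\<close> each carry
  mass at least \<open>c * pi * d\<^sup>2\<close>, the area compensating the growth of
  \<open>f\<close>. They shrink towards \<open>z0\<close> and eventually leave every point, so
  dominated convergence would force these masses to 0.\<close>

lemma not_integrable_inverse_square:
  fixes f :: "complex \<Rightarrow> real"
  assumes int: "f absolutely_integrable_on D" and v: "v \<noteq> 0" and pos: "c > 0" "e0 > 0" "\<delta> > 0"
    and low: "\<And>e w. 0 < e \<Longrightarrow> e < e0 \<Longrightarrow> dist w v < \<delta> \<Longrightarrow> z0 + of_real e * w \<in> D \<and> c / e\<^sup>2 \<le> \<bar>f (z0 + of_real e * w)\<bar>"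
  shows False
proof -
  \<comment> \<open>A radius of at most \<open>norm v\<close> keeps \<open>z0\<close> out of all the
    balls.\<close>
  define d where "d = min \<delta> (norm v)"
  have d: "d > 0" "d \<le> \<delta>" "d \<le> norm v" using v pos by (auto simp: d_def)
  \<comment> \<open>The shift by 2 gives \<open>e k < e0\<close> also for
    \<open>k = 0\<close>.\<close>
  define e where "e k = e0 / real (k + 2)" for k
  have e: "0 < e k" "e k < e0" for k using pos by (auto simp: e_def divide_less_eq)
  have elim: "e \<longlonglongrightarrow> 0"
  proof -
    have "(\<lambda>k. e0 * inverse (real (Suc (Suc k)))) \<longlonglongrightarrow> e0 * 0"
      by (intro tendsto_mult tendsto_const LIMSEQ_Suc[OF LIMSEQ_inverse_real_of_nat])
    moreover have "e k = e0 * inverse (real (Suc (Suc k)))" for k by (simp add: e_def divide_inverse)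
    ultimately have "(\<lambda>k. e k) \<longlonglongrightarrow> 0" by (simp only: mult_zero_right)
    then show ?thesis .
  qed
  define b where "b k = ball (z0 + of_real (e k) * v) (e k * d)" for k
  have bD: "z \<in> D \<and> c / (e k)\<^sup>2 \<le> \<bar>f z\<bar>" if "z \<in> b k" for z k
  proof -
    define w where "w = (z - z0) / of_real (e k)"
    have z: "z = z0 + of_real (e k) * w" using e[of k] by (simp add: w_def)
    have "dist z (z0 + of_real (e k) * v) = e k * dist w v"
      unfolding z dist_norm using e[of k] by (simp add: norm_mult flip: right_diff_distrib)
    then have "e k * dist w v < e k * d" using that by (simp add: b_def dist_commute)
    then have "dist w v < \<delta>" using e(1)[of k] d by simp
    from low[OF e this] show ?thesis unfolding z by blast
  qed
  let ?g = "\<lambda>z. indicator D z * \<bar>f z\<bar>"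
  have ig: "integrable lebesgue ?g"
    using int unfolding absolutely_integrable_on_def set_integrable_def[symmetric]
    using set_integrable_norm[OF int] unfolding set_integrable_def by simp
  define s where "s k z = indicator (b k) z * ?g z" for k z
  have bm: "b k \<in> sets lebesgue" for k by (simp add: b_def)
  have ms: "s k \<in> borel_measurable lebesgue" for k
    unfolding s_def 
    by (rule borel_measurable_times[OF borel_measurable_indicator[OF bm] borel_measurable_integrable[OF ig]])
  have bs: "norm (s k z) \<le> ?g z" for k z by (auto simp: s_def indicator_def)
  have out: "z \<notin> b k" if "e k * (norm v + d) \<le> norm (z - z0)" for z k
  proof
    assume "z \<in> b k"
    then have "norm (z - z0 - of_real (e k) * v) < e k * d" by (simp add: b_def dist_norm norm_minus_commute diff_diff_eq)
    moreover have "norm (z - z0) \<le> norm (z - z0 - of_real (e k) * v) + norm (of_real (e k) * v)"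
      using norm_triangle_ineq[of "z - z0 - of_real (e k) * v" "of_real (e k) * v"] by simp
    moreover have "norm (of_real (e k) * v) = e k * norm v" using e(1)[of k] by (simp add: norm_mult)
    ultimately show False using that by (simp add: algebra_simps)
  qed
  have lims: "(\<lambda>k. s k z) \<longlonglongrightarrow> 0" for z
  proof (cases "z = z0")
    case True
    have "z0 \<notin> b k" for k using d e(1)[of k] by (auto simp: b_def dist_norm norm_mult)
    then show ?thesis by (simp add: s_def True)
  next
    case False
    have "(\<lambda>k. e k * (norm v + d)) \<longlonglongrightarrow> 0 * (norm v + d)" by (intro tendsto_intros elim)
    then have "\<forall>\<^sub>F k in sequentially. e k * (norm v + d) < norm (z - z0)"
      by (intro order_tendstoD) (use False in auto)
    then have "\<forall>\<^sub>F k in sequentially. 0 = s k z"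
      by eventually_elim (use out in \<open>simp add: s_def less_imp_le\<close>)
    then show ?thesis by (rule Lim_transform_eventually[OF tendsto_const])
  qed
  have int_s: "integrable lebesgue (s k)" for k
    by (rule Bochner_Integration.integrable_bound[OF ig ms]) (use order_trans[OF bs abs_ge_self] in auto)
  have "(\<lambda>k. \<integral>z. s k z \<partial>lebesgue) \<longlonglongrightarrow> (\<integral>z. 0 \<partial>(lebesgue :: complex measure))"
    by (rule integral_dominated_convergence[OF _ ms ig]) (use lims bs in auto)
  then have L: "(\<lambda>k. \<integral>z. s k z \<partial>lebesgue) \<longlonglongrightarrow> 0" by simp
  have lowint: "c * pi * d\<^sup>2 \<le> (\<integral>z. s k z \<partial>lebesgue)" for k
  proof -
    have ib: "integrable lebesgue (indicator (b k) :: complex \<Rightarrow> real)"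
      by (intro integrable_real_indicator bm) (simp add: b_def emeasure_lborel_ball_finite[unfolded infinity_ennreal_def])
    have "measure lebesgue (b k) = pi * (e k * d)\<^sup>2"
      using content_ball[of "e k * d" "z0 + of_real (e k) * v"] e(1)[of k] d by (simp add: b_def unit_ball_vol_2)
    then have "c * pi * d\<^sup>2 = (\<integral>z. c / (e k)\<^sup>2 * indicator (b k) z \<partial>lebesgue)"
      using e(1)[of k] by (simp add: power_mult_distrib)
    also have "\<dots> \<le> (\<integral>z. s k z \<partial>lebesgue)"
      by (rule integral_mono[OF integrable_mult_right[OF ib] int_s]) (use bD in \<open>auto simp: s_def indicator_def\<close>)
    finally show ?thesis .
  qed
  have "c * pi * d\<^sup>2 \<le> 0" by (rule LIMSEQ_le_const[OF L]) (use lowint in auto)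
  moreover have "c * pi * d\<^sup>2 > 0" using pos d by simp
  ultimately show False by simp
qed

text \<open>A zero in the open set \<open>D\<close> is a minimum, so the gradient vanishes there.
  Away from the centre \<open>phi'\<close> is nonzero, so the point lies over a critical point of
  \<open>omega\<close>, and anisotropy of the second derivative is inherited by the
  pullback.\<close>

lemma f_sq_positive_if_laplacian_integrable:
  assumes mu: "0 < \<mu>" "\<mu> < 1" and n: "n \<ge> 1"
    and D: "open D" "D \<subseteq> regular_set \<mu> n" "- of_real \<mu> \<notin> D"
    and nonneg: "\<And>z. z \<in> D \<Longrightarrow> f_sq \<mu> C n z \<ge> 0"
    and int: "laplacian (h_tilde \<mu> C n) absolutely_integrable_on D"
    and z0: "z0 \<in> D"
  shows "f_sq \<mu> C n z0 > 0"
proof (rule ccontr)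
  assume "\<not> f_sq \<mu> C n z0 > 0"
  then have zero: "f_sq \<mu> C n z0 = 0" using nonneg[OF z0] by simp
  have zr: "z0 \<in> regular_set \<mu> n" using z0 D by blast
  have u: "z0 + \<mu> \<noteq> 0" using z0 D(3) by (metis add_eq_0_iff2)
  have p': "phi' \<mu> n z0 \<noteq> 0" using u n by (simp add: phi'_def)
  obtain r where r: "r > 0" "ball z0 r \<subseteq> D" using D(1) z0 openE by blast
  have "(\<lambda>v. Re (f_sq_grad \<mu> n z0 * v)) = (\<lambda>v. 0)"
    by (rule differential_zero_maxmin[of z0 "ball z0 r", OF _ open_ball f_sq_rgrad[OF zr, of C]])
       (use r nonneg zero in \<open>auto simp: subset_iff\<close>)
  from fun_cong[OF this, of 1] fun_cong[OF this, of \<i>] have G0: "f_sq_grad \<mu> n z0 = 0"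
    by (auto simp: complex_eq_iff)
  then have og: "omega_grad \<mu> (phi \<mu> n z0) = 0" using p' by (simp add: f_sq_grad_def)
  have "omega_dd \<mu> (phi \<mu> n z0) \<noteq> 0"
    using critical_point_anisotropic[OF mu _ og] zr by (simp add: regular_set_def)
  then have P: "f_sq_dd \<mu> n z0 \<noteq> 0" using p' by (simp add: f_sq_dd_def og)
  have "omega_ddbar \<mu> (phi \<mu> n z0) > 0"
    unfolding omega_ddbar_def using mu by (intro add_pos_nonneg) auto
  then have R: "f_sq_ddbar \<mu> n z0 > 0" using p' by (simp add: f_sq_ddbar_def)
  have Rc: "isCont (f_sq_ddbar \<mu> n) z0"
    using continuous_f_sq_parts(4) open_regular_set zr by (simp add: continuous_on_eq_continuous_at)
  obtain v c e0 d where E: "v \<noteq> 0" "c > 0" "e0 > 0" "d > 0"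
    "\<And>e w. 0 < e \<Longrightarrow> e < e0 \<Longrightarrow> dist w v < d \<Longrightarrow> f_sq \<mu> C n (z0 + of_real e * w) > 0 \<and>
       c / e\<^sup>2 \<le> \<bar>f_sq_ddbar \<mu> n (z0 + of_real e * w) / (2 * f_sq \<mu> C n (z0 + of_real e * w)) 
         - (norm (f_sq_grad \<mu> n (z0 + of_real e * w)))\<^sup>2 / (4 * (f_sq \<mu> C n (z0 + of_real e * w))\<^sup>2)\<bar>"
    using log_singularity_lower_bound[OF open_regular_set zr f_sq_rgrad f_sq_grad_wirtinger[OF zr] Rc R P zero G0] by blast
  \<comment> \<open>The second bound keeps the truncated cone inside the ball of radius
    \<open>r\<close> about \<open>z0\<close>, and so inside \<open>D\<close>.\<close>
  define e1 where "e1 = min e0 (r / (norm v + d))"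
  have nvd: "norm v + d > 0" using E by (simp add: add_nonneg_pos)
  have "e1 > 0" using E r nvd by (simp add: e1_def)
  moreover have "z0 + of_real e * w \<in> D \<and> (2 * c) / e\<^sup>2 \<le> \<bar>laplacian (h_tilde \<mu> C n) (z0 + of_real e * w)\<bar>"
    if ew: "0 < e" "e < e1" "dist w v < d" for e w
  proof -
    have "norm w \<le> norm v + d" using ew(3) norm_triangle_ineq2[of w v] by (simp add: dist_norm)
    then have "norm (of_real e * w) \<le> e * (norm v + d)" using ew(1) by (simp add: norm_mult)
    also have "\<dots> < r" using ew(2) nvd by (simp add: e1_def pos_less_divide_eq)
    finally have "z0 + of_real e * w \<in> ball z0 r" by (simp add: dist_norm)
    then have inD: "z0 + of_real e * w \<in> D" using r by blast
    have "e < e0" using ew(2) by (simp add: e1_def)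
    from E(5)[OF ew(1) this ew(3)]
    have F: "f_sq \<mu> C n (z0 + of_real e * w) > 0" "c / e\<^sup>2 \<le> \<bar>h_ddbar \<mu> C n (z0 + of_real e * w)\<bar>"
      by (auto simp: h_ddbar_def)
    have "z0 + of_real e * w \<in> positive_set \<mu> C n" using inD D(2) F(1) by (auto simp: positive_set_def)
    from laplacian_h[OF this] F(2) inD show ?thesis by (simp add: abs_mult)
  qed
  ultimately show False
    by (intro not_integrable_inverse_square[OF int E(1), of "2 * c" e1 d z0]) (use E in auto)
qed

section \<open>The period formula\<close>

lemma has_vector_derivative_within_Un:
  assumes "(f has_vector_derivative D) (at x within A)" "(f has_vector_derivative D) (at x within B)"
  shows "(f has_vector_derivative D) (at x within (A \<union> B))"
  using assms unfolding has_vector_derivative_def has_derivative_within by (simp add: Lim_within_Un)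

lemma frac_extension_eq:
  fixes g :: "real \<Rightarrow> 'a"
  assumes "g 0 = g 1" "t \<in> {of_int k..of_int k + 1}"
  shows "g (frac t) = g (t - of_int k)"
proof (cases "t = of_int k + 1")
  case True
  then have "frac t = 0" by (simp add: frac_eq_0_iff)
  then show ?thesis using assms True by simp
next
  case False
  then have "frac t = t - of_int k" using assms(2) by (intro frac_unique_iff[THEN iffD2]) auto
  then show ?thesis by simp
qed

lemma frac_extension_continuous:
  fixes g :: "real \<Rightarrow> complex"
  assumes "continuous_on {0..1} g" "g 0 = g 1"
  shows "continuous_on UNIV (\<lambda>t. g (frac t))"
proof (intro continuous_at_imp_continuous_on ballI)
  fix t :: real
  have c: "continuous_on {of_int k..of_int k + 1} (\<lambda>t. g (frac t))" for k :: int
  proof (rule continuous_on_eq)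
    show "continuous_on {of_int k..of_int k + 1} (\<lambda>t. g (t - of_int k))"
      by (intro continuous_on_compose2[OF assms(1)] continuous_intros) auto
  qed (use frac_extension_eq[of g, OF assms(2)] in simp)
  define k where "k = \<lfloor>t\<rfloor>"
  have t: "of_int k \<le> t" "t < of_int k + 1" by (auto simp: k_def)
  have "continuous_on ({of_int (k - 1)..of_int (k - 1) + 1} \<union> {of_int k..of_int k + 1}) (\<lambda>t. g (frac t))"
    by (intro continuous_on_closed_Un c) auto
  moreover have "{of_int (k - 1)..of_int (k - 1) + 1} \<union> {of_int k..of_int k + 1} = {of_int k - 1..of_int k + 1 :: real}" by auto
  ultimately have "continuous_on {of_int k - 1..of_int k + 1} (\<lambda>t. g (frac t))" by simp
  moreover have "t \<in> interior {of_int k - 1..of_int k + 1}" using t by (simp add: interior_atLeastAtMost_real)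
  ultimately show "isCont (\<lambda>t. g (frac t)) t" by (rule continuous_on_interior)
qed

text \<open>At an integer the two adjacent unit intervals supply the one-sided derivatives
  \<open>g' 1\<close> and \<open>g' 0\<close>, whose equality makes the extension
  differentiable.\<close>

lemma frac_extension_derivative:
  fixes g :: "real \<Rightarrow> complex"
  assumes der: "\<And>t. t \<in> {0..1} \<Longrightarrow> (g has_vector_derivative g' t) (at t within {0..1})"
    and "g 0 = g 1" "g' 0 = g' 1"
  shows "((\<lambda>t. g (frac t)) has_vector_derivative g' (frac t)) (at t)"
proof -
  have c: "((\<lambda>t. g (frac t)) has_vector_derivative g' (frac x)) (at x within {of_int k..of_int k + 1})"
    if x: "x \<in> {of_int k..of_int k + 1}" for k :: int and x
  proof -
    have "((g \<circ> (\<lambda>t. t - of_int k)) has_vector_derivative 1 *\<^sub>R g' (x - of_int k)) (at x within {of_int k..of_int k + 1})"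
    proof (rule vector_diff_chain_within)
      have "(\<lambda>t::real. t - of_int k) ` {of_int k..of_int k + 1} = {0..1}"
        by (auto intro: image_eqI[of _ _ "_ + of_int k"])
      then show "(g has_vector_derivative g' (x - of_int k)) (at (x - of_int k) within (\<lambda>t. t - of_int k) ` {of_int k..of_int k + 1})"
        using der[of "x - of_int k"] x by simp
    qed (auto intro!: derivative_eq_intros)
    then have "((\<lambda>t. g (t - of_int k)) has_vector_derivative g' (frac x)) (at x within {of_int k..of_int k + 1})"
      using frac_extension_eq[of g', OF assms(3) x] by (simp add: o_def)
    then show ?thesis
      by (rule has_vector_derivative_transform[OF x, rotated]) (use frac_extension_eq[of g, OF assms(2)] in simp)
  qed
  define k where "k = \<lfloor>t\<rfloor>"
  have t: "of_int k \<le> t" "t < of_int k + 1" by (auto simp: k_def)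
  show ?thesis
  proof (cases "t = of_int k")
    case True
    have "((\<lambda>t. g (frac t)) has_vector_derivative g' (frac t)) (at t within {of_int (k - 1)..of_int (k - 1) + 1} \<union> {of_int k..of_int k + 1})"
      by (intro has_vector_derivative_within_Un c) (auto simp: True)
    moreover have "{of_int (k - 1)..of_int (k - 1) + 1} \<union> {of_int k..of_int k + 1} = {of_int k - 1..of_int k + 1 :: real}" by auto
    moreover have "at t within {of_int k - 1..of_int k + 1} = at t" using True by (intro at_within_Icc_at) auto
    ultimately show ?thesis by simp
  next
    case False
    then have "at t within {of_int k..of_int k + 1} = at t" using t by (intro at_within_Icc_at) auto
    then show ?thesis using c[of t k] t by simp
  qed
qed

text \<open>\<open>phi\<close> takes the value \<open>- \<mu>\<close> at the centre alone, so
  elsewhere the point added to \<open>U_region\<close> cannot be the image.\<close>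

lemma regular_nonneg:
  fixes z :: complex
  assumes "phi \<mu> n ` \<Omega> \<subseteq> U_region \<mu> C \<union> {- of_real \<mu>}" "z \<in> \<Omega> - {- of_real \<mu>}"
  shows "z \<in> regular_set \<mu> n" "f_sq \<mu> C n z \<ge> 0"
proof -
  have "(z + \<mu>) ^ n \<noteq> 0" using assms(2) by (simp add: add_eq_0_iff2)
  then have "phi \<mu> n z \<noteq> - of_real \<mu>" by (simp add: phi_def)
  then have "phi \<mu> n z \<in> U_region \<mu> C" using assms by blast
  then show "z \<in> regular_set \<mu> n" "f_sq \<mu> C n z \<ge> 0"
    by (auto simp: U_region_def regular_set_def f_sq_def)
qed

section \<open>The lifted periodic orbit\<close>

context
  fixes \<mu> C T :: real and n :: nat and \<alpha> \<beta> :: "real \<Rightarrow> complex"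
  assumes mu: "0 < \<mu>" "\<mu> \<le> 1 / 2" and n: "n \<ge> 1"
    and sol: "is_solution \<mu> \<alpha>" and jac: "has_jacobian_integral \<mu> \<alpha> C" 
    and per: "periodic_with T \<alpha>" and lift: "n_simple_with_lifting n (- of_real \<mu>) T \<alpha> \<beta>"
begin

lemma Tpos: "T > 0" using per by (simp add: periodic_with_def)

lemma alpha_derivative: "(\<alpha> has_vector_derivative velocity \<alpha> t) (at t)"
  using sol unfolding is_solution_def velocity_def by (simp add: vector_derivative_works)

lemma velocity_derivative: "(velocity \<alpha> has_vector_derivative velocity (velocity \<alpha>) t) (at t)"
  using sol unfolding is_solution_def velocity_def[of "velocity \<alpha>"] by (simp add: vector_derivative_works)

lemma alpha_regular: "\<alpha> t \<notin> primaries \<mu>"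
  using sol by (simp add: is_solution_def)

lemma acceleration: "velocity (velocity \<alpha>) t = cnj (omega_grad \<mu> (\<alpha> t)) - 2 * \<i> * velocity \<alpha> t"
proof -
  have "Re (velocity (velocity \<alpha>) t) = partial_deriv 1 (omega \<mu>) (\<alpha> t) + 2 * Im (velocity \<alpha> t)"
    "Im (velocity (velocity \<alpha>) t) = partial_deriv \<i> (omega \<mu>) (\<alpha> t) - 2 * Re (velocity \<alpha> t)"
    using sol by (auto simp: is_solution_def)
  then show ?thesis
    unfolding partial_deriv_rgrad[OF omega_rgrad[OF alpha_regular]] by (simp add: complex_eq_iff)
qed

lemma speed: "(norm (velocity \<alpha> t))\<^sup>2 = 2 * omega \<mu> (\<alpha> t) - C"
  using jac unfolding has_jacobian_integral_def cmod_power2 by (smt (verit))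

lemma velocity_continuous: "continuous_on S (velocity \<alpha>)" and alpha_continuous: "continuous_on S \<alpha>"
  using velocity_derivative alpha_derivative 
  by (meson continuous_at_imp_continuous_on has_vector_derivative_continuous)+

lemma velocity_periodic: "velocity \<alpha> (t + T) = velocity \<alpha> t"
proof -
  have "((\<alpha> \<circ> (\<lambda>t. t + T)) has_vector_derivative 1 *\<^sub>R velocity \<alpha> (t + T)) (at t)"
    by (rule vector_diff_chain_at) (auto intro!: derivative_eq_intros alpha_derivative)
  moreover have "\<alpha> \<circ> (\<lambda>t. t + T) = \<alpha>" using per by (auto simp: periodic_with_def)
  ultimately have "(\<alpha> has_vector_derivative velocity \<alpha> (t + T)) (at t)" by simp
  then show ?thesis using alpha_derivative vector_derivative_unique_at by blast
qed

lemma lift_phi: "t \<in> {0..T} \<Longrightarrow> phi \<mu> n (\<beta> t) = \<alpha> t"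
  using lift by (simp add: n_simple_with_lifting_def phi_def)

lemma center_inside: "- of_real \<mu> \<in> inside (\<beta> ` {0..T})"
  using lift by (simp add: n_simple_with_lifting_def enclosed_region_def)

text \<open>The definition of a lifting admits a corner at the closing point. It is excluded here:
  \<open>velocity \<alpha>\<close> is periodic and equals \<open>phi'\<close> times the derivative
  of \<open>\<beta>\<close>, and \<open>phi'\<close> is nonzero on the curve because the centre lies
  inside. The rescaled extension to the line is thus continuously differentiable.\<close>

lemma lifting_extension:
  obtains \<Gamma> \<Gamma>' where "periodic_C1_jordan_curve \<Gamma> \<Gamma>'" "\<And>s. s \<in> {0..1} \<Longrightarrow> \<Gamma> s = \<beta> (T * s)"
    "\<And>s. s \<in> {0..1} \<Longrightarrow> T * velocity \<alpha> (T * s) = phi' \<mu> n (\<Gamma> s) * \<Gamma>' s"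
proof -
  obtain \<beta>' where b: "\<beta> 0 = \<beta> T" "inj_on \<beta> {0..<T}" "continuous_on {0..T} \<beta>'"
    "\<And>t. t \<in> {0..T} \<Longrightarrow> (\<beta> has_vector_derivative \<beta>' t) (at t within {0..T})" "\<And>t. t \<in> {0..T} \<Longrightarrow> \<beta>' t \<noteq> 0"
    using lift unfolding n_simple_with_lifting_def simple_regular_closed_curve_def by blast
  have vel: "velocity \<alpha> t = phi' \<mu> n (\<beta> t) * \<beta>' t" if t: "t \<in> {0..T}" for t
  proof -
    have "((phi \<mu> n \<circ> \<beta>) has_vector_derivative \<beta>' t * phi' \<mu> n (\<beta> t)) (at t within {0..T})"
      by (rule field_vector_diff_chain_within[OF b(4)[OF t]]) (rule has_field_derivative_at_within[OF phi_deriv])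
    then have "(\<alpha> has_vector_derivative \<beta>' t * phi' \<mu> n (\<beta> t)) (at t within {0..T})"
      by (rule has_vector_derivative_transform[OF t, rotated]) (use lift_phi in auto)
    moreover have "(\<alpha> has_vector_derivative velocity \<alpha> t) (at t within {0..T})"
      by (rule has_vector_derivative_at_within[OF alpha_derivative])
    ultimately have "\<beta>' t * phi' \<mu> n (\<beta> t) = velocity \<alpha> t"
      using t Tpos by (intro vector_derivative_unique_within[of t "{0..T}"]) (auto simp: trivial_limit_within islimpt_Icc)
    then show ?thesis by (simp add: mult.commute)
  qed
  have pb: "phi' \<mu> n (\<beta> t) \<noteq> 0" if "t \<in> {0..T}" for t
  proof -
    have "\<beta> t \<noteq> - of_real \<mu>" using center_inside inside_no_overlap[of "\<beta> ` {0..T}"] that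
      by (metis disjoint_iff imageI)
    then show ?thesis using n by (simp add: phi'_def add_eq_0_iff2)
  qed
  have "\<beta>' 0 = \<beta>' T"
    using vel[of 0] vel[of T] velocity_periodic[of 0] b(1) pb[of 0] Tpos by simp
  define g g' where "g s = \<beta> (T * s)" and "g' s = T * \<beta>' (T * s)" for s
  have g01: "g 0 = g 1" "g' 0 = g' 1" using b(1) \<open>\<beta>' 0 = \<beta>' T\<close> by (simp_all add: g_def g'_def)
  have rng: "T * s \<in> {0..T}" if "s \<in> {0..1}" for s using that Tpos by (auto simp: mult_le_cancel_left1)
  have gd: "(g has_vector_derivative g' s) (at s within {0..1})" if s: "s \<in> {0..1}" for s
  proof -
    have im: "(*) T ` {0..1} = {0..T}" using Tpos by (simp add: image_mult_atLeastAtMost)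
    have "((\<beta> \<circ> (*) T) has_vector_derivative T *\<^sub>R \<beta>' (T * s)) (at s within {0..1})"
      by (rule vector_diff_chain_within)
         (use b(4)[OF rng[OF s]] in \<open>auto intro!: derivative_eq_intros simp: im\<close>)
    then show ?thesis by (simp add: o_def g_def[abs_def] g'_def scaleR_conv_of_real)
  qed
  have g'c: "continuous_on {0..1} g'"
    unfolding g'_def using rng by (intro continuous_intros continuous_on_compose2[OF b(3)]) auto
  define \<Gamma> \<Gamma>' where "\<Gamma> t = g (frac t)" and "\<Gamma>' t = g' (frac t)" for t
  have fr: "frac t \<in> {0..<1}" for t :: real using frac_ge_0 frac_lt_1 by auto
  have eq: "\<Gamma> s = g s" "\<Gamma>' s = g' s" if "s \<in> {0..1}" for s
    using frac_extension_eq[of g s 0] frac_extension_eq[of g' s 0] that g01 by (simp_all add: \<Gamma>_def \<Gamma>'_def)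
  show ?thesis
  proof (rule that[of \<Gamma> \<Gamma>'])
    show "periodic_C1_jordan_curve \<Gamma> \<Gamma>'"
    proof
      fix t
      show "(\<Gamma> has_vector_derivative \<Gamma>' t) (at t)"
        unfolding \<Gamma>_def[abs_def] \<Gamma>'_def by (rule frac_extension_derivative[OF gd g01])
      show "continuous_on UNIV \<Gamma>'" unfolding \<Gamma>'_def by (rule frac_extension_continuous[OF g'c g01(2)])
      show "\<Gamma> (t + 1) = \<Gamma> t" "\<Gamma>' (t + 1) = \<Gamma>' t"
        by (simp_all add: \<Gamma>_def \<Gamma>'_def frac_def)
      show "\<Gamma>' t \<noteq> 0"
        using b(5)[OF rng[of "frac t"]] fr[of t] Tpos by (simp add: \<Gamma>'_def g'_def)
    next
      fix s t assume "\<Gamma> s = \<Gamma> t"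
      then have "\<beta> (T * frac s) = \<beta> (T * frac t)" by (simp add: \<Gamma>_def g_def)
      moreover have "T * frac x \<in> {0..<T}" for x using fr[of x] Tpos by (simp add: mult_less_cancel_left1)
      ultimately have "T * frac s = T * frac t" using b(2) by (meson inj_onD)
      then have "frac s = frac t" using Tpos by simp
      then have "t - s = of_int (\<lfloor>t\<rfloor> - \<lfloor>s\<rfloor>)" by (simp add: frac_def algebra_simps)
      then show "t - s \<in> \<int>" by (metis Ints_of_int)
    qed
    show "\<Gamma> s = \<beta> (T * s)" if "s \<in> {0..1}" for s using eq(1)[OF that] by (simp add: g_def)
    show "T * velocity \<alpha> (T * s) = phi' \<mu> n (\<Gamma> s) * \<Gamma>' s" if "s \<in> {0..1}" for s
      using vel[OF rng[OF that]] eq[OF that] by (simp add: g_def g'_def)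
  qed
qed

lemma path_image_eq:
  assumes "\<And>s. s \<in> {0..1} \<Longrightarrow> \<Gamma> s = \<beta> (T * s)"
  shows "path_image \<Gamma> = \<beta> ` {0..T}"
proof -
  have "path_image \<Gamma> = (\<lambda>s. \<beta> (T * s)) ` {0..1}"
    unfolding path_image_def using assms by (intro image_cong) auto
  also have "\<dots> = \<beta> ` (*) T ` {0..1}" by (simp add: image_image)
  also have "(*) T ` {0..1} = {0..T}" using Tpos by (simp add: image_mult_atLeastAtMost)
  finally show ?thesis .
qed

text \<open>Regularity of the lifting prevents the velocity from vanishing, so the orbit never
  touches the zero velocity set and \<open>h_tilde\<close> is smooth near the whole curve.\<close>

lemma curve_positive:
  assumes curve: "periodic_C1_jordan_curve \<Gamma> \<Gamma>'" and lifted: "\<And>s. s \<in> {0..1} \<Longrightarrow> \<Gamma> s = \<beta> (T * s)"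
    and vel: "\<And>s. s \<in> {0..1} \<Longrightarrow> T * velocity \<alpha> (T * s) = phi' \<mu> n (\<Gamma> s) * \<Gamma>' s"
    and s: "s \<in> {0..1}"
  shows "phi \<mu> n (\<Gamma> s) = \<alpha> (T * s)" "\<Gamma> s \<noteq> - of_real \<mu>" "velocity \<alpha> (T * s) \<noteq> 0" 
    "f_sq \<mu> C n (\<Gamma> s) = (norm (velocity \<alpha> (T * s)))\<^sup>2" "\<Gamma> s \<in> positive_set \<mu> C n"
proof -
  interpret periodic_C1_jordan_curve \<Gamma> \<Gamma>' by (rule curve)
  have ts: "T * s \<in> {0..T}" using s Tpos by (auto simp: mult_le_cancel_left1)
  show p: "phi \<mu> n (\<Gamma> s) = \<alpha> (T * s)" using lift_phi[OF ts] lifted[OF s] by simp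
  show c: "\<Gamma> s \<noteq> - of_real \<mu>" 
    using center_inside inside_no_overlap[of "\<beta> ` {0..T}"] ts lifted[OF s] by (metis disjoint_iff imageI)
  then have "phi' \<mu> n (\<Gamma> s) \<noteq> 0" using n by (simp add: phi'_def add_eq_0_iff2)
  then show v: "velocity \<alpha> (T * s) \<noteq> 0" using vel[OF s] nz[of s] Tpos by auto
  show F: "f_sq \<mu> C n (\<Gamma> s) = (norm (velocity \<alpha> (T * s)))\<^sup>2"
    by (simp add: f_sq_def p speed)
  show "\<Gamma> s \<in> positive_set \<mu> C n"
    unfolding positive_set_def regular_set_def using F v p alpha_regular by simp
qed

text \<open>Up to a constant, a logarithm of the velocity is \<open>n - 1\<close> times one of
  \<open>\<Gamma> + \<mu>\<close> plus one of \<open>\<Gamma>'\<close>, and each of the two gains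
  \<open>2 * pi * \<i> * \<sigma>\<close> over a period. The Coriolis force contributes the constant
  \<open>- 2 * \<i>\<close> to the logarithmic derivative of the velocity; this is how
  \<open>T\<close> appears.\<close>

lemma turning_identity:
  assumes curve: "periodic_C1_jordan_curve \<Gamma> \<Gamma>'" and lifted: "\<And>s. s \<in> {0..1} \<Longrightarrow> \<Gamma> s = \<beta> (T * s)"
    and vel: "\<And>s. s \<in> {0..1} \<Longrightarrow> T * velocity \<alpha> (T * s) = phi' \<mu> n (\<Gamma> s) * \<Gamma>' s"
    and wn: "\<And>z. z \<in> inside (path_image \<Gamma>) \<Longrightarrow> winding_number \<Gamma> z = of_real \<sigma>"
  shows "contour_integral \<Gamma> (h_grad \<mu> C n) = - 2 * pi * \<i> * of_nat n * of_real \<sigma> - 2 * \<i> * of_real T"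
proof -
  interpret periodic_C1_jordan_curve \<Gamma> \<Gamma>' by (rule curve)
  note pos = curve_positive[OF curve lifted vel]
  define A where "A s = velocity \<alpha> (T * s)" for s
  define A' where "A' s = of_real T * velocity (velocity \<alpha>) (T * s)" for s
  have dA: "(A has_vector_derivative A' s) (at s within {0..1})" for s
  proof -
    have "((velocity \<alpha> \<circ> (*) T) has_vector_derivative T *\<^sub>R velocity (velocity \<alpha>) (T * s)) (at s)"
      by (rule vector_diff_chain_at) (auto intro!: derivative_eq_intros velocity_derivative)
    then show ?thesis by (simp add: A_def[abs_def] A'_def o_def scaleR_conv_of_real has_vector_derivative_at_within)
  qed
  have cT: "continuous_on S (\<lambda>s. f (T * s))" if "continuous_on UNIV f" for S and f :: "real \<Rightarrow> complex"
    by (intro continuous_on_compose2[OF that] continuous_intros) auto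
  have cA: "continuous_on S A" for S unfolding A_def by (intro cT velocity_continuous)
  have cA': "continuous_on {0..1} A'"
  proof -
    have "continuous_on {0..1} (\<lambda>s. omega_grad \<mu> (\<alpha> (T * s)))"
      using alpha_regular by (intro continuous_on_compose2[OF continuous_omega_parts(2) cT[OF alpha_continuous]]) auto
    moreover have "continuous_on {0..1} (\<lambda>s. velocity \<alpha> (T * s))" by (rule cT[OF velocity_continuous])
    ultimately show ?thesis unfolding A'_def acceleration by (intro continuous_intros)
  qed
  have A0: "A s \<noteq> 0" if "s \<in> {0..1}" for s using pos(3)[OF _ _ that] by (simp add: A_def)
  have pA: "0 \<notin> path_image A" using A0 by (auto simp: path_image_def)
  have vA: "valid_path A" by (rule C1_path_valid[OF dA cA'])
  have cinv: "continuous_on (path_image A) (\<lambda>w. 1 / (w - 0))"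
    using pA by (intro continuous_intros) auto
  have "integral {0..1} (\<lambda>s. 1 / (A s - 0) * A' s) = 2 * pi * \<i> * winding_number A 0"
    using C1_contour_integral(2)[OF dA cA' cinv] winding_number_valid_path[OF vA pA] by simp
  moreover have ci: "continuous_on {0..1} (\<lambda>s. A' s / A s)"
    by (intro continuous_intros cA cA') (use A0 in auto)
  ultimately have hi: "((\<lambda>s. A' s / A s) has_integral 2 * pi * \<i> * winding_number A 0) {0..1}"
    using integrable_continuous_real[OF ci] by (simp add: has_integral_iff)
  obtain q where q: "path q" "pathfinish q - pathstart q = 2 * of_real pi * \<i> * winding_number A 0"
    "\<And>t. t \<in> {0..1} \<Longrightarrow> A t = 0 + exp (q t)"
    using winding_number_as_continuous_log[OF valid_path_imp_path[OF vA] pA] by blast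
  have log_ex: "\<exists>g. continuous_on UNIV g \<and> (\<forall>t. f t = exp (g t))" 
    if "continuous_on UNIV f" "\<And>t. f t \<noteq> 0" for f :: "real \<Rightarrow> complex"
    by (rule continuous_logarithm_on_contractible[OF that(1) convex_imp_contractible[OF convex_UNIV]]) (use that(2) in auto)
  have cnr: "- of_real \<mu> \<notin> range \<Gamma>"
  proof -
    have "- of_real \<mu> \<notin> \<beta> ` {0..T}" using center_inside inside_no_overlap by (metis disjoint_iff)
    moreover have "path_image \<Gamma> = \<beta> ` {0..T}" by (rule path_image_eq[OF lifted])
    ultimately show ?thesis by (simp add: range_eq)
  qed
  obtain m where m: "continuous_on UNIV m" "\<And>t. \<Gamma> t - (- of_real \<mu>) = exp (m t)"
  proof -
    have "continuous_on UNIV (\<lambda>t. \<Gamma> t - (- of_real \<mu>))" by (intro continuous_intros cont)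
    moreover have "\<Gamma> t - (- of_real \<mu>) \<noteq> 0" for t using cnr by (metis eq_iff_diff_eq_0 rangeI)
    ultimately show ?thesis using log_ex that by blast
  qed
  obtain l where l: "continuous_on UNIV l" "\<And>t. \<Gamma>' t = exp (l t)"
    using log_ex[OF cont' nz] by blast
  have m1: "m (0 + 1) - m 0 = 2 * pi * \<i> * winding_number \<Gamma> (- of_real \<mu>)"
    by (rule log_increment[OF cnr]) (use m in \<open>auto intro: continuous_on_subset\<close>)
  have l1: "l (0 + 1) - l 0 = 2 * pi * \<i> * of_real \<sigma>"
    by (rule umlaufsatz[OF wn l(1)]) (use l in auto)
  have wc: "winding_number \<Gamma> (- of_real \<mu>) = of_real \<sigma>"
    using wn center_inside path_image_eq[OF lifted] by simp
  have "q 1 - q 0 = (of_nat (n - 1) * m 1 + l 1) - (of_nat (n - 1) * m 0 + l 0)"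
  proof (rule continuous_logs_differ_by_constant[of "{0..1}" q "\<lambda>t. of_nat (n - 1) * m t + l t" "of_nat n / of_real T"])
    show "continuous_on {0..1} (\<lambda>t. of_nat (n - 1) * m t + l t)"
      by (intro continuous_intros continuous_on_subset[OF m(1)] continuous_on_subset[OF l(1)]) auto
    show "exp (q t) = of_nat n / of_real T * exp (of_nat (n - 1) * m t + l t)" if t: "t \<in> {0..1}" for t
    proof -
      have "of_real T * A t = of_nat n * (\<Gamma> t + of_real \<mu>) ^ (n - 1) * \<Gamma>' t"
        using vel[OF t] by (simp add: A_def phi'_def)
      also have "\<Gamma> t + of_real \<mu> = exp (m t)" using m(2)[of t] by simp
      also have "\<Gamma>' t = exp (l t)" by (rule l(2))
      finally have "of_real T * exp (q t) = of_nat n * exp (of_nat (n - 1) * m t + l t)"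
        using q(3)[OF t] by (simp add: exp_add exp_of_nat_mult)
      then show ?thesis using Tpos by (simp add: field_simps)
    qed
  qed (use q n Tpos in \<open>auto simp: path_def\<close>)
  also have "\<dots> = of_nat (n - 1) * (m 1 - m 0) + (l 1 - l 0)" by (simp add: algebra_simps)
  also have "\<dots> = (of_nat (n - 1) + 1) * (2 * pi * \<i> * of_real \<sigma>)" using m1 l1 wc by (simp add: algebra_simps)
  also have "of_nat (n - 1) + 1 = (of_nat n :: complex)" using n by (simp add: of_nat_diff)
  finally have "2 * of_real pi * \<i> * winding_number A 0 = of_nat n * (2 * pi * \<i> * of_real \<sigma>)"
    using q(2) by (simp add: pathfinish_def pathstart_def)
  with hi have hi2: "((\<lambda>s. A' s / A s) has_integral of_nat n * (2 * pi * \<i> * of_real \<sigma>)) {0..1}" by simp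
  \<comment> \<open>The acceleration contains \<open>cnj (omega_grad ...)\<close>, while
    \<open>h_grad\<close> contains \<open>omega_grad\<close> itself and, on the curve, the
    denominator \<open>v * cnj v\<close>. Conjugating makes the two integrands match.\<close>
  from has_integral_linear[OF hi2 bounded_linear_cnj]
  have hi3: "((\<lambda>s. cnj (A' s / A s)) has_integral cnj (of_nat n * (2 * pi * \<i> * of_real \<sigma>))) {0..1}"
    by (simp add: o_def)
  have "((\<lambda>s::real. 2 * \<i> * of_real T :: complex) has_integral 2 * \<i> * of_real T) {0..1}"
    using has_integral_const_real[of "2 * \<i> * of_real T" 0 1] by simp
  from has_integral_diff[OF hi3 this]
  have hi4: "((\<lambda>s. cnj (A' s / A s) - 2 * \<i> * of_real T) has_integral
      cnj (of_nat n * (2 * pi * \<i> * of_real \<sigma>)) - 2 * \<i> * of_real T) {0..1}" .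
  have "((\<lambda>s. h_grad \<mu> C n (\<Gamma> s) * \<Gamma>' s) has_integral
      cnj (of_nat n * (2 * pi * \<i> * of_real \<sigma>)) - 2 * \<i> * of_real T) {0..1}"
  proof (rule has_integral_eq[OF _ hi4])
    fix s :: real assume s: "s \<in> {0..1}"
    define g v where "g = omega_grad \<mu> (\<alpha> (T * s))" and "v = velocity \<alpha> (T * s)"
    note ps = pos[OF _ _ s]
    have v: "v \<noteq> 0" using ps(3) by (simp add: v_def)
    have vel': "phi' \<mu> n (\<Gamma> s) * \<Gamma>' s = of_real T * v" using vel[OF s] by (simp add: v_def)
    have FF: "complex_of_real (f_sq \<mu> C n (\<Gamma> s)) = v * cnj v"
      using ps(4) complex_norm_square[of v] by (simp add: v_def)
    have "h_grad \<mu> C n (\<Gamma> s) * \<Gamma>' s = g * (phi' \<mu> n (\<Gamma> s) * \<Gamma>' s) / of_real (f_sq \<mu> C n (\<Gamma> s))"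
      using ps(1) by (simp add: h_grad_def f_sq_grad_def g_def)
    also have "\<dots> = of_real T * g / cnj v" unfolding vel' FF using v by simp
    finally have 1: "h_grad \<mu> C n (\<Gamma> s) * \<Gamma>' s = of_real T * g / cnj v" .
    have "A' s / A s = of_real T * cnj g / v - 2 * \<i> * of_real T"
      unfolding A_def A'_def acceleration g_def[symmetric] v_def[symmetric] using v by (simp add: field_simps)
    then have "cnj (A' s / A s) = of_real T * g / cnj v + 2 * \<i> * of_real T" by simp
    then show "cnj (A' s / A s) - 2 * \<i> * of_real T = h_grad \<mu> C n (\<Gamma> s) * \<Gamma>' s" using 1 by simp
  qed
  moreover have "contour_integral \<Gamma> (h_grad \<mu> C n) = integral {0..1} (\<lambda>s. h_grad \<mu> C n (\<Gamma> s) * \<Gamma>' s)"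
  proof (rule C1_contour_integral(2))
    show "continuous_on (path_image \<Gamma>) (h_grad \<mu> C n)"
      by (rule continuous_on_subset[OF continuous_h_parts(1)]) (use pos(5) in \<open>auto simp: path_image_def\<close>)
  qed (auto intro: has_vector_derivative_at_within[OF der] continuous_on_subset[OF cont'])
  ultimately show ?thesis by (simp add: integral_unique algebra_simps)
qed

text \<open>The contour integral of \<open>G\<close> is evaluated twice. Turning gives
  \<open>- 2 * pi * \<i> * n * \<sigma> - 2 * \<i> * T\<close> and the added pole gives
  \<open>pi * \<i> * n * \<sigma>\<close>; Green's theorem gives \<open>\<i> * \<sigma>\<close>
  times the integral of the Laplacian.\<close>

lemma period_formula:
  fixes \<sigma> :: real
  defines "\<Omega> \<equiv> inside (\<beta> ` {0..T})"
  assumes orient: "\<And>z. z \<in> \<Omega> \<Longrightarrow> winding_number (\<lambda>s. \<beta> (T * s)) z = of_real \<sigma>"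
    and D: "\<Omega> - {- of_real \<mu>} \<subseteq> positive_set \<mu> C n"
    and int: "laplacian (h_tilde \<mu> C n) absolutely_integrable_on (\<Omega> - {- of_real \<mu>})"
  shows "2 * T = - \<sigma> * (real n * pi + integral (\<Omega> - {- of_real \<mu>}) (laplacian (h_tilde \<mu> C n)))"
proof -
  obtain \<Gamma> \<Gamma>' where curve: "periodic_C1_jordan_curve \<Gamma> \<Gamma>'" and lifted: "\<And>s. s \<in> {0..1} \<Longrightarrow> \<Gamma> s = \<beta> (T * s)"
    and vel: "\<And>s. s \<in> {0..1} \<Longrightarrow> T * velocity \<alpha> (T * s) = phi' \<mu> n (\<Gamma> s) * \<Gamma>' s"
    using lifting_extension by blast
  interpret periodic_C1_jordan_curve \<Gamma> \<Gamma>' by (rule curve)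
  note pos = curve_positive[OF curve lifted vel]
  define p where "p = - complex_of_real \<mu>"
  have im: "path_image \<Gamma> = \<beta> ` {0..T}" by (rule path_image_eq[OF lifted])
  then have Om: "\<Omega> = inside (path_image \<Gamma>)" by (simp add: \<Omega>_def)
  have wn: "winding_number \<Gamma> z = of_real \<sigma>" if "z \<in> inside (path_image \<Gamma>)" for z
    using orient[of z] winding_number_cong[of \<Gamma> "\<lambda>s. \<beta> (T * s)" z] lifted that Om by simp
  have pin: "p \<in> inside (path_image \<Gamma>)" using center_inside im by (simp add: p_def)
  then have pni: "p \<notin> path_image \<Gamma>" using inside_no_overlap by blast
  have op: "open \<Omega>" unfolding Om by (simp add: open_inside closed_path_image path)
  have der01: "(\<Gamma> has_vector_derivative \<Gamma>' t) (at t within {0..1})" for t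
    by (rule has_vector_derivative_at_within[OF der])
  have c01: "continuous_on {0..1} \<Gamma>'" by (rule continuous_on_subset[OF cont']) simp
  \<comment> \<open>The added term is holomorphic off \<open>p\<close>, so it does not affect the
    Laplacian, and by \<open>h_grad_near\<close> it cancels the pole.\<close>
  define G where "G z = h_grad \<mu> C n z + of_nat n / 2 * (1 / (z - p))" for z
  \<comment> \<open>Adding \<open>\<Omega>\<close> restores the centre, which
    \<open>positive_set\<close> omits.\<close>
  define U where "U = positive_set \<mu> C n \<union> \<Omega>"
  have Up: "U - {p} \<subseteq> positive_set \<mu> C n" using D by (auto simp: U_def p_def)
  let ?R = "\<lambda>z. complex_of_real (h_ddbar \<mu> C n z)"
  have Dm: "\<Omega> - {p} \<in> sets borel" using op by (intro borel_open) (simp add: open_delete)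
  have lap: "laplacian (h_tilde \<mu> C n) z = 2 * h_ddbar \<mu> C n z" if "z \<in> \<Omega> - {p}" for z
    using that D by (intro laplacian_h) (auto simp: p_def)
  \<comment> \<open>Absolute integrability refers to the completed measure; Borel measurability of
    the continuous representative carries it over to \<open>lborel\<close>, where Green's theorem is
    stated.\<close>
  have int1: "set_integrable lborel (\<Omega> - {p}) (\<lambda>z. 2 * h_ddbar \<mu> C n z)"
  proof -
    have "(\<lambda>z. indicator (\<Omega> - {p}) z *\<^sub>R laplacian (h_tilde \<mu> C n) z) = (\<lambda>z. indicator (\<Omega> - {p}) z *\<^sub>R (2 * h_ddbar \<mu> C n z))"
      using lap by (auto simp: indicator_def fun_eq_iff)
    then have "integrable lebesgue (\<lambda>z. indicator (\<Omega> - {p}) z *\<^sub>R (2 * h_ddbar \<mu> C n z))"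
      using int by (simp add: set_integrable_def p_def)
    moreover have "(\<lambda>z. indicator (\<Omega> - {p}) z *\<^sub>R (2 * h_ddbar \<mu> C n z)) \<in> borel_measurable lborel"
    proof -
      have "continuous_on (\<Omega> - {p}) (\<lambda>z. 2 * h_ddbar \<mu> C n z)"
        by (intro continuous_intros continuous_on_subset[OF continuous_h_parts(3)]) (use D in \<open>auto simp: p_def\<close>)
      from borel_measurable_continuous_on_indicator[OF Dm this] show ?thesis by simp
    qed
    ultimately show ?thesis unfolding set_integrable_def by (simp only: integrable_completion)
  qed
  have I: "integral (\<Omega> - {p}) (laplacian (h_tilde \<mu> C n)) = (\<integral>z. indicator (\<Omega> - {p}) z *\<^sub>R (2 * h_ddbar \<mu> C n z) \<partial>lborel)"
  proof -
    have "integral (\<Omega> - {p}) (laplacian (h_tilde \<mu> C n)) = integral (\<Omega> - {p}) (\<lambda>z. 2 * h_ddbar \<mu> C n z)"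
      by (rule Henstock_Kurzweil_Integration.integral_cong) (rule lap)
    also have "\<dots> = (\<integral>z. indicator (\<Omega> - {p}) z *\<^sub>R (2 * h_ddbar \<mu> C n z) \<partial>lborel)"
      using set_borel_integral_eq_integral(2)[OF int1] unfolding set_lebesgue_integral_def by (rule sym)
    finally show ?thesis .
  qed
  have int2: "integrable lborel (\<lambda>z. indicator (\<Omega> - {p}) z *\<^sub>R h_ddbar \<mu> C n z)"
    using integrable_mult_right[of "1 / 2", OF int1[unfolded set_integrable_def]] by simp
  have eqR: "indicator (\<Omega> - {p}) z *\<^sub>R ?R z = of_real (indicator (\<Omega> - {p}) z *\<^sub>R h_ddbar \<mu> C n z)" for z
    by (simp add: scaleR_conv_of_real)
  have IR: "(\<integral>z. indicator (\<Omega> - {p}) z *\<^sub>R ?R z \<partial>lborel) = of_real (integral (\<Omega> - {p}) (laplacian (h_tilde \<mu> C n)) / 2)"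
  proof -
    have "(\<integral>z. indicator (\<Omega> - {p}) z *\<^sub>R (2 * h_ddbar \<mu> C n z) \<partial>lborel) = 2 * (\<integral>z. indicator (\<Omega> - {p}) z *\<^sub>R h_ddbar \<mu> C n z \<partial>lborel)"
      by (subst integral_mult_right_zero[symmetric]) (simp add: mult_ac)
    then show ?thesis unfolding I eqR integral_complex_of_real by simp
  qed
  have "contour_integral \<Gamma> G = 2 * \<i> * of_real \<sigma> * (\<integral>z. indicator (inside (path_image \<Gamma>) - {p}) z *\<^sub>R ?R z \<partial>lborel)"
  proof (rule green_inside_punctured[OF der01 c01 loop wn pin])
    show "open U" unfolding U_def using op open_positive_set by auto
    show "inside (path_image \<Gamma>) \<union> path_image \<Gamma> \<subseteq> U"
      unfolding U_def Om using pos(5) by (auto simp: path_image_def)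
    show "wirtinger G (h_dd \<mu> C n z - of_nat n / 2 * (1 / (z - p)\<^sup>2)) (?R z) z" if z: "z \<in> U - {p}" for z
    proof -
      have "((\<lambda>z. of_nat n / 2 * (1 / (z - p))) has_field_derivative - (of_nat n / 2 * (1 / (z - p)\<^sup>2))) (at z)"
      proof -
        have "((\<lambda>z. 1 / (z - p)) has_field_derivative - (1 / (z - p)\<^sup>2)) (at z)"
          using z by (auto intro!: derivative_eq_intros simp: power2_eq_square)
        from DERIV_cmult[OF this, of "of_nat n / 2"] show ?thesis by simp
      qed
      from has_derivative_add[OF h_grad_wirtinger wirtinger_field_derivative[OF this], of \<mu> C n] z Up
      have "((\<lambda>z. h_grad \<mu> C n z + of_nat n / 2 * (1 / (z - p))) has_derivative (\<lambda>v. h_dd \<mu> C n z * v + ?R z * cnj v + (- (of_nat n / 2 * (1 / (z - p)\<^sup>2)) * v + 0 * cnj v))) (at z)"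
        by blast
      then show ?thesis unfolding G_def[abs_def]
        by (rule has_derivative_eq_rhs) (simp add: fun_eq_iff left_diff_distrib)
    qed
    show "continuous_on (U - {p}) (\<lambda>z. h_dd \<mu> C n z - of_nat n / 2 * (1 / (z - p)\<^sup>2))"
      by (intro continuous_intros continuous_on_subset[OF continuous_h_parts(2) Up]) auto
    show "continuous_on (U - {p}) ?R"
      by (intro continuous_intros continuous_on_subset[OF continuous_h_parts(3) Up])
    have "((\<lambda>z. (z + \<mu>) * h_grad \<mu> C n z + of_nat n / 2) \<longlongrightarrow> - of_nat n / 2 + of_nat n / 2) (at (- complex_of_real \<mu>))"
      using mu n by (intro tendsto_intros h_grad_near) auto
    then have "((\<lambda>z. (z + \<mu>) * h_grad \<mu> C n z + of_nat n / 2) \<longlongrightarrow> 0) (at p)" by (simp add: p_def)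
    moreover have "\<forall>\<^sub>F z in at p. (z + \<mu>) * h_grad \<mu> C n z + of_nat n / 2 = (z - p) * G z"
    proof -
      have "(z + \<mu>) * h_grad \<mu> C n z + of_nat n / 2 = (z - p) * G z" if "z \<noteq> p" for z
      proof -
        have "z + \<mu> = z - p" by (simp add: p_def)
        moreover have "w * (h + k * (1 / w)) = w * h + k" if "w \<noteq> 0" for w h k :: complex
          using that by (simp add: distrib_left)
        ultimately show ?thesis using that by (simp only: G_def right_minus_eq not_False_eq_True)
      qed
      then show ?thesis by (simp add: eventually_at_filter)
    qed
    ultimately show "((\<lambda>z. (z - p) * G z) \<longlongrightarrow> 0) (at p)"
      using Lim_transform_eventually by fast
    show "integrable lborel (\<lambda>z. indicator (inside (path_image \<Gamma>) - {p}) z *\<^sub>R ?R z)"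
      unfolding Om[symmetric] eqR using int2 by (rule integrable_of_real)
  qed
  then have green: "contour_integral \<Gamma> G = \<i> * of_real (\<sigma> * integral (\<Omega> - {p}) (laplacian (h_tilde \<mu> C n)))"
    unfolding Om[symmetric] IR by simp
  have vp: "valid_path \<Gamma>" by (rule C1_path_valid[OF der01 c01])
  have ch: "continuous_on (path_image \<Gamma>) (h_grad \<mu> C n)"
    by (rule continuous_on_subset[OF continuous_h_parts(1)]) (use pos(5) in \<open>auto simp: path_image_def\<close>)
  have cp: "continuous_on (path_image \<Gamma>) (\<lambda>z. of_nat n / 2 * (1 / (z - p)))"
    using pni by (intro continuous_intros) auto
  have cG: "continuous_on (path_image \<Gamma>) G" unfolding G_def by (intro continuous_on_add ch cp)
  have ii: "(\<lambda>t. f (\<Gamma> t) * \<Gamma>' t) integrable_on {0..1}" if "continuous_on (path_image \<Gamma>) f" for f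
    by (intro integrable_continuous_real continuous_intros c01 continuous_on_compose2[OF that cont]) (auto simp: path_image_def)
  have "contour_integral \<Gamma> G = contour_integral \<Gamma> (h_grad \<mu> C n) + contour_integral \<Gamma> (\<lambda>z. of_nat n / 2 * (1 / (z - p)))"
    unfolding C1_contour_integral(2)[OF der01 c01 cG] C1_contour_integral(2)[OF der01 c01 ch] C1_contour_integral(2)[OF der01 c01 cp]
    by (subst Henstock_Kurzweil_Integration.integral_add[OF ii[OF ch] ii[OF cp], symmetric]) (simp only: G_def distrib_right)
  also have "contour_integral \<Gamma> (\<lambda>z. of_nat n / 2 * (1 / (z - p))) = of_nat n / 2 * contour_integral \<Gamma> (\<lambda>z. 1 / (z - p))"
    by (rule contour_integral_lmul) (rule contour_integrable_inversediff[OF vp pni, unfolded inverse_eq_divide])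
  also have "contour_integral \<Gamma> (\<lambda>z. 1 / (z - p)) = 2 * pi * \<i> * of_real \<sigma>"
    using winding_number_valid_path[OF vp pni] wn[OF pin] by (simp add: field_simps)
  also have "contour_integral \<Gamma> (h_grad \<mu> C n) = - 2 * pi * \<i> * of_nat n * of_real \<sigma> - 2 * \<i> * of_real T"
    by (rule turning_identity[OF curve lifted vel wn])
  finally have "\<i> * of_real (\<sigma> * integral (\<Omega> - {p}) (laplacian (h_tilde \<mu> C n)))
     = - 2 * pi * \<i> * of_nat n * of_real \<sigma> - 2 * \<i> * of_real T + of_nat n / 2 * (2 * pi * \<i> * of_real \<sigma>)"
    unfolding green .
  also have "\<dots> = \<i> * of_real (- real n * pi * \<sigma> - 2 * T)" by (simp add: algebra_simps)
  finally have "\<sigma> * integral (\<Omega> - {p}) (laplacian (h_tilde \<mu> C n)) = - real n * pi * \<sigma> - 2 * T"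
    by (simp only: mult_cancel_left complex_i_not_zero of_real_eq_iff) simp
  then show ?thesis by (simp add: p_def algebra_simps)
qed

text \<open>Near the centre the bound \<open>M / norm (z + \<mu>)\<close> is integrable. The rest of
  the closed region is compact and contained in \<open>positive_set\<close>, boundary curve
  included, so \<open>h_ddbar\<close> is bounded there.\<close>

lemma laplacian_integrable:
  defines "\<Omega> \<equiv> inside (\<beta> ` {0..T})"
  assumes D: "\<Omega> - {- of_real \<mu>} \<subseteq> positive_set \<mu> C n"
  shows "laplacian (h_tilde \<mu> C n) absolutely_integrable_on (\<Omega> - {- of_real \<mu>})"
proof -
  obtain \<Gamma> \<Gamma>' where curve: "periodic_C1_jordan_curve \<Gamma> \<Gamma>'" and lifted: "\<And>s. s \<in> {0..1} \<Longrightarrow> \<Gamma> s = \<beta> (T * s)"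
    and vel: "\<And>s. s \<in> {0..1} \<Longrightarrow> T * velocity \<alpha> (T * s) = phi' \<mu> n (\<Gamma> s) * \<Gamma>' s"
    using lifting_extension by blast
  interpret periodic_C1_jordan_curve \<Gamma> \<Gamma>' by (rule curve)
  note pos = curve_positive[OF curve lifted vel]
  define p where "p = - complex_of_real \<mu>"
  have im: "path_image \<Gamma> = \<beta> ` {0..T}" by (rule path_image_eq[OF lifted])
  then have Om: "\<Omega> = inside (path_image \<Gamma>)" by (simp add: \<Omega>_def)
  have cl: "closed (path_image \<Gamma>)" by (simp add: closed_path_image path)
  have op: "open \<Omega>" unfolding Om using cl by (rule open_inside)
  define K where "K = \<Omega> \<union> path_image \<Gamma>"
  have "K = - outside (path_image \<Gamma>)" unfolding K_def Om by (simp add: union_with_inside Un_commute)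
  then have "closed K" using open_outside[OF cl] by (simp add: closed_def)
  moreover have bK: "bounded K" unfolding K_def Om
    using compact_path_image[OF path] by (simp add: bounded_inside compact_imp_bounded)
  ultimately have K: "compact K" by (simp add: compact_eq_bounded_closed)
  have mu1: "\<mu> < 1" using mu by simp
  obtain r M where rM: "r > 0" "\<And>z. z \<noteq> - complex_of_real \<mu> \<Longrightarrow> norm (z + \<mu>) < r \<Longrightarrow> \<bar>h_ddbar \<mu> C n z\<bar> \<le> M / norm (z + \<mu>)"
    by (rule h_ddbar_near[OF mu1 n, of C]) (rule that)
  have KP: "K - ball p r \<subseteq> positive_set \<mu> C n"
    using D pos(5) rM(1) unfolding K_def p_def by (auto simp: path_image_def)
  have "compact (h_ddbar \<mu> C n ` (K - ball p r))"
    by (intro compact_continuous_image continuous_on_subset[OF continuous_h_parts(3) KP] compact_diff K) auto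
  then obtain B where B: "B > 0" "\<And>z. z \<in> K - ball p r \<Longrightarrow> \<bar>h_ddbar \<mu> C n z\<bar> \<le> B"
    using compact_imp_bounded bounded_pos by (metis image_eqI real_norm_def)
  obtain N where N: "\<And>z. z \<in> K \<Longrightarrow> norm z \<le> N" using bK bounded_iff by metis
  have Dm: "\<Omega> - {p} \<in> sets borel" using op by (intro borel_open) (simp add: open_delete)
  have lap: "laplacian (h_tilde \<mu> C n) z = 2 * h_ddbar \<mu> C n z" if "z \<in> \<Omega> - {p}" for z
    using that D by (intro laplacian_h) (auto simp: p_def)
  have m: "(\<lambda>z. indicator (\<Omega> - {p}) z *\<^sub>R (2 * h_ddbar \<mu> C n z)) \<in> borel_measurable lborel"
  proof -
    have "continuous_on (\<Omega> - {p}) (\<lambda>z. 2 * h_ddbar \<mu> C n z)"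
      by (intro continuous_intros continuous_on_subset[OF continuous_h_parts(3)]) (use D in \<open>auto simp: p_def\<close>)
    from borel_measurable_continuous_on_indicator[OF Dm this] show ?thesis by simp
  qed
  have i1: "integrable lborel (\<lambda>z. 2 * B * indicator (cball 0 N) z + 2 * \<bar>M\<bar> * (indicator (cball 0 N) z / norm (z - p)))"
    by (intro Bochner_Integration.integrable_add integrable_mult_right integrable_inverse_norm_cball integrable_real_indicator)
       (auto simp: emeasure_lborel_cball_finite[unfolded infinity_ennreal_def])
  have bd: "norm (indicator (\<Omega> - {p}) z *\<^sub>R (2 * h_ddbar \<mu> C n z)) 
     \<le> 2 * B * indicator (cball 0 N) z + 2 * \<bar>M\<bar> * (indicator (cball 0 N) z / norm (z - p))" for z
  proof (cases "z \<in> \<Omega> - {p}")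
    case True
    then have zN: "z \<in> cball 0 N" using N by (simp add: K_def)
    have "\<bar>h_ddbar \<mu> C n z\<bar> \<le> B + \<bar>M\<bar> / norm (z - p)"
    proof (cases "z \<in> ball p r")
      case zr: True
      then have "\<bar>h_ddbar \<mu> C n z\<bar> \<le> M / norm (z + \<mu>)"
        using True by (intro rM(2)) (auto simp: p_def dist_norm norm_minus_commute)
      also have "\<dots> \<le> \<bar>M\<bar> / norm (z - p)" by (simp add: p_def divide_right_mono)
      finally show ?thesis using B(1) by simp
    next
      case False
      then have "\<bar>h_ddbar \<mu> C n z\<bar> \<le> B" using True by (intro B(2)) (auto simp: K_def)
      then show ?thesis by (simp add: add_increasing2)
    qed
    then show ?thesis using True zN by (simp add: abs_mult)
  qed (use B(1) in simp)
  have "integrable lborel (\<lambda>z. indicator (\<Omega> - {p}) z *\<^sub>R (2 * h_ddbar \<mu> C n z))"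
    by (rule Bochner_Integration.integrable_bound[OF i1 m]) (use order_trans[OF bd abs_ge_self] in simp)
  then have "integrable lebesgue (\<lambda>z. indicator (\<Omega> - {p}) z *\<^sub>R (2 * h_ddbar \<mu> C n z))"
    using m by (simp only: integrable_completion)
  moreover have "(\<lambda>z. indicator (\<Omega> - {p}) z *\<^sub>R laplacian (h_tilde \<mu> C n) z) = (\<lambda>z. indicator (\<Omega> - {p}) z *\<^sub>R (2 * h_ddbar \<mu> C n z))"
    using lap by (auto simp: indicator_def fun_eq_iff)
  ultimately show ?thesis unfolding set_integrable_def p_def[symmetric] by simp
qed

end

text \<open>If \<open>f_tilde\<close> vanishes somewhere in \<open>D\<close>, the area integral does
  not converge absolutely, so both formulas carry integrability as a premise. The first conjunct
  supplies that premise whenever \<open>f_tilde\<close> is positive on \<open>D\<close>.\<close>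

theorem theorem3p2:
  fixes \<mu> C T :: real and n :: nat and \<alpha> \<beta> :: "real \<Rightarrow> complex"
  assumes "0 < \<mu>" and "\<mu> \<le> 1 / 2" and "n \<ge> 1"
    and "is_solution \<mu> \<alpha>"
    and "has_jacobian_integral \<mu> \<alpha> C"
    and "periodic_with T \<alpha>"
    and "n_simple_with_lifting n (- of_real \<mu>) T \<alpha> \<beta>"
  shows
    "let \<Omega> = enclosed_region T \<beta>;
         D = \<Omega> - {- of_real \<mu>};
         \<Delta>h = laplacian (h_tilde \<mu> C n);
         in_U = (phi \<mu> n ` \<Omega> \<subseteq> U_region \<mu> C \<union> {- of_real \<mu>})
     in (in_U \<and> (\<forall>z\<in>D. f_tilde \<mu> C n z > 0) \<longrightarrow> \<Delta>h absolutely_integrable_on D) \<and>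
        (goes_clockwise T \<beta> \<and> in_U \<and> \<Delta>h absolutely_integrable_on D
           \<longrightarrow> 2 * T = real n * pi + integral D \<Delta>h) \<and>
        (goes_counterclockwise T \<beta> \<and> in_U \<and> \<Delta>h absolutely_integrable_on D
           \<longrightarrow> 2 * T = - real n * pi - integral D \<Delta>h)"
proof -
  define \<Omega> where "\<Omega> = inside (\<beta> ` {0..T})"
  define D where "D = \<Omega> - {- complex_of_real \<mu>}"
  define \<Delta>h where "\<Delta>h = laplacian (h_tilde \<mu> C n)"
  define in_U where "in_U \<longleftrightarrow> phi \<mu> n ` \<Omega> \<subseteq> U_region \<mu> C \<union> {- of_real \<mu>}"
  obtain \<Gamma> \<Gamma>' where curve: "periodic_C1_jordan_curve \<Gamma> \<Gamma>'" and lifted: "\<And>s. s \<in> {0..1} \<Longrightarrow> \<Gamma> s = \<beta> (T * s)"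
    by (rule lifting_extension[OF assms]) (rule that)
  interpret periodic_C1_jordan_curve \<Gamma> \<Gamma>' by (rule curve)
  have "path_image \<Gamma> = \<beta> ` {0..T}" by (rule path_image_eq[OF assms]) (rule lifted)
  moreover have "open (inside (path_image \<Gamma>))" by (intro open_inside closed_path_image path)
  ultimately have "open \<Omega>" by (simp add: \<Omega>_def)
  then have D: "open D" "- complex_of_real \<mu> \<notin> D" by (auto simp: D_def open_delete)
  note reg = regular_nonneg[of \<mu> n \<Omega> C, folded D_def in_U_def]
  have positive: "D \<subseteq> positive_set \<mu> C n" if "in_U" "\<Delta>h absolutely_integrable_on D"
  proof
    fix z assume z: "z \<in> D"
    have "f_sq \<mu> C n z > 0"
      by (rule f_sq_positive_if_laplacian_integrable[OF _ _ _ D(1) _ D(2) reg(2)[OF that(1)] that(2)[unfolded \<Delta>h_def] z])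
         (use assms(1-3) reg(1)[OF that(1)] in auto)
    then show "z \<in> positive_set \<mu> C n" using reg(1)[OF that(1) z] by (simp add: positive_set_def)
  qed
  have formula: "2 * T = - \<sigma> * (real n * pi + integral D \<Delta>h)"
    if "in_U" "\<Delta>h absolutely_integrable_on D" "\<And>z. z \<in> \<Omega> \<Longrightarrow> winding_number (\<lambda>s. \<beta> (T * s)) z = of_real \<sigma>" for \<sigma> :: real
    using period_formula[OF assms, of \<sigma>] positive[OF that(1,2)] that(2,3)
    by (simp add: D_def \<Omega>_def \<Delta>h_def)
  have "in_U \<and> (\<forall>z\<in>D. f_tilde \<mu> C n z > 0) \<longrightarrow> \<Delta>h absolutely_integrable_on D"
  proof (intro impI, elim conjE)
    assume U: "in_U" and f: "\<forall>z\<in>D. f_tilde \<mu> C n z > 0"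
    have "D \<subseteq> positive_set \<mu> C n"
      using f reg(1)[OF U] by (auto simp: positive_set_def f_tilde_def f_sq_def)
    then show "\<Delta>h absolutely_integrable_on D"
      using laplacian_integrable[OF assms] by (simp add: D_def \<Omega>_def \<Delta>h_def)
  qed
  moreover have "2 * T = real n * pi + integral D \<Delta>h" 
    if "goes_clockwise T \<beta>" "in_U" "\<Delta>h absolutely_integrable_on D"
    using formula[of "-1"] that by (simp add: goes_clockwise_def enclosed_region_def \<Omega>_def)
  moreover have "2 * T = - real n * pi - integral D \<Delta>h" 
    if "goes_counterclockwise T \<beta>" "in_U" "\<Delta>h absolutely_integrable_on D"
    using formula[of 1] that by (simp add: goes_counterclockwise_def enclosed_region_def \<Omega>_def)
  ultimately show ?thesis
    unfolding Let_def enclosed_region_def \<Omega>_def[symmetric] D_def[symmetric] \<Delta>h_def[symmetric] in_U_def[symmetric]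
    by blast
qed

end
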